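(* Let $(M,H)$ and $(M',H')$ be Carnot manifolds of step $r$, of dimensions $n$ and $n'$, let $\phi:M\to M'$ be a Carnot manifold map, let $a\in M$ and set $a'=\phi(a)$. Let $(X_1,\ldots,X_n)$ be an $H$-frame near $a$ and $(X_1',\ldots,X_{n'}')$ an $H'$-frame near $a'$. Let $(x_1,\ldots,x_n)$ be Carnot coordinates at $a$ adapted to $(X_1,\ldots,X_n)$ and $(x_1',\ldots,x_{n'}')$ Carnot coordinates at $a'$ adapted to $(X_1',\ldots,X_{n'}')$. Then, in these coordinates, $$\phi(x)=\hat\phi'(a)x+\mathrm O_w(\|x\|^{w+1})\qquad\text{near }x=0,$$ where the Carnot differential $\hat\phi'(a)$ is regarded as a $w$-homogeneous group map from $G(a)$ to $G'(a')$.
   Context: All manifolds, bundles, vector fields and maps are smooth. A Carnot manifold of step $r$ is a pair $(M,H)$, where $M$ is a manifold and $H=(H_1,\ldots,H_r)$ is a filtration of vector subbundles $H_1\subset\cdots\subset H_r=TM$ such that $[X,Y]$ is a section of $H_{w+w'}$ whenever $X$ is a section of $H_w$, $Y$ is a section of $H_{w'}$ and $w+w'\le r$. A Carnot manifold map between step $r$ Carnot manifolds is a smooth map $\phi:M\to M'$ such that $\phi'(x)(H_j(x))\subset H'_j(\phi(x))$ for all $x\in M$, $j=1,\ldots,r$. Tangent groups. Set $H_0=\{0\}$, $\mathfrak g_wM=H_w/H_{w-1}$, $\mathfrak gM=\mathfrak g_1M\oplus\cdots\oplus\mathfrak g_rM$. Each fiber $\mathfrak gM(a)$ is a graded nilpotent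 Lie algebra: if $\xi\in\mathfrak g_wM(a)$, $\eta\in\mathfrak g_{w'}M(a)$ are the classes of $X(a)$, $Y(a)$ with $X$, $Y$ sections near $a$ of $H_w$, $H_{w'}$, then $[\xi,\eta]$ is the class of $[X,Y](a)$ in $\mathfrak g_{w+w'}M(a)$ if $w+w'\le r$, and $0$ otherwise. The tangent group $GM(a)$ is $\mathfrak gM(a)$ with the Dynkin (Baker-Campbell-Hausdorff) product. The Carnot differential $\hat\phi'(a):\mathfrak gM(a)\to\mathfrak gM'(\phi(a))$ is the direct sum over $w=1,\ldots,r$ of the linear maps $\mathfrak g_wM(a)\to\mathfrak g_wM'(\phi(a))$ induced by $\phi'(a)$; it is a group map $GM(a)\to GM'(\phi(a))$. Weights and frames. With $n=\dim M$, the weight sequence of $(M,H)$ is $w_j=\min\{w: j\le\operatorname{rk}H_w\}$, $j=1,\ldots,n$; that of $(M',H')$ is denoted $(w_1',\ldots,w'_{n'})$. An $H$-frame over an open set is a tangent frame $(X_1,\ldots,X_n)$ such that $X_j$ is a section of $H_{w_j}$. Then $[X_i,X_j]=\sum_{w_k\le w_i+w_j}L_{ij}^kX_k$ with smooth functions $L_{ij}^k$. The classes $\xi_j(a)$ of $X_j(a)$ in $\mathfrak g_{w_j}M(a)$ form a graded basis of $\mathfrak gM(a)$. The group $G(a)$ is $\mathbb R^n$ with the Dynkin product of the Lie bracket on $\mathbb R^n$ given on the canonical basis by $[e_i,e_j]=\sum_{w_k=w_i+w_j}L_{ij}^k(a)e_k$ (zero if $w_i+w_j>r$); the basis $(\xi_j(a))$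 identifies $GM(a)$ with $G(a)$. The group $G'(a')$ on $\mathbb R^{n'}$ is defined likewise from $(X'_1,\ldots,X'_{n'})$. Using these bases, $\hat\phi'(a)$ is regarded as a linear map $\mathbb R^n=G(a)\to\mathbb R^{n'}=G'(a')$. Dilations and $\mathrm O_w$. Dilations on $\mathbb R^n$: $\delta_t(x)=t\cdot x=(t^{w_1}x_1,\ldots,t^{w_n}x_n)$, and similarly on $\mathbb R^{n'}$ with weights $w_k'$. A map $\Theta:\mathbb R^n\to\mathbb R^{n'}$ is $w$-homogeneous if $\Theta(t\cdot x)=t\cdot\Theta(x)$ for all $x$ and $t\in\mathbb R$. Fix a pseudo-norm on $\mathbb R^n$: a continuous function $\|\cdot\|\ge0$, positive off $0$, with $\|t\cdot x\|=|t|\|x\|$ (e.g. $\sum_j|x_j|^{1/w_j}$; the choice is irrelevant). For $m\in\mathbb N_0$, a map $\Theta=(\Theta_1,\ldots,\Theta_{n'})$ from a neighborhood of $0\in\mathbb R^n$ to $\mathbb R^{n'}$ is $\mathrm O_w(\|x\|^{w+m})$ if $\Theta_k(x)=\mathrm O(\|x\|^{w_k'+m})$ near $x=0$ for $k=1,\ldots,n'$. Carnot coordinates. Let $X_j^a$ be the left-invariant vector field on $G(a)$ equal to $\partial_j$ at $0$. Local coordinates centered at $a$ with range $U\subset\mathbb R^n$ are Carnot coordinates at $a$ adapted to $(X_1,\ldots,X_n)$ if, in these coordinates, (i) $X_j(0)=\partial_j$ for all $j$, and (ii) for all $j$, $t^{w_j}\delta_t^*X_j=X_j^a+\mathrm O(t)$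 as $t\to0$ in the $C^\infty$ topology of vector fields on $U$, where for $X=\sum_pb_p(x)\partial_p$ one has $\delta_t^*X=\sum_pt^{-w_p}b_p(t\cdot x)\partial_p$. The coordinates at $a$ are taken with small enough range so that $\phi$ maps their domain into the domain of the coordinates at $a'$; $\phi(x)$ denotes $\phi$ read in the two coordinate systems. *)

theory Defs
  imports
    "HOL-Analysis.Analysis"
    "HOL-Library.Function_Algebras"
    "HOL-Library.Landau_Symbols"
begin

text \<open>
  Conventions. The model space of a manifold of dimension \<open>n\<close> is \<open>real ^ 'n\<close> with \<open>CARD('n) = n\<close>;
  the index type \<open>'n\<close> is linearly ordered, which plays the role of the numbering \<open>1, \<dots>, n\<close>.
\<close>


section \<open>Smooth maps between Euclidean spaces\<close>

text \<open>Both notions are meant for open \<open>S\<close> only.\<close>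

primrec Ck_on :: "nat \<Rightarrow> 'a::real_normed_vector set \<Rightarrow> ('a \<Rightarrow> 'b::real_normed_vector) \<Rightarrow> bool" where
  "Ck_on 0 S f \<longleftrightarrow> continuous_on S f"
| "Ck_on (Suc k) S f \<longleftrightarrow>
     (\<forall>x\<in>S. f differentiable (at x)) \<and>
     (\<forall>v. Ck_on k S (\<lambda>x. frechet_derivative f (at x) v))"

definition smooth_on :: "'a::real_normed_vector set \<Rightarrow> ('a \<Rightarrow> 'b::real_normed_vector) \<Rightarrow> bool" where
  "smooth_on S f \<longleftrightarrow> (\<forall>k. Ck_on k S f)"

primrec iterated_partial ::
    "'n list \<Rightarrow> (real ^ 'n \<Rightarrow> 'b::real_normed_vector) \<Rightarrow> real ^ 'n \<Rightarrow> 'b" where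
  "iterated_partial [] f = f"
| "iterated_partial (i # is) f =
     (\<lambda>x. frechet_derivative (iterated_partial is f) (at x) (axis i 1))"


section \<open>Smooth manifolds\<close>

type_synonym ('m, 'n) chart = "'m set \<times> ('m \<Rightarrow> real ^ 'n)"

abbreviation chart_inv :: "('m, 'n::finite) chart \<Rightarrow> real ^ 'n \<Rightarrow> 'm" where
  "chart_inv \<kappa> \<equiv> inv_into (fst \<kappa>) (snd \<kappa>)"

record ('m, 'n) mfd =
  mtop :: "'m topology"
  atlas :: "('m, 'n) chart set"

abbreviation points :: "('m, 'n::finite) mfd \<Rightarrow> 'm set" where
  "points M \<equiv> topspace (mtop M)"

definition topological_chart :: "'m topology \<Rightarrow> ('m, 'n::finite) chart \<Rightarrow> bool" where
  "topological_chart T \<kappa> \<longleftrightarrow>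
     openin T (fst \<kappa>) \<and> open (snd \<kappa> ` fst \<kappa>) \<and>
     homeomorphic_map (subtopology T (fst \<kappa>)) (top_of_set (snd \<kappa> ` fst \<kappa>)) (snd \<kappa>)"

definition smooth_compatible :: "('m, 'n::finite) chart \<Rightarrow> ('m, 'n) chart \<Rightarrow> bool" where
  "smooth_compatible \<kappa> \<kappa>' \<longleftrightarrow>
     smooth_on (snd \<kappa> ` (fst \<kappa> \<inter> fst \<kappa>')) (snd \<kappa>' \<circ> chart_inv \<kappa>) \<and>
     smooth_on (snd \<kappa>' ` (fst \<kappa> \<inter> fst \<kappa>')) (snd \<kappa> \<circ> chart_inv \<kappa>')"

text \<open>The atlas is maximal, so that ``local coordinates'' means ``member of the atlas''.\<close>

definition smooth_manifold :: "('m, 'n::finite) mfd \<Rightarrow> bool" where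
  "smooth_manifold M \<longleftrightarrow>
     Hausdorff_space (mtop M) \<and> second_countable (mtop M) \<and>
     (\<forall>\<kappa>\<in>atlas M. topological_chart (mtop M) \<kappa>) \<and>
     (\<Union>\<kappa>\<in>atlas M. fst \<kappa>) = points M \<and>
     (\<forall>\<kappa>\<in>atlas M. \<forall>\<kappa>'\<in>atlas M. smooth_compatible \<kappa> \<kappa>') \<and>
     (\<forall>\<kappa>. topological_chart (mtop M) \<kappa> \<and> (\<forall>\<kappa>'\<in>atlas M. smooth_compatible \<kappa> \<kappa>') \<longrightarrow> \<kappa> \<in> atlas M)"

definition chart_rep ::
    "('m, 'n::finite) chart \<Rightarrow> ('m', 'k::finite) chart \<Rightarrow> ('m \<Rightarrow> 'm') \<Rightarrow> real ^ 'n \<Rightarrow> real ^ 'k" where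
  "chart_rep \<kappa> \<kappa>' \<phi> = (\<lambda>x. snd \<kappa>' (\<phi> (chart_inv \<kappa> x)))"

definition smooth_map ::
    "('m, 'n::finite) mfd \<Rightarrow> ('m', 'k::finite) mfd \<Rightarrow> ('m \<Rightarrow> 'm') \<Rightarrow> bool" where
  "smooth_map M M' \<phi> \<longleftrightarrow>
     continuous_map (mtop M) (mtop M') \<phi> \<and>
     (\<forall>\<kappa>\<in>atlas M. \<forall>\<kappa>'\<in>atlas M'.
        smooth_on (snd \<kappa> ` {p \<in> fst \<kappa>. \<phi> p \<in> fst \<kappa>'}) (chart_rep \<kappa> \<kappa>' \<phi>))"


section \<open>Tangent vectors\<close>

instantiation "fun" :: (type, real_vector) real_vector
begin

definition scaleR_fun :: "real \<Rightarrow> ('a \<Rightarrow> 'b) \<Rightarrow> 'a \<Rightarrow> 'b" where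
  "scaleR_fun c f = (\<lambda>x. c *\<^sub>R f x)"

instance
  by standard (auto simp: scaleR_fun_def plus_fun_def algebra_simps)

end

text \<open>
  A tangent vector at \<open>p\<close> is the family of its coordinate representations in all charts around \<open>p\<close>,
  related by the derivatives of the coordinate changes. It is extended by zero to
  all other charts, so that distinct families are distinct tangent vectors. The vector space
  structure is pointwise.
\<close>

type_synonym ('m, 'n) tangent = "('m, 'n) chart \<Rightarrow> real ^ 'n"

definition charts_at :: "('m, 'n::finite) mfd \<Rightarrow> 'm \<Rightarrow> ('m, 'n) chart set" where
  "charts_at M p = {\<kappa> \<in> atlas M. p \<in> fst \<kappa>}"

definition tangent_space :: "('m, 'n::finite) mfd \<Rightarrow> 'm \<Rightarrow> ('m, 'n) tangent set" where
  "tangent_space M p = {v.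
     (\<forall>\<kappa>\<in>charts_at M p. \<forall>\<kappa>'\<in>charts_at M p.
        v \<kappa>' = frechet_derivative (snd \<kappa>' \<circ> chart_inv \<kappa>) (at (snd \<kappa> p)) (v \<kappa>)) \<and>
     (\<forall>\<kappa>. \<kappa> \<notin> charts_at M p \<longrightarrow> v \<kappa> = 0)}"

definition differential ::
    "('m, 'n::finite) mfd \<Rightarrow> ('m', 'k::finite) mfd \<Rightarrow> ('m \<Rightarrow> 'm') \<Rightarrow> 'm \<Rightarrow>
     ('m, 'n) tangent \<Rightarrow> ('m', 'k) tangent" where
  "differential M M' \<phi> p v = (THE u. u \<in> tangent_space M' (\<phi> p) \<and>
     (\<forall>\<kappa>\<in>charts_at M p. \<forall>\<kappa>'\<in>charts_at M' (\<phi> p).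
        u \<kappa>' = frechet_derivative (chart_rep \<kappa> \<kappa>' \<phi>) (at (snd \<kappa> p)) (v \<kappa>)))"

definition field_rep ::
    "('m, 'n::finite) chart \<Rightarrow> ('m \<Rightarrow> ('m, 'n) tangent) \<Rightarrow> real ^ 'n \<Rightarrow> real ^ 'n" where
  "field_rep \<kappa> X = (\<lambda>x. X (chart_inv \<kappa> x) \<kappa>)"

definition vector_field_on ::
    "('m, 'n::finite) mfd \<Rightarrow> 'm set \<Rightarrow> ('m \<Rightarrow> ('m, 'n) tangent) \<Rightarrow> bool" where
  "vector_field_on M V X \<longleftrightarrow>
     (\<forall>p\<in>V. X p \<in> tangent_space M p) \<and>
     (\<forall>\<kappa>\<in>atlas M. smooth_on (snd \<kappa> ` (fst \<kappa> \<inter> V)) (field_rep \<kappa> X))"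

definition lie_bracket ::
    "('m, 'n::finite) mfd \<Rightarrow> ('m \<Rightarrow> ('m, 'n) tangent) \<Rightarrow> ('m \<Rightarrow> ('m, 'n) tangent) \<Rightarrow>
     'm \<Rightarrow> ('m, 'n) tangent" where
  "lie_bracket M X Y p = (\<lambda>\<kappa>.
     if \<kappa> \<in> charts_at M p
     then frechet_derivative (field_rep \<kappa> Y) (at (snd \<kappa> p)) (X p \<kappa>)
        - frechet_derivative (field_rep \<kappa> X) (at (snd \<kappa> p)) (Y p \<kappa>)
     else 0)"


section \<open>Vector subbundles and Carnot manifolds\<close>

definition basis_family :: "('i \<Rightarrow> 'v::real_vector) \<Rightarrow> 'i set \<Rightarrow> 'v set \<Rightarrow> bool" where
  "basis_family v I S \<longleftrightarrow> inj_on v I \<and> independent (v ` I) \<and> span (v ` I) = S"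

definition subbundle_of_rank ::
    "('m, 'n::finite) mfd \<Rightarrow> nat \<Rightarrow> ('m \<Rightarrow> ('m, 'n) tangent set) \<Rightarrow> bool" where
  "subbundle_of_rank M k E \<longleftrightarrow>
     (\<forall>p\<in>points M. \<exists>V Y. openin (mtop M) V \<and> p \<in> V \<and>
        (\<forall>i<k. vector_field_on M V (Y i)) \<and>
        (\<forall>q\<in>V. basis_family (\<lambda>i. Y i q) {..<k} (E q)))"

definition rk :: "('m, 'n::finite) mfd \<Rightarrow> ('m \<Rightarrow> ('m, 'n) tangent set) \<Rightarrow> nat" where
  "rk M E = (THE k. subbundle_of_rank M k E)"

definition section_on ::
    "('m, 'n::finite) mfd \<Rightarrow> ('m \<Rightarrow> ('m, 'n) tangent set) \<Rightarrow> 'm set \<Rightarrow>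
     ('m \<Rightarrow> ('m, 'n) tangent) \<Rightarrow> bool" where
  "section_on M E V X \<longleftrightarrow> vector_field_on M V X \<and> (\<forall>p\<in>V. X p \<in> E p)"

text \<open>
  \<open>H w p\<close> is the fiber of the \<open>w\<close>-th subbundle at \<open>p\<close>, with the convention that \<open>H 0\<close> is the zero
  bundle; values for \<open>w > r\<close> are irrelevant. The bracket condition is imposed on sections over
  arbitrary open sets.
\<close>

type_synonym ('m, 'n) filtration = "nat \<Rightarrow> 'm \<Rightarrow> ('m, 'n) tangent set"

definition carnot_manifold :: "nat \<Rightarrow> ('m, 'n::finite) mfd \<Rightarrow> ('m, 'n) filtration \<Rightarrow> bool" where
  "carnot_manifold r M H \<longleftrightarrow>
     1 \<le> r \<and> smooth_manifold M \<and>
     (\<forall>w\<in>{1..r}. \<exists>k. subbundle_of_rank M k (H w)) \<and>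
     (\<forall>p\<in>points M.
        H 0 p = {0} \<and> (\<forall>w\<in>{1..<r}. H w p \<subseteq> H (Suc w) p) \<and> H r p = tangent_space M p) \<and>
     (\<forall>V w w' X Y.
        openin (mtop M) V \<and> 1 \<le> w \<and> 1 \<le> w' \<and> w + w' \<le> r \<and>
        section_on M (H w) V X \<and> section_on M (H w') V Y \<longrightarrow>
        section_on M (H (w + w')) V (lie_bracket M X Y))"

definition carnot_map ::
    "nat \<Rightarrow> ('m, 'n::finite) mfd \<Rightarrow> ('m, 'n) filtration \<Rightarrow>
     ('m', 'k::finite) mfd \<Rightarrow> ('m', 'k) filtration \<Rightarrow> ('m \<Rightarrow> 'm') \<Rightarrow> bool" where
  "carnot_map r M H M' H' \<phi> \<longleftrightarrow>
     smooth_map M M' \<phi> \<and>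
     (\<forall>p\<in>points M. \<forall>w\<in>{1..r}. differential M M' \<phi> p ` H w p \<subseteq> H' w (\<phi> p))"

definition weight ::
    "('m, 'n::{finite,linorder}) mfd \<Rightarrow> ('m, 'n) filtration \<Rightarrow> 'n \<Rightarrow> nat" where
  "weight M H j = (LEAST w. card {..j} \<le> rk M (H w))"

definition H_frame_on ::
    "('m, 'n::{finite,linorder}) mfd \<Rightarrow> ('m, 'n) filtration \<Rightarrow> 'm set \<Rightarrow>
     ('n \<Rightarrow> 'm \<Rightarrow> ('m, 'n) tangent) \<Rightarrow> bool" where
  "H_frame_on M H V X \<longleftrightarrow>
     (\<forall>j. section_on M (H (weight M H j)) V (X j)) \<and>
     (\<forall>p\<in>V. basis_family (\<lambda>j. X j p) UNIV (tangent_space M p))"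


section \<open>The Carnot differential\<close>

definition graded_class ::
    "('m, 'n::finite) filtration \<Rightarrow> 'm \<Rightarrow> nat \<Rightarrow> ('m, 'n) tangent \<Rightarrow> ('m, 'n) tangent set" where
  "graded_class H a w v = (\<lambda>h. v + h) ` H (w - 1) a"

text \<open>
  An element of the direct sum of the quotients \<open>H w a / H (w - 1) a\<close>, \<open>1 \<le> w \<le> r\<close>, is the tuple of
  its components, each of which is a coset (and \<open>undefined\<close> outside \<open>{1..r}\<close>).
\<close>

type_synonym ('m, 'n) graded = "nat \<Rightarrow> ('m, 'n) tangent set"

text \<open>
  The component of degree \<open>w\<close> is the map of quotients induced by the differential: it maps the coset
  of \<open>v\<close> to the coset of the image of \<open>v\<close>, here independently of a choice of representative.
\<close>

definition carnot_differential ::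
    "nat \<Rightarrow> ('m, 'n::finite) mfd \<Rightarrow> ('m', 'k::finite) mfd \<Rightarrow> ('m', 'k) filtration \<Rightarrow>
     ('m \<Rightarrow> 'm') \<Rightarrow> 'm \<Rightarrow> ('m, 'n) graded \<Rightarrow> ('m', 'k) graded" where
  "carnot_differential r M M' H' \<phi> a \<zeta> =
     (\<lambda>w\<in>{1..r}. \<Union>v\<in>\<zeta> w. graded_class H' (\<phi> a) w (differential M M' \<phi> a v))"

text \<open>
  The linear isomorphism of \<open>real ^ 'n\<close> with the graded space given by the basis of classes
  \<open>\<xi>\<^sub>j\<close> of \<open>X j a\<close>, that is, \<open>x \<mapsto> \<Sum>j. x\<^sub>j \<xi>\<^sub>j\<close>; the component of degree \<open>w\<close> only involves the
  indices of weight \<open>w\<close>.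
\<close>

definition graded_frame_map ::
    "nat \<Rightarrow> ('m, 'n::{finite,linorder}) mfd \<Rightarrow> ('m, 'n) filtration \<Rightarrow>
     ('n \<Rightarrow> 'm \<Rightarrow> ('m, 'n) tangent) \<Rightarrow> 'm \<Rightarrow> (real, 'n) vec \<Rightarrow> ('m, 'n) graded" where
  "graded_frame_map r M H X a x =
     (\<lambda>w\<in>{1..r}. graded_class H a w (\<Sum>j | weight M H j = w. (x $ j) *\<^sub>R X j a))"

definition carnot_differential_coords ::
    "nat \<Rightarrow> ('m, 'n::{finite,linorder}) mfd \<Rightarrow> ('m, 'n) filtration \<Rightarrow>
     ('n \<Rightarrow> 'm \<Rightarrow> ('m, 'n) tangent) \<Rightarrow>
     ('m', 'k::{finite,linorder}) mfd \<Rightarrow> ('m', 'k) filtration \<Rightarrow>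
     ('k \<Rightarrow> 'm' \<Rightarrow> ('m', 'k) tangent) \<Rightarrow> ('m \<Rightarrow> 'm') \<Rightarrow> 'm \<Rightarrow> (real, 'n) vec \<Rightarrow> (real, 'k) vec" where
  "carnot_differential_coords r M H X M' H' X' \<phi> a x =
     (THE y. graded_frame_map r M' H' X' (\<phi> a) y =
        carnot_differential r M M' H' \<phi> a (graded_frame_map r M H X a x))"


section \<open>The Dynkin product and the group of a frame at a point\<close>

fun nested_bracket :: "('v \<Rightarrow> 'v \<Rightarrow> 'v) \<Rightarrow> 'v list \<Rightarrow> 'v::zero" where
  "nested_bracket br [] = 0"
| "nested_bracket br [z] = z"
| "nested_bracket br (z # zs) = br z (nested_bracket br zs)"

text \<open>
  Dynkin's formula
    \<open>x \<cdot> y = \<Sum>m\<ge>1. (-1)^(m-1) / m * \<Sum> [x^p\<^sub>1 y^q\<^sub>1 \<dots> x^p\<^sub>m y^q\<^sub>m] / ((\<Sum>i. p\<^sub>i + q\<^sub>i) * (\<Prod>i. p\<^sub>i! * q\<^sub>i!))\<close>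
  with right-nested brackets; the inner sum is over all \<open>(p\<^sub>i, q\<^sub>i) \<noteq> (0, 0)\<close>. For a Lie bracket that is
  nilpotent of step \<open>r\<close> all terms with \<open>(\<Sum>i. p\<^sub>i + q\<^sub>i) > r\<close> vanish, and therefore so do those with
  \<open>m > r\<close>; they are omitted.
\<close>

definition dynkin_indices :: "nat \<Rightarrow> nat \<Rightarrow> (nat \<times> nat) list set" where
  "dynkin_indices r m = {ps. length ps = m \<and> (\<forall>(p, q)\<in>set ps. p + q \<noteq> 0) \<and>
     (\<Sum>(p, q)\<leftarrow>ps. p + q) \<le> r}"

definition dynkin_product :: "nat \<Rightarrow> ('v \<Rightarrow> 'v \<Rightarrow> 'v) \<Rightarrow> 'v \<Rightarrow> 'v \<Rightarrow> 'v::real_vector" where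
  "dynkin_product r br x y =
     (\<Sum>m=1..r. ((-1) ^ (m - 1) / real m) *\<^sub>R
        (\<Sum>ps\<in>dynkin_indices r m.
           (1 / (real (\<Sum>(p, q)\<leftarrow>ps. p + q) * (\<Prod>(p, q)\<leftarrow>ps. fact p * fact q))) *\<^sub>R
           nested_bracket br (concat (map (\<lambda>(p, q). replicate p x @ replicate q y) ps))))"

definition structure_function ::
    "('m, 'n::finite) mfd \<Rightarrow> ('n \<Rightarrow> 'm \<Rightarrow> ('m, 'n) tangent) \<Rightarrow> 'm \<Rightarrow> 'n \<Rightarrow> 'n \<Rightarrow> 'n \<Rightarrow> real" where
  "structure_function M X p i j =
     (THE c. lie_bracket M (X i) (X j) p = (\<Sum>k\<in>UNIV. c k *\<^sub>R X k p))"

text \<open>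
  The bilinear bracket with \<open>[e\<^sub>i, e\<^sub>j] = \<Sum>k | w\<^sub>k = w\<^sub>i + w\<^sub>j. L i j k * e\<^sub>k\<close>. The sum is empty when
  \<open>w\<^sub>i + w\<^sub>j\<close> exceeds the step.
\<close>

definition frame_bracket ::
    "('m, 'n::{finite,linorder}) mfd \<Rightarrow> ('m, 'n) filtration \<Rightarrow>
     ('n \<Rightarrow> 'm \<Rightarrow> ('m, 'n) tangent) \<Rightarrow> 'm \<Rightarrow> (real, 'n) vec \<Rightarrow> (real, 'n) vec \<Rightarrow> (real, 'n) vec" where
  "frame_bracket M H X a x y =
     (\<Sum>i\<in>UNIV. \<Sum>j\<in>UNIV. (x $ i * y $ j) *\<^sub>R
        (\<Sum>k | weight M H k = weight M H i + weight M H j.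
           structure_function M X a i j k *\<^sub>R axis k 1))"

definition frame_group_mult ::
    "nat \<Rightarrow> ('m, 'n::{finite,linorder}) mfd \<Rightarrow> ('m, 'n) filtration \<Rightarrow>
     ('n \<Rightarrow> 'm \<Rightarrow> ('m, 'n) tangent) \<Rightarrow> 'm \<Rightarrow> (real, 'n) vec \<Rightarrow> (real, 'n) vec \<Rightarrow> (real, 'n) vec" where
  "frame_group_mult r M H X a = dynkin_product r (frame_bracket M H X a)"

text \<open>The left-invariant vector field equal to \<open>\<partial>\<^sub>j\<close> at the unit \<open>0\<close>.\<close>

definition left_invariant_field ::
    "nat \<Rightarrow> ('m, 'n::{finite,linorder}) mfd \<Rightarrow> ('m, 'n) filtration \<Rightarrow>
     ('n \<Rightarrow> 'm \<Rightarrow> ('m, 'n) tangent) \<Rightarrow> 'm \<Rightarrow> 'n \<Rightarrow> (real, 'n) vec \<Rightarrow> (real, 'n) vec" where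
  "left_invariant_field r M H X a j x =
     frechet_derivative (frame_group_mult r M H X a x) (at 0) (axis j 1)"


section \<open>Dilations, pseudo-norms and Carnot coordinates\<close>

definition dilation :: "('n \<Rightarrow> nat) \<Rightarrow> real \<Rightarrow> real ^ 'n::finite \<Rightarrow> real ^ 'n" where
  "dilation w t x = (\<chi> j. t ^ w j * x $ j)"

definition dilation_pullback ::
    "('n \<Rightarrow> nat) \<Rightarrow> real \<Rightarrow> (real ^ 'n::finite \<Rightarrow> real ^ 'n) \<Rightarrow> real ^ 'n \<Rightarrow> real ^ 'n" where
  "dilation_pullback w t b x = (\<chi> p. inverse (t ^ w p) * b (dilation w t x) $ p)"

definition w_homogeneous ::
    "('n \<Rightarrow> nat) \<Rightarrow> ('k \<Rightarrow> nat) \<Rightarrow> (real ^ 'n::finite \<Rightarrow> real ^ 'k::finite) \<Rightarrow> bool" where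
  "w_homogeneous w w' \<Theta> \<longleftrightarrow> (\<forall>t x. \<Theta> (dilation w t x) = dilation w' t (\<Theta> x))"

definition pseudo_norm :: "('n \<Rightarrow> nat) \<Rightarrow> (real ^ 'n::finite \<Rightarrow> real) \<Rightarrow> bool" where
  "pseudo_norm w N \<longleftrightarrow>
     continuous_on UNIV N \<and> (\<forall>x. 0 \<le> N x) \<and> (\<forall>x. x \<noteq> 0 \<longrightarrow> 0 < N x) \<and>
     (\<forall>t x. N (dilation w t x) = \<bar>t\<bar> * N x)"

text \<open>The filter \<open>nhds 0\<close> includes the point \<open>0\<close> itself, so \<open>\<Theta> 0 = 0\<close> if all exponents are positive.\<close>

definition is_Ow ::
    "('k \<Rightarrow> nat) \<Rightarrow> (real ^ 'n::finite \<Rightarrow> real) \<Rightarrow> nat \<Rightarrow> (real ^ 'n \<Rightarrow> real ^ 'k::finite) \<Rightarrow> bool" where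
  "is_Ow w' N m \<Theta> \<longleftrightarrow> (\<forall>k. (\<lambda>x. \<Theta> x $ k) \<in> O[nhds 0](\<lambda>x. N x ^ (w' k + m)))"

text \<open>
  \<open>Z t = Z0 + O(t)\<close> as \<open>t \<rightarrow> 0\<close>, \<open>t \<noteq> 0\<close>, in the smooth topology on \<open>U\<close>: every partial derivative is
  \<open>O(t)\<close>, uniformly on compact subsets. The field \<open>Z t\<close> need only be defined near a given compact set
  for \<open>t\<close> small depending on it, as is the case for pullbacks of fields on \<open>U\<close> by dilations.
\<close>

definition smooth_topology_O_t ::
    "(real ^ 'n::finite) set \<Rightarrow> (real \<Rightarrow> real ^ 'n \<Rightarrow> real ^ 'n) \<Rightarrow> (real ^ 'n \<Rightarrow> real ^ 'n) \<Rightarrow> bool" where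
  "smooth_topology_O_t U Z Z0 \<longleftrightarrow>
     (\<forall>K is. compact K \<and> K \<subseteq> U \<longrightarrow>
        (\<exists>C. \<exists>\<epsilon>>0. \<forall>t. 0 < \<bar>t\<bar> \<and> \<bar>t\<bar> < \<epsilon> \<longrightarrow>
           (\<forall>x\<in>K. norm (iterated_partial is (\<lambda>y. Z t y - Z0 y) x) \<le> C * \<bar>t\<bar>)))"

definition carnot_coordinates ::
    "nat \<Rightarrow> ('m, 'n::{finite,linorder}) mfd \<Rightarrow> ('m, 'n) filtration \<Rightarrow> 'm set \<Rightarrow>
     ('n \<Rightarrow> 'm \<Rightarrow> ('m, 'n) tangent) \<Rightarrow> 'm \<Rightarrow> ('m, 'n) chart \<Rightarrow> bool" where
  "carnot_coordinates r M H V X a \<kappa> \<longleftrightarrow>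
     \<kappa> \<in> charts_at M a \<and> fst \<kappa> \<subseteq> V \<and> snd \<kappa> a = 0 \<and>
     (\<forall>j. field_rep \<kappa> (X j) 0 = axis j 1) \<and>
     (\<forall>j. smooth_topology_O_t (snd \<kappa> ` fst \<kappa>)
        (\<lambda>t x. t ^ weight M H j *\<^sub>R dilation_pullback (weight M H) t (field_rep \<kappa> (X j)) x)
        (left_invariant_field r M H X a j))"

end

theory Submission
  imports Defs
begin

text \<open>
  Write \<open>f\<close> for the map read in Carnot coordinates and \<open>f\<^sub>t = \<delta>\<^sub>t\<inverse> \<circ> f \<circ> \<delta>\<^sub>t\<close>. Since \<open>\<phi>\<close> respects the
  filtrations, \<open>f\<close> maps \<open>X\<^sub>j\<close> to a combination of the fields \<open>X'\<^sub>k\<close> with \<open>w'\<^sub>k \<le> w\<^sub>j\<close>. In Dynkin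
  coordinates \<open>\<Sum>\<^sub>j x\<^sub>j X\<^sub>j\<^sup>a\<close> equals \<open>x\<close> along the line \<open>s x\<close>, so for small \<open>t\<close> the constant velocity \<open>x\<close> of
  that line is a combination of the rescaled fields with coefficients \<open>x\<^sub>j + O(t)\<close>. Hence
  \<open>s \<mapsto> f\<^sub>t (s x)\<close> and \<open>s \<mapsto> s (\<Phi> x)\<close> start at \<open>0\<close> and solve the same differential equation up to \<open>O(t)\<close>, and a
  Gronwall argument gives \<open>f\<^sub>t x = \<Phi> x + O(t)\<close> uniformly for \<open>x\<close> near \<open>0\<close>; scaling with \<open>\<delta>\<^sub>t\<close> turns this
  into the weighted estimate. No a priori bound on \<open>f\<^sub>t\<close> or its derivatives is needed. That \<open>\<Phi>\<close> respects
  brackets follows by differentiating the relation between the frames at \<open>0\<close> and antisymmetrizing.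
\<close>

section \<open>Preliminaries from analysis\<close>

text \<open>Rescaling turns the coefficient c of a target field of weight p in the image of a source
  field of weight q into t^(q - p) c. The filtration condition says that no negative power of t
  survives; equal weights leave an entry of f'(0), and every other entry gains a factor t. So the
  limit is the block diagonal part of f'(0), which is what the Carnot differential becomes in the
  two frames. The obstacle is that the rescaled target fields are controlled only on a fixed ball,
  while the position of the rescaled curve is unknown beforehand. The Gronwall argument is therefore
  a bootstrap: its differential inequality is available only while the deviation is below a
  threshold, and its conclusion keeps the deviation strictly below. Taking x short makes the
  Lipschitz term at most half of the deviation, so it is absorbed on the unit interval without an
  exponential. For brackets, differentiating the coefficient functions would require their
  regularity. Subtracting the constant coefficients at 0 leaves, in the components of large weight,
  a sum of products of two factors of size O(|x|), whose derivative at 0 vanishes.\<close>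

lemma sum_axis_scaleR: "(\<Sum>j\<in>UNIV. (c $ j) *\<^sub>R axis j 1) = (c :: real ^ 'n::finite)"
  using basis_expansion[of c] by (simp add: scalar_mult_eq_scaleR)

text \<open>The errors of the single vectors add up to 1/2, so the map \<open>T\<close> from
  coefficients to combinations differs from the identity by at most 1/2 in operator norm. Hence
  \<open>T\<close> is injective with inverse bounded by 2, and surjective by dimension.\<close>

lemma near_identity_frame:
  fixes B :: "'n::finite \<Rightarrow> real ^ 'n"
  assumes B: "\<And>j. norm (B j - axis j 1) \<le> 1 / (2 * real CARD('n))"
  shows near_identity_frame_lower: "norm c \<le> 2 * norm (\<Sum>j\<in>UNIV. (c $ j) *\<^sub>R B j)"
    and near_identity_frame_surj: "\<exists>c. (\<Sum>j\<in>UNIV. (c $ j) *\<^sub>R B j) = v"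
proof -
  define T where "T = (\<lambda>c. \<Sum>j\<in>UNIV. (c $ j) *\<^sub>R B j)"
  have lower: "norm c \<le> 2 * norm (T c)" for c
  proof -
    have "norm (T c - c) = norm (\<Sum>j\<in>UNIV. (c $ j) *\<^sub>R (B j - axis j 1))"
      by (simp add: T_def scaleR_diff_right sum_subtractf sum_axis_scaleR)
    also have "\<dots> \<le> (\<Sum>j\<in>(UNIV::'n set). norm c * (1 / (2 * real CARD('n))))"
      using B unfolding norm_scaleR real_norm_def[symmetric]
      by (intro sum_norm_le) (metis component_le_norm_cart mult_mono norm_ge_zero norm_scaleR real_norm_def)
    also have "\<dots> = norm c / 2"
      by simp
    finally have "norm (T c - c) \<le> norm c / 2" .
    moreover have "norm c \<le> norm (T c) + norm (T c - c)"
      using norm_triangle_sub[of c "T c"] by (simp add: norm_minus_commute)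
    ultimately show ?thesis by simp
  qed
  show "norm c \<le> 2 * norm (\<Sum>j\<in>UNIV. (c $ j) *\<^sub>R B j)"
    using lower[of c] by (simp add: T_def)
  have lin: "linear T"
    by (rule linearI) (auto simp: T_def scaleR_left_distrib sum.distrib scaleR_sum_right)
  have "inj T"
  proof (rule injI)
    fix c d assume "T c = T d"
    then have "T (c - d) = 0"
      by (simp add: linear_diff[OF lin])
    then show "c = d" using lower[of "c - d"] by simp
  qed
  with lin have "surj T" by (rule linear_injective_imp_surjective) (rule refl)
  then show "\<exists>c. (\<Sum>j\<in>UNIV. (c $ j) *\<^sub>R B j) = v"
    unfolding T_def surj_def by metis
qed

text \<open>A Gronwall estimate whose hypothesis on \<open>u'\<close> holds only while
  \<open>u\<close> stays below \<open>\<eta>\<close>. Since the interval has length 1 and the growth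
  factor is 1/2, the mean value theorem suffices: the maximum of the norm is at most
  \<open>A\<close> plus half of itself.\<close>

lemma integral_inequality_bootstrap:
  fixes u :: "real \<Rightarrow> 'a::real_inner"
  assumes cont: "continuous_on {0..1} u" and u0: "u 0 = 0"
    and der: "\<And>s. 0 < s \<Longrightarrow> s < 1 \<Longrightarrow> (u has_vector_derivative u' s) (at s)"
    and bound: "\<And>s. 0 < s \<Longrightarrow> s < 1 \<Longrightarrow> norm (u s) \<le> \<eta> \<Longrightarrow> norm (u' s) \<le> A + norm (u s) / 2"
    and A: "0 \<le> A" "2 * A < \<eta>" and s: "s \<in> {0..1}"
  shows "norm (u s) \<le> 2 * A"
proof -
  have mvt: "\<exists>x\<in>{0<..<b}. norm (u b) \<le> norm (u' x)" if "0 < b" "b \<le> 1" for b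
  proof -
    have "\<exists>x\<in>{0<..<b}. norm (u b - u 0) \<le> norm ((b - 0) *\<^sub>R u' x)"
    proof (rule mvt_general[where f' = "\<lambda>x h. h *\<^sub>R u' x"])
      show "continuous_on {0..b} u" using cont that by (rule_tac continuous_on_subset) auto
    qed (use that der in \<open>auto simp: has_vector_derivative_def\<close>)
    then obtain x where x: "x \<in> {0<..<b}" "norm (u b - u 0) \<le> norm (b *\<^sub>R u' x)" by auto
    have "b * norm (u' x) \<le> norm (u' x)"
      using that by (simp add: mult_left_le_one_le)
    with x that u0 show ?thesis by (auto intro!: bexI[of _ x])
  qed
  have cn: "continuous_on {0..1} (\<lambda>s. norm (u s))"
    by (intro continuous_intros cont)
  have small: "norm (u s) < \<eta>" if s: "s \<in> {0..1}" for s
  proof (rule ccontr)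
    \<comment> \<open>\<open>Inf S\<close> is the first time at which the norm reaches
      \<open>\<eta>\<close>. The derivative bound holds before it, so the mean value theorem gives
      \<eta> < A + \<eta>/2, which contradicts \<open>2 * A < \<eta>\<close>.\<close>
    define S where "S = {s\<in>{0..1}. \<eta> \<le> norm (u s)}"
    assume "\<not> norm (u s) < \<eta>"
    with s have ne: "S \<noteq> {}" by (auto simp: S_def)
    have "closed S"
      unfolding S_def by (intro continuous_on_closed_Collect_le continuous_intros cont)
    moreover have bdd: "bdd_below S" by (auto simp: S_def intro!: bdd_belowI[of _ 0])
    ultimately have mem: "Inf S \<in> S" using ne by (intro closed_contains_Inf)
    then have b: "0 \<le> Inf S" "Inf S \<le> 1" and big: "\<eta> \<le> norm (u (Inf S))" by (auto simp: S_def)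
    have "Inf S \<noteq> 0" using big u0 A by auto
    with b have "0 < Inf S" by simp
    from mvt[OF this b(2)] obtain x where x: "0 < x" "x < Inf S" "norm (u (Inf S)) \<le> norm (u' x)"
      by auto
    have "x \<notin> S" using x(2) cInf_lower[OF _ bdd, of x] by auto
    then have "norm (u x) < \<eta>" using x b by (auto simp: S_def)
    with bound[of x] x b have "norm (u' x) < A + \<eta> / 2" by fastforce
    with x big A show False by simp
  qed
  \<comment> \<open>The threshold is now never reached, so the derivative bound holds throughout and
    can be applied up to a point of maximal norm.\<close>
  obtain m where m: "m \<in> {0..1}" "\<And>s. s \<in> {0..1} \<Longrightarrow> norm (u s) \<le> norm (u m)"
    using continuous_attains_sup[of "{0..1::real}", OF _ _ cn] by auto
  have "norm (u m) \<le> 2 * A"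
  proof (cases "m = 0")
    case True then show ?thesis using u0 A by simp
  next
    case False
    with m have "0 < m" "m \<le> 1" by auto
    from mvt[OF this] obtain x where x: "0 < x" "x < m" "norm (u m) \<le> norm (u' x)" by auto
    with small[of x] bound[of x] m(1) m(2)[of x] have "norm (u' x) \<le> A + norm (u m) / 2"
      by fastforce
    with x show ?thesis by simp
  qed
  with m(2)[OF s] show ?thesis by simp
qed

text \<open>The mixed second difference is the increment of the difference of \<open>f\<close> along
  two parallel segments in direction \<open>v\<close>. Its derivative is a difference of two values
  of the directional derivative of \<open>f\<close>, which differentiability at 0 alone approximates
  linearly.\<close>

lemma second_difference_tendsto:
  fixes f :: "'a::real_normed_vector \<Rightarrow> 'b::real_inner"
  assumes U: "open U" "0 \<in> U"
    and f: "\<And>x. x \<in> U \<Longrightarrow> f differentiable (at x)"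
    and G: "((\<lambda>x. frechet_derivative f (at x) v) has_derivative G) (at 0)"
  shows "((\<lambda>t. (f (t *\<^sub>R u + t *\<^sub>R v) - f (t *\<^sub>R u) - f (t *\<^sub>R v) + f 0) /\<^sub>R t\<^sup>2) \<longlongrightarrow> G u) (at_right 0)"
proof (rule tendstoI)
  fix e :: real assume e: "0 < e"
  define g where "g = (\<lambda>x. frechet_derivative f (at x) v)"
  define K where "K = norm u + norm v + 1"
  have K: "0 < K" by (simp add: K_def add_nonneg_pos)
  \<comment> \<open>\<open>K\<close> bounds all points of the parallelogram by \<open>t * K\<close>.
    Two remainders of size \<open>e' * (t * K)\<close> over a segment of length \<open>t\<close>
    give \<open>t\<^sup>2 * (2 * e' * K)\<close>, that is half of
    \<open>e * t\<^sup>2\<close>.\<close>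
  define e' where "e' = e / (4 * K)"
  have e': "0 < e'" using e K by (simp add: e'_def)
  have lin: "linear G" using G has_derivative_linear by blast
  obtain d1 where d1: "0 < d1" "\<And>y. norm y < d1 \<Longrightarrow> norm (g y - g 0 - G y) \<le> e' * norm y"
    using G e' unfolding has_derivative_at_alt g_def by (metis diff_zero)
  obtain d2 where d2: "0 < d2" "ball 0 d2 \<subseteq> U"
    using U openE by blast
  define d where "d = min d1 d2 / K"
  have "0 < d" using d1 d2 K by (simp add: d_def)
  have "dist ((f (t *\<^sub>R u + t *\<^sub>R v) - f (t *\<^sub>R u) - f (t *\<^sub>R v) + f 0) /\<^sub>R t\<^sup>2) (G u) < e"
    if t: "0 < t" "t < d" for t
  proof -
    have tK: "t * K < d1" "t * K < d2" using t K by (simp_all add: d_def pos_less_divide_eq)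
    \<comment> \<open>The expected limit is subtracted here as a linear term in \<sigma>, so that
      \<open>h'\<close> consists of the remainders only.\<close>
    define h where "h = (\<lambda>\<sigma>. f (t *\<^sub>R u + \<sigma> *\<^sub>R v) - f (\<sigma> *\<^sub>R v) - (\<sigma> * t) *\<^sub>R G u)"
    define h' where "h' = (\<lambda>\<sigma>. g (t *\<^sub>R u + \<sigma> *\<^sub>R v) - g (\<sigma> *\<^sub>R v) - t *\<^sub>R G u)"
    have nrm: "norm (t *\<^sub>R u + \<sigma> *\<^sub>R v) \<le> t * K" "norm (\<sigma> *\<^sub>R v) \<le> t * K" if "0 \<le> \<sigma>" "\<sigma> \<le> t" for \<sigma>
    proof -
      have "\<sigma> * norm v \<le> t * norm v" using that by (simp add: mult_right_mono)
      then show "norm (\<sigma> *\<^sub>R v) \<le> t * K"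
        using that t by (simp add: K_def algebra_simps add_increasing)
      have "norm (t *\<^sub>R u + \<sigma> *\<^sub>R v) \<le> t * norm u + \<sigma> * norm v"
        using norm_triangle_ineq[of "t *\<^sub>R u" "\<sigma> *\<^sub>R v"] that t by simp
      with \<open>\<sigma> * norm v \<le> t * norm v\<close> t show "norm (t *\<^sub>R u + \<sigma> *\<^sub>R v) \<le> t * K"
        by (simp add: K_def algebra_simps)
    qed
    have fder: "((\<lambda>\<sigma>. f (c + \<sigma> *\<^sub>R v)) has_derivative (\<lambda>s. s *\<^sub>R g (c + \<sigma> *\<^sub>R v))) (at \<sigma>)"
      if "norm (c + \<sigma> *\<^sub>R v) \<le> t * K" for c \<sigma>
    proof -
      have "c + \<sigma> *\<^sub>R v \<in> U" using that tK d2 by (auto simp: subset_iff dist_norm)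
      then have D: "(f has_derivative frechet_derivative f (at (c + \<sigma> *\<^sub>R v))) (at (c + \<sigma> *\<^sub>R v))"
        using f frechet_derivative_works by blast
      have "((\<lambda>\<sigma>. c + \<sigma> *\<^sub>R v) has_derivative (\<lambda>s. s *\<^sub>R v)) (at \<sigma>)"
        by (auto intro!: derivative_eq_intros)
      from diff_chain_at[OF this D] show ?thesis
        by (simp add: o_def g_def linear_cmul[OF has_derivative_linear[OF D]])
    qed
    have hder: "(h has_derivative (\<lambda>s. s *\<^sub>R h' \<sigma>)) (at \<sigma>)" if "0 \<le> \<sigma>" "\<sigma> \<le> t" for \<sigma>
      unfolding h_def h'_def using nrm[OF that] fder[of "t *\<^sub>R u" \<sigma>] fder[of 0 \<sigma>]
      by (auto intro!: derivative_eq_intros simp: algebra_simps)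
    have hb: "norm (h' \<sigma>) \<le> 2 * e' * (t * K)" if "0 \<le> \<sigma>" "\<sigma> \<le> t" for \<sigma>
    proof -
      let ?y = "t *\<^sub>R u + \<sigma> *\<^sub>R v" and ?z = "\<sigma> *\<^sub>R v"
      have "h' \<sigma> = (g ?y - g 0 - G ?y) - (g ?z - g 0 - G ?z)"
        by (simp add: h'_def linear_add[OF lin] linear_cmul[OF lin])
      also have "norm \<dots> \<le> norm (g ?y - g 0 - G ?y) + norm (g ?z - g 0 - G ?z)"
        by (rule norm_triangle_ineq4)
      also have "\<dots> \<le> e' * norm ?y + e' * norm ?z"
        using nrm[OF that] tK by (intro add_mono d1) auto
      also have "\<dots> \<le> e' * (t * K) + e' * (t * K)"
        using nrm[OF that] e' by (intro add_mono mult_left_mono) auto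
      finally show ?thesis by (simp add: algebra_simps)
    qed
    have "\<exists>x\<in>{0<..<t}. norm (h t - h 0) \<le> norm ((t - 0) *\<^sub>R h' x)"
      using t hder
      by (intro mvt_general continuous_at_imp_continuous_on ballI has_derivative_continuous[OF hder])
         auto
    then obtain x where x: "0 < x" "x < t" "norm (h t - h 0) \<le> t * norm (h' x)" using t by auto
    have "t * norm (h' x) \<le> t * (2 * e' * (t * K))"
      using hb[of x] x t by (intro mult_left_mono) auto
    with x(3) have "norm (h t - h 0) \<le> t * (2 * e' * (t * K))" by (rule order_trans)
    also have "\<dots> = t\<^sup>2 * (2 * e' * K)"
      by (simp add: power2_eq_square)
    finally have "norm (h t - h 0) \<le> t\<^sup>2 * (2 * e' * K)" .
    also have "2 * e' * K < e" using e K by (simp add: e'_def)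
    finally have "norm (h t - h 0) < t\<^sup>2 * e" using t by simp
    then have "norm ((h t - h 0) /\<^sub>R t\<^sup>2) < e"
      using t unfolding norm_scaleR by (simp add: divide_simps mult.commute)
    moreover have "(f (t *\<^sub>R u + t *\<^sub>R v) - f (t *\<^sub>R u) - f (t *\<^sub>R v) + f 0) /\<^sub>R t\<^sup>2 - G u
        = (h t - h 0) /\<^sub>R t\<^sup>2"
      using t by (simp add: h_def algebra_simps power2_eq_square)
    ultimately show ?thesis by (simp only: dist_norm)
  qed
  then show "\<forall>\<^sub>F t in at_right 0. dist ((f (t *\<^sub>R u + t *\<^sub>R v) - f (t *\<^sub>R u) - f (t *\<^sub>R v) + f 0) /\<^sub>R t\<^sup>2) (G u) < e"
    using \<open>0 < d\<close> by (auto simp: eventually_at_right[of 0 1] intro!: exI[of _ d])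
qed

text \<open>Exchanging \<open>u\<close> and \<open>v\<close> does not change the second difference,
  so its two limits agree.\<close>

lemma second_derivative_symmetric:
  fixes f :: "'a::real_normed_vector \<Rightarrow> 'b::real_inner"
  assumes "open U" "0 \<in> U" "\<And>x. x \<in> U \<Longrightarrow> f differentiable (at x)"
    and "((\<lambda>x. frechet_derivative f (at x) v) has_derivative G) (at 0)"
    and "((\<lambda>x. frechet_derivative f (at x) u) has_derivative F) (at 0)"
  shows "G u = F v"
proof (rule tendsto_unique)
  show "((\<lambda>t. (f (t *\<^sub>R u + t *\<^sub>R v) - f (t *\<^sub>R u) - f (t *\<^sub>R v) + f 0) /\<^sub>R t\<^sup>2) \<longlongrightarrow> G u) (at_right 0)"
    by (rule second_difference_tendsto[OF assms(1-4)])
  show "((\<lambda>t. (f (t *\<^sub>R u + t *\<^sub>R v) - f (t *\<^sub>R u) - f (t *\<^sub>R v) + f 0) /\<^sub>R t\<^sup>2) \<longlongrightarrow> F v) (at_right 0)"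
    using second_difference_tendsto[OF assms(1-3,5), of v] by (simp add: algebra_simps)
qed simp

text \<open>A vector outside the ball can be moved onto the sphere by a dilation with parameter in
  [0, 1], which does not increase \<open>N\<close>. So the minimum of \<open>N\<close> on the sphere
  is a lower bound for \<open>N\<close> outside the ball, and half of it serves as
  \<open>c\<close>.\<close>

lemma pseudo_norm_small_imp_small:
  fixes N :: "real ^ 'n::finite \<Rightarrow> real"
  assumes N: "pseudo_norm w N" and w: "\<And>j. 1 \<le> w j" and \<rho>: "0 < \<rho>"
  obtains c where "0 < c" "\<And>z. N z \<le> c \<Longrightarrow> norm z \<le> \<rho>"
proof -
  have hom: "N (dilation w t x) = \<bar>t\<bar> * N x" for t x using N by (auto simp: pseudo_norm_def)
  have "continuous_on (sphere 0 \<rho>) N" using N by (auto simp: pseudo_norm_def intro: continuous_on_subset)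
  moreover have "sphere (0::real^'n) \<rho> \<noteq> {}" using \<rho> by simp
  ultimately obtain y where y: "y \<in> sphere 0 \<rho>" "\<And>z. z \<in> sphere 0 \<rho> \<Longrightarrow> N y \<le> N z"
    using continuous_attains_inf[OF compact_sphere] by metis
  have "y \<noteq> 0" using y \<rho> by auto
  then have Ny: "0 < N y" using N by (auto simp: pseudo_norm_def)
  have "N y \<le> N z" if z: "\<rho> < norm z" for z
  proof -
    have c: "continuous_on {0..1} (\<lambda>t. norm (dilation w t z))"
      unfolding dilation_def by (intro continuous_intros)
    have "dilation w 0 z = 0"
    proof -
      have "w j \<noteq> 0" for j using w[of j] by simp
      then show ?thesis by (simp add: dilation_def vec_eq_iff)
    qed
    moreover have "dilation w 1 z = z" by (simp add: dilation_def vec_eq_iff)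
    ultimately obtain t where t: "0 \<le> t" "t \<le> 1" "norm (dilation w t z) = \<rho>"
      using IVT'[of "\<lambda>t. norm (dilation w t z)" 0 \<rho> 1] c z \<rho> by auto
    have "N y \<le> N (dilation w t z)" using t by (intro y) auto
    also have "\<dots> = t * N z" using t hom by simp
    also have "\<dots> \<le> N z" using t N by (simp add: pseudo_norm_def mult_left_le_one_le)
    finally show ?thesis .
  qed
  then show ?thesis using Ny by (intro that[of "N y / 2"]) (fastforce simp: not_le[symmetric])+
qed

section \<open>The Dynkin product\<close>

text \<open>Polynomial maps have this property, and sums and bilinear products preserve it. This is
  how the left-invariant fields obtain the Lipschitz constants used in comparing curves.\<close>

definition lipschitz_on_balls :: "('a::real_normed_vector \<Rightarrow> 'b::real_normed_vector) \<Rightarrow> bool" where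
  "lipschitz_on_balls f \<longleftrightarrow> (\<forall>R. \<exists>L. L-lipschitz_on (cball 0 R) f)"

lemma lipschitz_on_balls_const [simp]: "lipschitz_on_balls (\<lambda>x. c)"
  unfolding lipschitz_on_balls_def using lipschitz_on_constant by blast

lemma lipschitz_on_balls_id [simp]: "lipschitz_on_balls (\<lambda>x. x)"
  unfolding lipschitz_on_balls_def using lipschitz_on_id by blast

lemma lipschitz_on_balls_add:
  "lipschitz_on_balls f \<Longrightarrow> lipschitz_on_balls g \<Longrightarrow> lipschitz_on_balls (\<lambda>x. f x + g x)"
  unfolding lipschitz_on_balls_def using lipschitz_on_add by blast

lemma lipschitz_on_balls_scaleR: "lipschitz_on_balls f \<Longrightarrow> lipschitz_on_balls (\<lambda>x. c *\<^sub>R f x)"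
  unfolding lipschitz_on_balls_def using lipschitz_on_cmult by blast

lemma lipschitz_on_balls_sum:
  "(\<And>i. i \<in> I \<Longrightarrow> lipschitz_on_balls (f i)) \<Longrightarrow> lipschitz_on_balls (\<lambda>x. \<Sum>i\<in>I. f i x)"
  by (induction I rule: infinite_finite_induct) (auto intro: lipschitz_on_balls_add)

lemma lipschitz_on_balls_bounded:
  fixes f :: "'a::real_normed_vector \<Rightarrow> 'b::real_normed_vector"
  assumes "lipschitz_on_balls f"
  obtains B where "0 \<le> B" "\<And>x. norm x \<le> R \<Longrightarrow> norm (f x) \<le> B"
proof -
  obtain L where L: "L-lipschitz_on (cball 0 (max R 0)) f"
    using assms unfolding lipschitz_on_balls_def by blast
  note L0 = lipschitz_on_nonneg[OF L]
  show thesis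
  proof (rule that[of "norm (f 0) + L * max R 0"])
    show "0 \<le> norm (f 0) + L * max R 0" using L0 by simp
    fix x :: 'a assume x: "norm x \<le> R"
    have "norm (f x - f 0) \<le> L * norm (x - 0)"
      using x by (intro lipschitz_on_normD[OF L]) auto
    also have "\<dots> \<le> L * max R 0" using x L0 by (intro mult_left_mono) auto
    finally show "norm (f x) \<le> norm (f 0) + L * max R 0"
      using norm_triangle_sub[of "f x" "f 0"] by simp
  qed
qed

lemma lipschitz_on_balls_bilinear:
  fixes f :: "'a::real_normed_vector \<Rightarrow> 'b::real_normed_vector" and g :: "'a \<Rightarrow> 'c::real_normed_vector"
  assumes br: "bounded_bilinear br" and f: "lipschitz_on_balls f" and g: "lipschitz_on_balls g"
  shows "lipschitz_on_balls (\<lambda>x. br (f x) (g x))"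
  unfolding lipschitz_on_balls_def
proof
  fix R
  interpret bounded_bilinear br by (rule br)
  obtain K where K: "0 \<le> K" "\<And>a b. norm (br a b) \<le> norm a * norm b * K"
    using nonneg_bounded by blast
  obtain Lf where Lf: "Lf-lipschitz_on (cball 0 R) f" using f unfolding lipschitz_on_balls_def by blast
  obtain Lg where Lg: "Lg-lipschitz_on (cball 0 R) g" using g unfolding lipschitz_on_balls_def by blast
  obtain Bf where Bf: "0 \<le> Bf" "\<And>x. norm x \<le> R \<Longrightarrow> norm (f x) \<le> Bf"
    using lipschitz_on_balls_bounded[OF f] by blast
  obtain Bg where Bg: "0 \<le> Bg" "\<And>x. norm x \<le> R \<Longrightarrow> norm (g x) \<le> Bg"
    using lipschitz_on_balls_bounded[OF g] by blast
  note L0 = lipschitz_on_nonneg[OF Lf] lipschitz_on_nonneg[OF Lg]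
  have "(Lf * Bg * K + Bf * Lg * K)-lipschitz_on (cball 0 R) (\<lambda>x. br (f x) (g x))"
  proof (rule lipschitz_onI)
    fix x y :: 'a assume xy: "x \<in> cball 0 R" "y \<in> cball 0 R"
    then have n: "norm x \<le> R" "norm y \<le> R" by auto
    have "br (f x) (g x) - br (f y) (g y) = br (f x - f y) (g x) + br (f y) (g x - g y)"
      by (simp add: diff_left diff_right)
    also have "norm \<dots> \<le> norm (f x - f y) * norm (g x) * K + norm (f y) * norm (g x - g y) * K"
      by (rule order_trans[OF norm_triangle_ineq add_mono[OF K(2) K(2)]])
    also have "\<dots> \<le> (Lf * norm (x - y)) * Bg * K + Bf * (Lg * norm (x - y)) * K"
      using lipschitz_on_normD[OF Lf xy] lipschitz_on_normD[OF Lg xy] Bf Bg K L0 n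
      by (intro add_mono mult_mono) auto
    finally show "dist (br (f x) (g x)) (br (f y) (g y)) \<le> (Lf * Bg * K + Bf * Lg * K) * dist x y"
      by (simp add: dist_norm algebra_simps)
  qed (use Bf Bg K L0 in auto)
  then show "\<exists>L. L-lipschitz_on (cball 0 R) (\<lambda>x. br (f x) (g x))" by blast
qed

text \<open>A word in \<open>x\<close> and \<open>y\<close> is a list of booleans. The induction
  carries both conjuncts because the product rule for the outer bracket involves the derivative of
  the inner word as well as the inner word itself at \<open>y = 0\<close>.\<close>

lemma nested_bracket_has_derivative:
  fixes br :: "'v::euclidean_space \<Rightarrow> 'v \<Rightarrow> 'v"
  assumes br: "bilinear br"
  shows "(\<forall>y. lipschitz_on_balls (\<lambda>x. nested_bracket br (map (\<lambda>b. if b then x else y) bs))) \<and>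
    (\<exists>D. (\<forall>x. ((\<lambda>y. nested_bracket br (map (\<lambda>b. if b then x else y) bs)) has_derivative D x) (at 0)) \<and>
         (\<forall>v. lipschitz_on_balls (\<lambda>x. D x v)))"
proof (induction bs)
  case Nil
  show ?case
    by (auto intro!: exI[of _ "\<lambda>x v. 0"])
next
  case (Cons b bs)
  note bb = br[unfolded bilinear_conv_bounded_bilinear]
  show ?case
  proof (cases bs)
    case Nil
    then show ?thesis
      by (cases b) (auto intro!: exI[of _ "\<lambda>x v. if b then 0 else v"])
  next
    case (Cons c cs)
    let ?n = "\<lambda>x y. nested_bracket br (map (\<lambda>b. if b then x else y) bs)"
    have step: "nested_bracket br (map (\<lambda>b. if b then x else y) (b # bs)) = br (if b then x else y) (?n x y)"
      for x y by (simp add: Cons)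
    from Cons.IH obtain D where lip: "\<And>y. lipschitz_on_balls (\<lambda>x. ?n x y)"
      and D: "\<And>x. (?n x has_derivative D x) (at 0)" and lipD: "\<And>v. lipschitz_on_balls (\<lambda>x. D x v)"
      by blast
    define E where "E = (\<lambda>x v. br (if b then x else 0) (D x v) + br (if b then 0 else v) (?n x 0))"
    have "((\<lambda>y. br (if b then x else y) (?n x y)) has_derivative E x) (at 0)" for x
    proof -
      have "((\<lambda>y. if b then x else y) has_derivative (\<lambda>v. if b then 0 else v)) (at 0)"
        by (cases b) auto
      from bounded_bilinear.FDERIV[OF bb this D[of x]] show ?thesis
        by (simp add: E_def)
    qed
    moreover have "lipschitz_on_balls (\<lambda>x. E x v)" for v
      unfolding E_def
      by (cases b) (auto intro!: lipschitz_on_balls_add lipschitz_on_balls_bilinear[OF bb] lip lipD)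
    moreover have "lipschitz_on_balls (\<lambda>x. br (if b then x else y) (?n x y))" for y
      by (cases b) (auto intro!: lipschitz_on_balls_bilinear[OF bb] lip)
    ultimately show ?thesis unfolding step by (intro conjI allI exI[of _ E])
  qed
qed


text \<open>Separating the pattern of letters from their values (\<open>True\<close> for
  \<open>x\<close>, \<open>False\<close> for \<open>y\<close>) lets properties of all terms of the
  Dynkin formula be proved by induction on the pattern.\<close>

definition dynkin_word :: "(nat \<times> nat) list \<Rightarrow> bool list" where
  "dynkin_word ps = concat (map (\<lambda>(p, q). replicate p True @ replicate q False) ps)"

lemma map_dynkin_word:
  "concat (map (\<lambda>(p, q). replicate p x @ replicate q y) ps) = map (\<lambda>b. if b then x else y) (dynkin_word ps)"
  by (induction ps) (auto simp: dynkin_word_def)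

lemma length_dynkin_word: "length (dynkin_word ps) = (\<Sum>(p, q)\<leftarrow>ps. p + q)"
  by (induction ps) (auto simp: dynkin_word_def)

lemma length_le_length_dynkin_word:
  "(\<forall>(p, q)\<in>set ps. p + q \<noteq> 0) \<Longrightarrow> length ps \<le> length (dynkin_word ps)"
  by (induction ps) (auto simp: dynkin_word_def)

lemma finite_dynkin_indices: "finite (dynkin_indices r m)"
proof (rule finite_subset)
  show "dynkin_indices r m \<subseteq> {ps. set ps \<subseteq> {..r} \<times> {..r} \<and> length ps = m}"
  proof (clarsimp simp: dynkin_indices_def)
    fix ps p q assume sum: "(\<Sum>(p, q)\<leftarrow>ps. p + q) \<le> r" and "(p, q) \<in> set ps"
    then have "p + q \<le> (\<Sum>(p, q)\<leftarrow>ps. p + q)"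
      by (intro member_le_sum_list) force+
    with sum show "p \<le> r \<and> q \<le> r" by simp
  qed
  show "finite {ps. set ps \<subseteq> {..r} \<times> {..r} \<and> length ps = m}"
    by (rule finite_lists_length_eq) simp
qed

lemma dynkin_product_has_derivative:
  fixes br :: "'v::euclidean_space \<Rightarrow> 'v \<Rightarrow> 'v"
  assumes br: "bilinear br"
  obtains D where "\<And>x. (dynkin_product r br x has_derivative D x) (at 0)"
    and "\<And>v. lipschitz_on_balls (\<lambda>x. D x v)"
proof -
  from nested_bracket_has_derivative[OF br] obtain D where
    D: "\<And>bs x. ((\<lambda>y. nested_bracket br (map (\<lambda>b. if b then x else y) bs)) has_derivative D bs x) (at 0)"
    and lip: "\<And>bs v. lipschitz_on_balls (\<lambda>x. D bs x v)"
    by metis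
  show thesis
  proof (rule that)
    show "(dynkin_product r br x has_derivative (\<lambda>v. \<Sum>m=1..r. ((-1) ^ (m - 1) / real m) *\<^sub>R
        (\<Sum>ps\<in>dynkin_indices r m.
           (1 / (real (\<Sum>(p, q)\<leftarrow>ps. p + q) * (\<Prod>(p, q)\<leftarrow>ps. fact p * fact q))) *\<^sub>R
           D (dynkin_word ps) x v))) (at 0)" for x
      unfolding dynkin_product_def map_dynkin_word
      by (intro has_derivative_sum has_derivative_scaleR_right D)
    show "lipschitz_on_balls (\<lambda>x. \<Sum>m=1..r. ((-1) ^ (m - 1) / real m) *\<^sub>R
        (\<Sum>ps\<in>dynkin_indices r m.
           (1 / (real (\<Sum>(p, q)\<leftarrow>ps. p + q) * (\<Prod>(p, q)\<leftarrow>ps. fact p * fact q))) *\<^sub>R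
           D (dynkin_word ps) x v))" for v
      by (intro lipschitz_on_balls_sum lipschitz_on_balls_scaleR lip)
  qed
qed

text \<open>The innermost bracket is formed of two multiples of \<open>v\<close>, hence is 0, and
  the outer brackets preserve 0.\<close>

lemma nested_bracket_collinear:
  fixes br :: "'v::real_vector \<Rightarrow> 'v \<Rightarrow> 'v"
  assumes br: "bilinear br" and alt: "br v v = 0"
    and "2 \<le> length zs" "set zs \<subseteq> range (\<lambda>c. c *\<^sub>R v)"
  shows "nested_bracket br zs = 0"
  using assms(3,4)
proof (induction zs)
  case (Cons z zs)
  show ?case
  proof (cases "2 \<le> length zs")
    case True
    with Cons have "nested_bracket br zs = 0" by auto
    with True show ?thesis using bilinear_rzero[OF br] by (cases zs) auto
  next
    case False
    with Cons.prems(1) obtain y where "zs = [y]" by (cases zs) (auto simp: Suc_le_eq)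
    with Cons.prems(2) show ?thesis
      by (auto simp: bilinear_lmul[OF br] bilinear_rmul[OF br] alt)
  qed
qed simp

text \<open>One-parameter subgroups are straight lines. An index list with \<open>m \<ge> 2\<close>
  blocks has at least two letters, so its term vanishes; for \<open>m = 1\<close> only the
  one-letter words \<open>[(1, 0)]\<close> and \<open>[(0, 1)]\<close> remain, which contribute the
  two arguments with coefficient 1.\<close>

lemma dynkin_product_collinear:
  fixes br :: "'v::real_vector \<Rightarrow> 'v \<Rightarrow> 'v"
  assumes br: "bilinear br" and alt: "br v v = 0" and r: "1 \<le> r"
  shows "dynkin_product r br (s *\<^sub>R v) (t *\<^sub>R v) = (s + t) *\<^sub>R v"
proof -
  define c where "c = (\<lambda>ps. 1 / (real (\<Sum>(p, q)\<leftarrow>ps. p + q) * (\<Prod>(p, q)\<leftarrow>ps. fact p * fact q)))"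
  define T where "T = (\<lambda>ps. nested_bracket br (concat (map (\<lambda>(p, q). replicate p (s *\<^sub>R v) @ replicate q (t *\<^sub>R v)) ps)))"
  have zero: "T ps = 0" if "2 \<le> length (dynkin_word ps)" for ps
    unfolding T_def map_dynkin_word
    by (rule nested_bracket_collinear[OF br alt]) (use that in auto)
  have "(\<Sum>ps\<in>dynkin_indices r m. c ps *\<^sub>R T ps) = 0" if "2 \<le> m" for m
  proof (rule sum.neutral, rule ballI)
    fix ps assume "ps \<in> dynkin_indices r m"
    then have "2 \<le> length (dynkin_word ps)"
      using length_le_length_dynkin_word[of ps] that by (auto simp: dynkin_indices_def)
    then show "c ps *\<^sub>R T ps = 0" using zero by simp
  qed
  then have "dynkin_product r br (s *\<^sub>R v) (t *\<^sub>R v) =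
      (\<Sum>m\<in>{1}. ((-1) ^ (m - 1) / real m) *\<^sub>R (\<Sum>ps\<in>dynkin_indices r m. c ps *\<^sub>R T ps))"
    unfolding dynkin_product_def c_def T_def using r
    by (intro sum.mono_neutral_right) auto
  also have "\<dots> = (\<Sum>ps\<in>dynkin_indices r 1. c ps *\<^sub>R T ps)" by simp
  also have "\<dots> = (\<Sum>ps\<in>{[(1, 0)], [(0, 1)]}. c ps *\<^sub>R T ps)"
  proof (rule sum.mono_neutral_right)
    show "{[(1, 0)], [(0, 1)]} \<subseteq> dynkin_indices r 1" using r by (auto simp: dynkin_indices_def)
    show "\<forall>ps\<in>dynkin_indices r 1 - {[(1, 0)], [(0, 1)]}. c ps *\<^sub>R T ps = 0"
    proof
      fix ps assume ps: "ps \<in> dynkin_indices r 1 - {[(1, 0)], [(0, 1)]}"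
      then obtain p q where pq: "ps = [(p, q)]" "p + q \<noteq> 0"
        by (auto simp: dynkin_indices_def length_Suc_conv)
      with ps have "(p, q) \<noteq> (1, 0)" "(p, q) \<noteq> (0, 1)" by auto
      with pq have "2 \<le> length (dynkin_word ps)" by (auto simp: length_dynkin_word)
      then show "c ps *\<^sub>R T ps = 0" using zero by simp
    qed
  qed (rule finite_dynkin_indices)
  also have "\<dots> = (s + t) *\<^sub>R v"
    by (simp add: c_def T_def scaleR_left_distrib)
  finally show ?thesis .
qed

lemma nested_bracket_hom:
  assumes "\<And>x y. \<Phi> (br x y) = br' (\<Phi> x) (\<Phi> y)" "\<Phi> 0 = 0"
  shows "\<Phi> (nested_bracket br zs) = nested_bracket br' (map \<Phi> zs)"
proof (induction zs)
  case (Cons z zs)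
  then show ?case using assms by (cases zs) auto
qed (use assms in simp)

lemma dynkin_product_hom:
  assumes lin: "linear \<Phi>" and br: "\<And>x y. \<Phi> (br x y) = br' (\<Phi> x) (\<Phi> y)"
  shows "\<Phi> (dynkin_product r br x y) = dynkin_product r br' (\<Phi> x) (\<Phi> y)"
proof -
  have *: "map \<Phi> (concat (map (\<lambda>(p, q). replicate p x @ replicate q y) ps)) =
      concat (map (\<lambda>(p, q). replicate p (\<Phi> x) @ replicate q (\<Phi> y)) ps)" for ps
    by (induction ps) auto
  show ?thesis
    unfolding dynkin_product_def
    by (simp add: linear_sum[OF lin] linear_cmul[OF lin] nested_bracket_hom[where \<Phi> = \<Phi> and br = br and br' = br', OF br linear_0[OF lin]] *)
qed

section \<open>The bracket, the group and the left-invariant fields of a frame at a point\<close>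

lemma bilinear_frame_bracket:
  fixes M :: "('m, 'a::{finite,linorder}) mfd"
  shows "bilinear (frame_bracket M H X a)"
proof -
  define F where "F = (\<lambda>i j. \<Sum>k | weight M H k = weight M H i + weight M H j.
    structure_function M X a i j k *\<^sub>R axis k (1::real))"
  have eq: "frame_bracket M H X a x y = (\<Sum>i\<in>UNIV. x $ i *\<^sub>R (\<Sum>j\<in>UNIV. y $ j *\<^sub>R F i j))" for x y
    by (simp add: frame_bracket_def F_def scaleR_sum_right mult.assoc)
  have "linear (\<lambda>y. \<Sum>j\<in>UNIV. y $ j *\<^sub>R F i j)" for i
    by (rule linearI) (simp_all add: scaleR_left_distrib sum.distrib scaleR_sum_right)
  note lin = linear_add[OF this] linear_cmul[OF this]
  show ?thesis
    unfolding bilinear_def eq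
    by (intro conjI allI linearI)
      (simp_all only: lin vector_add_component vector_scaleR_component scaleR_left_distrib scaleR_right_distrib distrib_left distrib_right
        sum.distrib scaleR_sum_right scaleR_scaleR real_scaleR_def mult.commute mult.left_commute)
qed

lemma frame_bracket_axis:
  "frame_bracket M H X a (axis i 1) (axis j 1) =
    (\<Sum>k | weight M H k = weight M H i + weight M H j. structure_function M X a i j k *\<^sub>R axis k 1)"
proof -
  let ?F = "\<lambda>i j. (\<Sum>k | weight M H k = weight M H i + weight M H j. structure_function M X a i j k *\<^sub>R axis k 1)"
  have "frame_bracket M H X a (axis i 1) (axis j 1) =
      (\<Sum>i'\<in>UNIV. \<Sum>j'\<in>UNIV. if i' = i then if j' = j then ?F i' j' else 0 else 0)"
    unfolding frame_bracket_def by (intro sum.cong refl) (auto simp: axis_def)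
  also have "\<dots> = (\<Sum>i'\<in>UNIV. if i' = i then ?F i' j else 0)"
    by (intro sum.cong refl) (auto simp: sum.delta')
  also have "\<dots> = ?F i j" by simp
  finally show ?thesis .
qed

text \<open>Exchanging the summation indices shows that the bracket of \<open>v\<close> with itself
  equals its own negative. Antisymmetry is assumed for the triples that enter the bracket; for these
  the weight sum is itself a weight, hence at most the step, and \<open>structure_function\<close>
  can be computed in a chart.\<close>

lemma frame_bracket_self:
  assumes "\<And>i j k. weight M H k = weight M H i + weight M H j \<Longrightarrow>
    structure_function M X a i j k = - structure_function M X a j i k"
  shows "frame_bracket M H X a v v = 0"
proof -
  define F where "F = (\<lambda>i j. \<Sum>k | weight M H k = weight M H i + weight M H j.
    structure_function M X a i j k *\<^sub>R axis k (1::real))"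
  have F: "F i j = - F j i" for i j
  proof -
    have "F i j = (\<Sum>k | weight M H k = weight M H i + weight M H j.
        - (structure_function M X a j i k *\<^sub>R axis k (1::real)))"
      unfolding F_def by (intro sum.cong refl) (simp add: assms[of _ i j])
    also have "\<dots> = - F j i" by (simp add: F_def sum_negf add.commute)
    finally show ?thesis .
  qed
  have "frame_bracket M H X a v v = (\<Sum>i\<in>UNIV. \<Sum>j\<in>UNIV. (v $ i * v $ j) *\<^sub>R F i j)"
    by (simp add: frame_bracket_def F_def)
  also have "\<dots> = (\<Sum>j\<in>UNIV. \<Sum>i\<in>UNIV. (v $ i * v $ j) *\<^sub>R F i j)"
    by (rule sum.swap)
  also have "\<dots> = (\<Sum>j\<in>UNIV. \<Sum>i\<in>UNIV. - ((v $ j * v $ i) *\<^sub>R F j i))"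
    by (intro sum.cong refl) (subst F, simp add: mult.commute)
  also have "\<dots> = - frame_bracket M H X a v v"
    by (simp add: frame_bracket_def F_def sum_negf)
  finally show ?thesis by (simp add: vec_eq_iff)
qed

lemma frame_group_mult_has_derivative:
  obtains D where "\<And>x. (frame_group_mult r M H X a x has_derivative D x) (at 0)"
    and "\<And>v. lipschitz_on_balls (\<lambda>x. D x v)"
proof -
  obtain D where "\<And>x. (dynkin_product r (frame_bracket M H X a) x has_derivative D x) (at 0)"
    and "\<And>v. lipschitz_on_balls (\<lambda>x. D x v)"
    using dynkin_product_has_derivative[OF bilinear_frame_bracket[of M H X a], of r] by metis
  then show thesis by (intro that[of D]) (simp_all add: frame_group_mult_def)
qed

lemma left_invariant_field_lipschitz:
  "lipschitz_on_balls (left_invariant_field r M H X a j)"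
proof -
  obtain D where D: "\<And>x. (frame_group_mult r M H X a x has_derivative D x) (at 0)"
    and lip: "\<And>v. lipschitz_on_balls (\<lambda>x. D x v)"
    using frame_group_mult_has_derivative[of r M H X a] by metis
  have "left_invariant_field r M H X a j = (\<lambda>x. D x (axis j 1))"
    by (simp add: fun_eq_iff left_invariant_field_def frechet_derivative_at[OF D, symmetric])
  then show ?thesis using lip by simp
qed

text \<open>The left side is the derivative at \<open>t = 0\<close> of the product of
  \<open>s *\<^sub>R v\<close> and \<open>t *\<^sub>R v\<close>, which is
  \<open>(s + t) *\<^sub>R v\<close>. It says that straight lines through 0 are integral curves of
  the left-invariant fields with constant coefficients.\<close>

lemma left_invariant_field_on_line:
  assumes "frame_bracket M H X a v v = 0" and r: "1 \<le> r"
  shows "(\<Sum>j\<in>UNIV. (v $ j) *\<^sub>R left_invariant_field r M H X a j (s *\<^sub>R v)) = v"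
proof -
  let ?m = "frame_group_mult r M H X a (s *\<^sub>R v)"
  obtain D where D: "(?m has_derivative D) (at 0)"
    using frame_group_mult_has_derivative[of r M H X a] by metis
  note lin = has_derivative_linear[OF D]
  have "(\<Sum>j\<in>UNIV. (v $ j) *\<^sub>R left_invariant_field r M H X a j (s *\<^sub>R v)) = D (\<Sum>j\<in>UNIV. (v $ j) *\<^sub>R axis j 1)"
    unfolding left_invariant_field_def frechet_derivative_at[OF D, symmetric]
    by (simp add: linear_sum[OF lin] linear_cmul[OF lin])
  also have "\<dots> = D v"
    using basis_expansion[of v] by (simp add: scalar_mult_eq_scaleR)
  finally have eq: "(\<Sum>j\<in>UNIV. (v $ j) *\<^sub>R left_invariant_field r M H X a j (s *\<^sub>R v)) = D v" .
  have "((\<lambda>t. t *\<^sub>R v) has_derivative (\<lambda>t. t *\<^sub>R v)) (at 0)"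
    by (auto intro!: derivative_eq_intros)
  from diff_chain_at[OF this, of ?m D] D
  have "((\<lambda>t. ?m (t *\<^sub>R v)) has_derivative (\<lambda>t. D (t *\<^sub>R v))) (at 0)"
    by (simp add: o_def)
  moreover have "(\<lambda>t. ?m (t *\<^sub>R v)) = (\<lambda>t. (s + t) *\<^sub>R v)"
    unfolding frame_group_mult_def
    using dynkin_product_collinear[OF bilinear_frame_bracket assms] by auto
  moreover have "((\<lambda>t. (s + t) *\<^sub>R v) has_derivative (\<lambda>t. t *\<^sub>R v)) (at 0)"
    by (auto intro!: derivative_eq_intros)
  ultimately have "(\<lambda>t. D (t *\<^sub>R v)) = (\<lambda>t. t *\<^sub>R v)"
    by (metis has_derivative_unique)
  then have "D v = v" by (metis scaleR_one)
  with eq show ?thesis by simp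
qed

section \<open>Maps relating frames\<close>

lemma norm_dilation_le:
  assumes "\<And>j. 1 \<le> w j" "0 \<le> t" "t \<le> 1"
  shows "norm (dilation w t x) \<le> t * norm x"
proof -
  have "norm (dilation w t x) \<le> norm (t *\<^sub>R x)"
  proof (rule norm_le_componentwise_cart)
    fix j
    have "t ^ w j \<le> t ^ 1" using assms by (intro power_decreasing) auto
    then show "norm (dilation w t x $ j) \<le> norm ((t *\<^sub>R x) $ j)"
      using assms by (simp add: dilation_def abs_mult mult_right_mono)
  qed
  then show ?thesis using assms by simp
qed

lemma linear_dilation: "linear (dilation w t)"
  by (rule linearI) (simp_all add: dilation_def vec_eq_iff algebra_simps)

lemma dilation_inverse: "t \<noteq> 0 \<Longrightarrow> dilation w (inverse t) (dilation w t x) = x"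
  "t \<noteq> 0 \<Longrightarrow> dilation w t (dilation w (inverse t) x) = x"
  by (simp_all add: dilation_def vec_eq_iff power_inverse field_simps)

lemma dilation_pullback_eq: "dilation_pullback w t b x = dilation w (inverse t) (b (dilation w t x))"
  by (simp add: dilation_pullback_def dilation_def power_inverse)

lemma has_derivative_linear_bound:
  fixes h :: "'a::real_normed_vector \<Rightarrow> 'b::real_normed_vector"
  assumes "(h has_derivative h') (at 0)" and h0: "h 0 = 0"
  obtains C d where "0 \<le> C" "0 < d" "\<And>x. norm x \<le> d \<Longrightarrow> norm (h x) \<le> C * norm x"
proof -
  from assms obtain d where d: "0 < d" "\<And>x. norm x < d \<Longrightarrow> norm (h x - h' x) \<le> 1 * norm x"
    unfolding has_derivative_at_alt by (metis diff_zero zero_less_one)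
  obtain K where K: "0 \<le> K" "\<And>x. norm (h' x) \<le> norm x * K"
    using has_derivative_bounded_linear[OF assms(1)] bounded_linear.nonneg_bounded by blast
  show thesis
  proof (rule that[of "K + 1" "d / 2"])
    fix x :: 'a assume "norm x \<le> d / 2"
    then have "norm (h x - h' x) \<le> norm x" using d by simp
    then show "norm (h x) \<le> (K + 1) * norm x"
      using K(2)[of x] norm_triangle_sub[of "h x" "h' x"] by (simp add: algebra_simps)
  qed (use K d in auto)
qed

lemma has_derivative_zero_of_quadratic_bound:
  fixes h :: "'a::real_normed_vector \<Rightarrow> real"
  assumes h: "(h has_derivative h') (at 0)"
    and d: "0 < d" and bound: "\<And>x. norm x \<le> d \<Longrightarrow> \<bar>h x\<bar> \<le> C * norm x * norm x"
  shows "h' v = 0"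
proof -
  have h0: "h 0 = 0" using bound[of 0] d by simp
  have lim: "((\<lambda>x. C * norm x) \<longlongrightarrow> 0) (at 0)"
    by (auto intro!: tendsto_eq_intros)
  have "((\<lambda>x. (h x - h 0 - 0) /\<^sub>R norm (x - 0)) \<longlongrightarrow> 0) (at 0)"
  proof (rule Lim_null_comparison[OF _ lim])
    have "\<forall>\<^sub>F x in at 0. norm x < d \<and> x \<noteq> (0::'a)"
      using d by (auto simp: eventually_at intro!: exI[of _ d])
    then show "\<forall>\<^sub>F x in at 0. norm ((h x - h 0 - 0) /\<^sub>R norm (x - 0)) \<le> C * norm x"
    proof eventually_elim
      case (elim x)
      then show ?case using bound[of x] by (simp add: h0 field_simps)
    qed
  qed
  then have "(h has_derivative (\<lambda>x. 0)) (at 0)"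
    by (simp add: has_derivative_at_within)
  with h have "h' = (\<lambda>x. 0)" by (rule has_derivative_unique)
  then show ?thesis by simp
qed

text \<open>The local situation freed from manifolds: a map between Euclidean spaces and two frames
  that are standard at 0. The filtrations survive only in \<open>related\<close>, whose coefficients
  exist point by point; no regularity in \<open>x\<close> is asserted for them.\<close>

locale frame_related_map =
  fixes w :: "'n::finite \<Rightarrow> nat" and w' :: "'k::finite \<Rightarrow> nat"
    and U :: "(real ^ 'n) set" and f :: "real ^ 'n \<Rightarrow> real ^ 'k"
    and b :: "'n \<Rightarrow> real ^ 'n \<Rightarrow> real ^ 'n" and b' :: "'k \<Rightarrow> real ^ 'k \<Rightarrow> real ^ 'k"
  assumes U: "open U" "0 \<in> U"
    and w_pos: "\<And>j. 1 \<le> w j"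
    and f_zero: "f 0 = 0"
    and f_differentiable: "\<And>x. x \<in> U \<Longrightarrow> f differentiable (at x)"
    and f_twice_differentiable: "\<And>v. (\<lambda>x. frechet_derivative f (at x) v) differentiable (at 0)"
    and b_differentiable: "\<And>j. b j differentiable (at 0)"
    and b'_differentiable: "\<And>k. b' k differentiable (at 0)"
    and b_zero: "\<And>j. b j 0 = axis j 1"
    and b'_zero: "\<And>k. b' k 0 = axis k 1"
    and related: "\<And>x j. x \<in> U \<Longrightarrow> \<exists>c. (\<forall>k. w j < w' k \<longrightarrow> c $ k = 0) \<and>
      frechet_derivative f (at x) (b j x) = (\<Sum>k\<in>UNIV. (c $ k) *\<^sub>R b' k (f x))"
begin

definition c0 :: "'n \<Rightarrow> real ^ 'k" where
  "c0 j = frechet_derivative f (at 0) (axis j 1)"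

text \<open>The block diagonal part of f'(0) with respect to the weights, later identified with the
  Carnot differential in the frames.\<close>

definition hom :: "real ^ 'n \<Rightarrow> real ^ 'k" where
  "hom x = (\<chi> k. \<Sum>j | w j = w' k. x $ j * c0 j $ k)"

text \<open>
  The part of \<open>f' b\<^sub>j\<close> not explained by the constant coefficients \<open>c0 j\<close>. Its components of weight
  \<open>> w j\<close> vanish to second order at \<open>0\<close>, which replaces differentiating the coefficient functions.
\<close>

definition residual :: "'n \<Rightarrow> real ^ 'n \<Rightarrow> real ^ 'k" where
  "residual j x = frechet_derivative f (at x) (b j x) - (\<Sum>k\<in>UNIV. (c0 j $ k) *\<^sub>R b' k (f x))"

lemma f_has_derivative: "x \<in> U \<Longrightarrow> (f has_derivative frechet_derivative f (at x)) (at x)"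
  using f_differentiable frechet_derivative_works by blast

lemma linear_df: "x \<in> U \<Longrightarrow> linear (frechet_derivative f (at x))"
  using f_has_derivative has_derivative_linear by blast

lemma linear_hom: "linear hom"
  by (rule linearI) (simp_all add: hom_def vec_eq_iff algebra_simps sum.distrib sum_distrib_left)

lemma c0_eq_0: "w j < w' k \<Longrightarrow> c0 j $ k = 0"
proof -
  assume jk: "w j < w' k"
  obtain c where c: "\<forall>k. w j < w' k \<longrightarrow> c $ k = 0"
    "frechet_derivative f (at 0) (b j 0) = (\<Sum>k\<in>UNIV. (c $ k) *\<^sub>R b' k (f 0))"
    using related U(2) by blast
  then have "c0 j = c" by (simp add: c0_def b_zero b'_zero f_zero sum_axis_scaleR)
  with c jk show ?thesis by simp
qed

lemma residual_zero: "residual j 0 = 0"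
  by (simp add: residual_def b_zero b'_zero f_zero sum_axis_scaleR c0_def)

lemma residual_has_derivative:
  "(residual j has_derivative
     (\<lambda>h. frechet_derivative f (at 0) (frechet_derivative (b j) (at 0) h)
        + frechet_derivative (\<lambda>x. frechet_derivative f (at x) (axis j 1)) (at 0) h
        - (\<Sum>k\<in>UNIV. (c0 j $ k) *\<^sub>R frechet_derivative (b' k) (at 0) (frechet_derivative f (at 0) h)))) (at 0)"
proof -
  let ?D = "frechet_derivative f (at 0)"
  let ?F = "\<lambda>v. frechet_derivative (\<lambda>x. frechet_derivative f (at x) v) (at 0)"
  let ?B = "frechet_derivative (b j) (at 0)"
  have lin: "linear ?D" using linear_df U by blast
  have F: "((\<lambda>x. frechet_derivative f (at x) v) has_derivative ?F v) (at 0)" for v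
    using f_twice_differentiable frechet_derivative_works by blast
  have B: "(b j has_derivative ?B) (at 0)"
    using b_differentiable frechet_derivative_works by blast
  have B': "(b' k has_derivative frechet_derivative (b' k) (at 0)) (at (f 0))" for k
    using b'_differentiable frechet_derivative_works f_zero by metis
  have lincomb: "(\<Sum>p\<in>UNIV. (v $ p) *\<^sub>R L (axis p 1)) = L v" if "linear L" for L :: "real^'n \<Rightarrow> real^'k" and v
    using sum_axis_scaleR[of v] by (simp add: linear_sum[OF that, symmetric] linear_cmul[OF that, symmetric])
  \<comment> \<open>The second derivative is available for fixed directions only, so the moving
    vector \<open>b j x\<close> is first expanded in the standard basis.\<close>
  have 1: "((\<lambda>x. \<Sum>p\<in>UNIV. (b j x $ p) *\<^sub>R frechet_derivative f (at x) (axis p 1)) has_derivative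
      (\<lambda>h. \<Sum>p\<in>UNIV. (b j 0 $ p) *\<^sub>R ?F (axis p 1) h + (?B h $ p) *\<^sub>R ?D (axis p 1))) (at 0)"
    by (intro has_derivative_sum has_derivative_scaleR F
        bounded_linear.has_derivative[OF bounded_linear_vec_nth] B)
  have 2: "(\<lambda>h. \<Sum>p\<in>UNIV. (b j 0 $ p) *\<^sub>R ?F (axis p 1) h + (?B h $ p) *\<^sub>R ?D (axis p 1)) =
      (\<lambda>h. ?D (?B h) + ?F (axis j 1) h)"
  proof
    fix h
    have "(\<Sum>p\<in>UNIV. (b j 0 $ p) *\<^sub>R ?F (axis p 1) h) = (\<Sum>p\<in>UNIV. if p = j then ?F (axis p 1) h else 0)"
      by (intro sum.cong refl) (simp add: b_zero axis_def)
    then show "(\<Sum>p\<in>UNIV. (b j 0 $ p) *\<^sub>R ?F (axis p 1) h + (?B h $ p) *\<^sub>R ?D (axis p 1)) =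
        ?D (?B h) + ?F (axis j 1) h"
      by (simp add: sum.distrib lincomb[OF lin])
  qed
  have 3: "((\<lambda>x. frechet_derivative f (at x) (b j x)) has_derivative (\<lambda>h. ?D (?B h) + ?F (axis j 1) h)) (at 0)"
    by (rule has_derivative_transform_within_open[OF 1[unfolded 2] U]) (rule lincomb[OF linear_df])
  have "((\<lambda>x. b' k (f x)) has_derivative (\<lambda>h. frechet_derivative (b' k) (at 0) (?D h))) (at 0)" for k
    using diff_chain_at[OF f_has_derivative[OF U(2)] B'] by (simp add: o_def)
  with 3 show ?thesis
    unfolding residual_def
    by (intro has_derivative_diff has_derivative_sum has_derivative_scaleR_right)
qed

text \<open>The difference of the coefficients from \<open>c0 j\<close> is what expresses
  \<open>residual j x\<close> in the frame \<open>b' k (f x)\<close>. That residual is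
  differentiable and vanishes at 0, and the frame is close to the standard one, so the difference is
  O(|x|).\<close>

lemma frame_coefficients_near_zero:
  "\<exists>d>0. \<exists>C\<ge>0. \<forall>x. norm x \<le> d \<longrightarrow> x \<in> U \<and>
    (\<forall>k. norm (b' k (f x) - axis k 1) \<le> C * norm x) \<and>
    (\<exists>c. \<forall>j. (\<forall>k. w j < w' k \<longrightarrow> c j $ k = 0) \<and>
        frechet_derivative f (at x) (b j x) = (\<Sum>k\<in>UNIV. (c j $ k) *\<^sub>R b' k (f x)) \<and>
        norm (c j - c0 j) \<le> C * norm x)"
proof -
  have "\<exists>C d. 0 \<le> C \<and> 0 < d \<and> (\<forall>x. norm x \<le> d \<longrightarrow> norm (residual j x) \<le> C * norm x)" for j
    using has_derivative_linear_bound[OF residual_has_derivative residual_zero] by metis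
  then obtain C1 d1 where 1: "\<And>j. 0 \<le> C1 j" "\<And>j. 0 < d1 j"
    "\<And>j x. norm x \<le> d1 j \<Longrightarrow> norm (residual j x) \<le> C1 j * norm x"
    by metis
  have "\<exists>C d. 0 \<le> C \<and> 0 < d \<and> (\<forall>x. norm x \<le> d \<longrightarrow> norm (b' k (f x) - axis k 1) \<le> C * norm x)" for k
  proof -
    have "(b' k has_derivative frechet_derivative (b' k) (at 0)) (at (f 0))"
      using b'_differentiable frechet_derivative_works f_zero by metis
    from diff_chain_at[OF f_has_derivative[OF U(2)] this]
    have "((\<lambda>x. b' k (f x) - axis k 1) has_derivative
        (\<lambda>h. frechet_derivative (b' k) (at 0) (frechet_derivative f (at 0) h))) (at 0)"
      by (auto simp: o_def intro!: derivative_eq_intros)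
    from has_derivative_linear_bound[OF this] show ?thesis
      by (metis b'_zero diff_self f_zero)
  qed
  then obtain C2 d2 where 2: "\<And>k. 0 \<le> C2 k" "\<And>k. 0 < d2 k"
    "\<And>k x. norm x \<le> d2 k \<Longrightarrow> norm (b' k (f x) - axis k 1) \<le> C2 k * norm x"
    by metis
  obtain d3 where d3: "0 < d3" "cball 0 d3 \<subseteq> U"
    using U open_contains_cball by blast
  \<comment> \<open>The factor 2 is the bound for the inverse of a frame close to the standard
    one.\<close>
  define C where "C = (\<Sum>j\<in>UNIV. 2 * C1 j) + (\<Sum>k\<in>UNIV. C2 k)"
  have C1: "2 * C1 j \<le> C" for j
  proof -
    have "2 * C1 j \<le> (\<Sum>j\<in>UNIV. 2 * C1 j)" using 1(1) by (intro member_le_sum) auto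
    moreover have "0 \<le> (\<Sum>k\<in>UNIV. C2 k)" using 2(1) by (intro sum_nonneg) auto
    ultimately show ?thesis by (simp add: C_def)
  qed
  have C2: "C2 k \<le> C" for k
  proof -
    have "C2 k \<le> (\<Sum>k\<in>UNIV. C2 k)" using 2(1) by (intro member_le_sum) auto
    moreover have "0 \<le> (\<Sum>j\<in>UNIV. 2 * C1 j)" using 1(1) by (intro sum_nonneg) auto
    ultimately show ?thesis by (simp add: C_def)
  qed
  have C0: "0 \<le> C" using C2 2(1) order_trans by blast
  let ?n = "1 / (2 * real CARD('k))"
  \<comment> \<open>The entry \<open>?n / (C + 1)\<close> puts the frame at \<open>f x\<close>
    within the tolerance of \<open>near_identity_frame\<close>; adding 1 keeps the denominator
    positive.\<close>
  define d where "d = Min ({d3, ?n / (C + 1)} \<union> range d1 \<union> range d2)"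
  have d: "0 < d" using C0 1(2) 2(2) d3(1) by (auto simp: d_def)
  have le: "d \<le> d3" "d \<le> ?n / (C + 1)" "d \<le> d1 j" "d \<le> d2 k" for j k
    unfolding d_def by (rule Min_le, simp, simp)+
  show ?thesis
  proof (rule exI[of _ d], intro conjI d, rule exI[of _ C], intro conjI C0 allI impI)
    have near: "norm (b' k (f x) - axis k 1) \<le> C * norm x" if "norm x \<le> d" for x k
      using 2(3)[of x k] that le(4)[of k] mult_right_mono[OF C2[of k], of "norm x"] by simp
    fix x :: "real ^ 'n" assume x: "norm x \<le> d"
    then show xU: "x \<in> U" using le(1) d3(2) by (auto simp: subset_iff)
    show "norm (b' k (f x) - axis k 1) \<le> C * norm x" for k by (rule near[OF x])
    have near': "norm (b' k (f x) - axis k 1) \<le> ?n" for k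
    proof -
      have "C * norm x \<le> (C + 1) * (?n / (C + 1))"
        using x le(2) C0 by (intro mult_mono) auto
      also have "\<dots> = ?n" using C0 by simp
      finally show ?thesis using near[OF x, of k] by simp
    qed
    have "\<exists>c. (\<forall>k. w j < w' k \<longrightarrow> c $ k = 0) \<and>
        frechet_derivative f (at x) (b j x) = (\<Sum>k\<in>UNIV. (c $ k) *\<^sub>R b' k (f x)) \<and>
        norm (c - c0 j) \<le> C * norm x" for j
    proof -
      obtain c where c: "\<forall>k. w j < w' k \<longrightarrow> c $ k = 0"
        "frechet_derivative f (at x) (b j x) = (\<Sum>k\<in>UNIV. (c $ k) *\<^sub>R b' k (f x))"
        using related[OF xU] by blast
      have "norm (c - c0 j) \<le> 2 * norm (\<Sum>k\<in>UNIV. ((c - c0 j) $ k) *\<^sub>R b' k (f x))"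
        by (rule near_identity_frame_lower[OF near'])
      also have "(\<Sum>k\<in>UNIV. ((c - c0 j) $ k) *\<^sub>R b' k (f x)) = residual j x"
        by (simp add: residual_def c(2) scaleR_diff_left sum_subtractf)
      also have "2 * norm (residual j x) \<le> 2 * C1 j * norm x"
        using 1(3)[of x j] x le(3)[of j] by simp
      also have "\<dots> \<le> C * norm x" using C1 by (intro mult_right_mono) auto
      finally show ?thesis using c by blast
    qed
    from choice[OF allI, OF this] show "\<exists>c. \<forall>j. (\<forall>k. w j < w' k \<longrightarrow> c j $ k = 0) \<and>
        frechet_derivative f (at x) (b j x) = (\<Sum>k\<in>UNIV. (c j $ k) *\<^sub>R b' k (f x)) \<and>
        norm (c j - c0 j) \<le> C * norm x"
      .
  qed
qed

text \<open>Expand the residual in the frame at \<open>f x\<close> and split each frame vector into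
  its standard value and an error. The standard part has no component \<open>m\<close>, since both
  coefficient vectors vanish there. The other part consists of products of two O(|x|) terms, so its
  derivative at 0 is zero.\<close>

lemma residual_derivative_component:
  assumes jm: "w j < w' m" and res: "(residual j has_derivative R) (at 0)"
  shows "R h $ m = 0"
proof -
  obtain d C where d: "0 < d" and C: "0 \<le> C"
    and near: "\<And>x k. norm x \<le> d \<Longrightarrow> norm (b' k (f x) - axis k 1) \<le> C * norm x"
    and coef: "\<And>x. norm x \<le> d \<Longrightarrow> \<exists>c. \<forall>j. (\<forall>k. w j < w' k \<longrightarrow> c j $ k = 0) \<and>
        frechet_derivative f (at x) (b j x) = (\<Sum>k\<in>UNIV. (c j $ k) *\<^sub>R b' k (f x)) \<and>
        norm (c j - c0 j) \<le> C * norm x"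
    using frame_coefficients_near_zero by blast
  have "((\<lambda>x. residual j x $ m) has_derivative (\<lambda>h. R h $ m)) (at 0)"
    by (rule bounded_linear.has_derivative[OF bounded_linear_vec_nth res])
  then show ?thesis
  proof (rule has_derivative_zero_of_quadratic_bound[OF _ d])
    fix x :: "real ^ 'n" assume x: "norm x \<le> d"
    from coef[OF this] obtain c' where "\<forall>j. (\<forall>k. w j < w' k \<longrightarrow> c' j $ k = 0) \<and>
        frechet_derivative f (at x) (b j x) = (\<Sum>k\<in>UNIV. (c' j $ k) *\<^sub>R b' k (f x)) \<and>
        norm (c' j - c0 j) \<le> C * norm x" ..
    then obtain c where c: "\<And>k. w j < w' k \<Longrightarrow> c $ k = 0"
        "frechet_derivative f (at x) (b j x) = (\<Sum>k\<in>UNIV. (c $ k) *\<^sub>R b' k (f x))"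
        "norm (c - c0 j) \<le> C * norm x" by blast
    have "residual j x = (\<Sum>k\<in>UNIV. ((c - c0 j) $ k) *\<^sub>R b' k (f x))"
      by (simp add: residual_def c(2) scaleR_diff_left sum_subtractf)
    also have "\<dots> = (\<Sum>k\<in>UNIV. ((c - c0 j) $ k) *\<^sub>R (b' k (f x) - axis k 1)) + (c - c0 j)"
      using sum_axis_scaleR[of "c - c0 j"] by (simp add: scaleR_diff_right sum_subtractf)
    finally have "residual j x $ m = (\<Sum>k\<in>UNIV. ((c - c0 j) $ k) *\<^sub>R (b' k (f x) - axis k 1)) $ m"
      using c(1)[OF jm] c0_eq_0[OF jm] by simp
    also have "\<bar>\<dots>\<bar> \<le> norm (\<Sum>k\<in>UNIV. ((c - c0 j) $ k) *\<^sub>R (b' k (f x) - axis k 1))"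
      by (rule component_le_norm_cart)
    also have "\<dots> \<le> (\<Sum>k\<in>(UNIV::'k set). (C * norm x) * (C * norm x))"
    proof (rule sum_norm_le)
      fix k
      have "\<bar>(c - c0 j) $ k\<bar> \<le> C * norm x"
        using component_le_norm_cart[of "c - c0 j" k] c(3) by simp
      then show "norm (((c - c0 j) $ k) *\<^sub>R (b' k (f x) - axis k 1)) \<le> (C * norm x) * (C * norm x)"
        unfolding norm_scaleR using near[OF x, of k] C by (intro mult_mono) auto
    qed
    also have "\<dots> = (real CARD('k) * C * C) * norm x * norm x" by simp
    finally show "\<bar>residual j x $ m\<bar> \<le> (real CARD('k) * C * C) * norm x * norm x" .
  qed
qed

text \<open>Component \<open>m\<close> of the derivatives of \<open>residual j\<close> along
  \<open>axis i 1\<close> and of \<open>residual i\<close> along \<open>axis j 1\<close> vanishes.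
  In the difference of these two equations the second derivatives of \<open>f\<close> cancel by
  symmetry, and what is left are the coordinate expressions of the brackets.\<close>

lemma bracket_related:
  assumes m: "w i < w' m" "w j < w' m"
  shows "frechet_derivative f (at 0)
      (frechet_derivative (b j) (at 0) (axis i 1) - frechet_derivative (b i) (at 0) (axis j 1)) $ m =
    (\<Sum>k\<in>UNIV. \<Sum>l\<in>UNIV. c0 i $ k * c0 j $ l *
      (frechet_derivative (b' l) (at 0) (axis k 1) - frechet_derivative (b' k) (at 0) (axis l 1)) $ m)"
proof -
  let ?D = "frechet_derivative f (at 0)"
  let ?F = "\<lambda>v. frechet_derivative (\<lambda>x. frechet_derivative f (at x) v) (at 0)"
  let ?B = "\<lambda>j. frechet_derivative (b j) (at 0)" and ?B' = "\<lambda>j. frechet_derivative (b' j) (at 0)"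
  have F: "((\<lambda>x. frechet_derivative f (at x) v) has_derivative ?F v) (at 0)" for v
    using f_twice_differentiable frechet_derivative_works by blast
  have sym: "?F (axis i 1) (axis j 1) = ?F (axis j 1) (axis i 1)"
    by (rule second_derivative_symmetric[OF U f_differentiable F F])
  have linB': "linear (?B' k)" for k
    using b'_differentiable frechet_derivative_works has_derivative_linear by blast
  have linD: "linear ?D" using linear_df U by blast
  have expand: "?B' k (?D (axis j 1)) = (\<Sum>l\<in>UNIV. (c0 j $ l) *\<^sub>R ?B' k (axis l 1))" for k j
    using sum_axis_scaleR[of "c0 j"]
    by (simp add: linear_sum[OF linB', symmetric] linear_cmul[OF linB', symmetric] c0_def)
  have comp: "(\<Sum>k\<in>UNIV. (c0 i $ k) *\<^sub>R ?B' k (?D (axis j 1))) $ m =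
      (\<Sum>k\<in>UNIV. \<Sum>l\<in>UNIV. c0 i $ k * c0 j $ l * ?B' k (axis l 1) $ m)" for i j
    by (simp add: expand sum_distrib_left mult.assoc)
  have 1: "?D (?B j (axis i 1)) $ m + ?F (axis j 1) (axis i 1) $ m
      = (\<Sum>k\<in>UNIV. \<Sum>l\<in>UNIV. c0 j $ k * c0 i $ l * ?B' k (axis l 1) $ m)"
    using residual_derivative_component[OF m(2) residual_has_derivative, of "axis i 1"]
    unfolding comp[symmetric] by simp
  have 2: "?D (?B i (axis j 1)) $ m + ?F (axis i 1) (axis j 1) $ m
      = (\<Sum>k\<in>UNIV. \<Sum>l\<in>UNIV. c0 i $ k * c0 j $ l * ?B' k (axis l 1) $ m)"
    using residual_derivative_component[OF m(1) residual_has_derivative, of "axis j 1"]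
    unfolding comp[symmetric] by simp
  \<comment> \<open>Renaming the indices gives both double sums the same coefficient, so that they
    can be subtracted termwise.\<close>
  have 3: "(\<Sum>k\<in>UNIV. \<Sum>l\<in>UNIV. c0 j $ k * c0 i $ l * ?B' k (axis l 1) $ m)
      = (\<Sum>k\<in>UNIV. \<Sum>l\<in>UNIV. c0 i $ k * c0 j $ l * ?B' l (axis k 1) $ m)"
    by (subst sum.swap) (simp add: mult.commute mult.left_commute)
  have "?D (?B j (axis i 1) - ?B i (axis j 1)) $ m = ?D (?B j (axis i 1)) $ m - ?D (?B i (axis j 1)) $ m"
    by (simp add: linear_diff[OF linD])
  also have "\<dots> = (\<Sum>k\<in>UNIV. \<Sum>l\<in>UNIV. c0 i $ k * c0 j $ l * ?B' l (axis k 1) $ m)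
      - (\<Sum>k\<in>UNIV. \<Sum>l\<in>UNIV. c0 i $ k * c0 j $ l * ?B' k (axis l 1) $ m)"
    using 1 2 3 sym by simp
  also have "\<dots> = (\<Sum>k\<in>UNIV. \<Sum>l\<in>UNIV. c0 i $ k * c0 j $ l * (?B' l (axis k 1) - ?B' k (axis l 1)) $ m)"
    by (simp add: sum_subtractf right_diff_distrib)
  finally show ?thesis .
qed

end

section \<open>Rescaled frames: uniform limits and expansion of constant vectors\<close>

definition dilation_limit ::
    "('n::finite \<Rightarrow> nat) \<Rightarrow> ('n \<Rightarrow> real ^ 'n \<Rightarrow> real ^ 'n) \<Rightarrow> ('n \<Rightarrow> real ^ 'n \<Rightarrow> real ^ 'n) \<Rightarrow> bool" where
  "dilation_limit w b L \<longleftrightarrow> (\<exists>R>0. \<exists>C\<ge>0. \<exists>\<epsilon>>0. \<forall>t x j. 0 < t \<longrightarrow> t < \<epsilon> \<longrightarrow> norm x \<le> R \<longrightarrow>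
     norm (t ^ w j *\<^sub>R dilation_pullback w t (b j) x - L j x) \<le> C * t)"

lemma dilation_limitI:
  fixes b L :: "'n::finite \<Rightarrow> real ^ 'n \<Rightarrow> real ^ 'n"
  assumes "\<And>j. \<exists>R>0. \<exists>C. \<exists>\<epsilon>>0. \<forall>t x. 0 < t \<longrightarrow> t < \<epsilon> \<longrightarrow> norm x \<le> R \<longrightarrow>
     norm (t ^ w j *\<^sub>R dilation_pullback w t (b j) x - L j x) \<le> C * t"
  shows "dilation_limit w b L"
proof -
  from assms obtain R C \<epsilon> where *: "\<And>j. 0 < R j" "\<And>j. 0 < \<epsilon> j"
    "\<And>t x j. 0 < t \<Longrightarrow> t < \<epsilon> j \<Longrightarrow> norm x \<le> R j \<Longrightarrow>
       norm (t ^ w j *\<^sub>R dilation_pullback w t (b j) x - L j x) \<le> C j * t"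
    by metis
  have C: "C j \<le> (\<Sum>j\<in>UNIV. \<bar>C j\<bar>)" for j
  proof -
    have "\<bar>C j\<bar> \<le> (\<Sum>j\<in>UNIV. \<bar>C j\<bar>)" by (rule member_le_sum) auto
    then show ?thesis by simp
  qed
  show ?thesis
    unfolding dilation_limit_def
  proof (rule exI[of _ "Min (range R)"], rule conjI, use *(1) in simp,
      rule exI[of _ "\<Sum>j\<in>UNIV. \<bar>C j\<bar>"], rule conjI, simp add: sum_nonneg,
      rule exI[of _ "Min (range \<epsilon>)"], rule conjI, use *(2) in simp, intro allI impI)
    fix t and x :: "real ^ 'n" and j assume t: "0 < t" "t < Min (range \<epsilon>)" "norm x \<le> Min (range R)"
    then have "t < \<epsilon> j" "norm x \<le> R j" by simp_all
    note *(3)[OF t(1) this]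
    also have "C j * t \<le> (\<Sum>j\<in>UNIV. \<bar>C j\<bar>) * t"
      using t(1) by (intro mult_right_mono C) simp
    finally show "norm (t ^ w j *\<^sub>R dilation_pullback w t (b j) x - L j x) \<le> (\<Sum>j\<in>UNIV. \<bar>C j\<bar>) * t" .
  qed
qed

lemma lipschitz_on_balls_uniform:
  fixes L :: "'j::finite \<Rightarrow> 'a::real_normed_vector \<Rightarrow> 'b::real_normed_vector"
  assumes "\<And>j. lipschitz_on_balls (L j)"
  obtains \<Lambda> where "0 \<le> \<Lambda>"
    "\<And>j x y. norm x \<le> R \<Longrightarrow> norm y \<le> R \<Longrightarrow> norm (L j x - L j y) \<le> \<Lambda> * norm (x - y)"
proof -
  have "\<forall>j. \<exists>l. l-lipschitz_on (cball 0 R) (L j)"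
    using assms unfolding lipschitz_on_balls_def by blast
  from choice[OF this] obtain l where l: "\<And>j. (l j)-lipschitz_on (cball 0 R) (L j)"
    by blast
  show thesis
  proof (rule that[of "\<Sum>j\<in>UNIV. l j"])
    have nn: "0 \<le> l j" for j using lipschitz_on_nonneg[OF l] .
    then show "0 \<le> (\<Sum>j\<in>UNIV. l j)" by (simp add: sum_nonneg)
    fix j :: 'j and x y :: 'a assume xy: "norm x \<le> R" "norm y \<le> R"
    have "l j \<le> (\<Sum>j\<in>UNIV. l j)" using nn by (intro member_le_sum) auto
    then have "l j * norm (x - y) \<le> (\<Sum>j\<in>UNIV. l j) * norm (x - y)"
      by (intro mult_right_mono) auto
    moreover have "norm (L j x - L j y) \<le> l j * norm (x - y)"
      using xy by (intro lipschitz_on_normD[OF l]) auto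
    ultimately show "norm (L j x - L j y) \<le> (\<Sum>j\<in>UNIV. l j) * norm (x - y)" by simp
  qed
qed

lemma field_on_line_at_zero:
  fixes L :: "'n::finite \<Rightarrow> real ^ 'n \<Rightarrow> real ^ 'n"
  assumes "\<And>v s. (\<Sum>j\<in>UNIV. (v $ j) *\<^sub>R L j (s *\<^sub>R v)) = v"
  shows "L j 0 = axis j 1"
proof -
  have "axis j 1 = (\<Sum>i\<in>UNIV. (axis j 1 $ i) *\<^sub>R L i 0)"
    using assms[of "axis j 1" 0] by simp
  also have "\<dots> = (\<Sum>i\<in>UNIV. if i = j then L i 0 else 0)"
    by (intro sum.cong refl) (simp add: axis_def)
  finally show ?thesis by simp
qed

text \<open>The hypothesis \<open>line\<close> writes \<open>x\<close> as the combination of the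
  limit fields at \<open>s *\<^sub>R x\<close> with coefficients \<open>x $ j\<close>. The rescaled
  fields are O(t) away and still a frame close to the standard one, so the coefficients of
  \<open>x\<close> in them differ from \<open>x\<close> by O(t |x|). The identity is stated after
  applying the dilation, ready for the derivative of a map.\<close>

lemma source_coefficients:
  fixes L :: "'n::finite \<Rightarrow> real ^ 'n \<Rightarrow> real ^ 'n"
  assumes lim: "dilation_limit w b L" and lip: "\<And>j. lipschitz_on_balls (L j)"
    and line: "\<And>v s. (\<Sum>j\<in>UNIV. (v $ j) *\<^sub>R L j (s *\<^sub>R v)) = v"
  shows "\<exists>\<rho>>0. \<exists>C\<ge>0. \<exists>\<epsilon>>0. \<forall>t x s. 0 < t \<longrightarrow> t < \<epsilon> \<longrightarrow> norm x \<le> \<rho> \<longrightarrow> 0 \<le> s \<longrightarrow> s \<le> 1 \<longrightarrow>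
    (\<exists>\<gamma>. dilation w t x = (\<Sum>j\<in>UNIV. (\<gamma> $ j * t ^ w j) *\<^sub>R b j (dilation w t (s *\<^sub>R x))) \<and>
         norm (\<gamma> - x) \<le> C * t * norm x)"
proof -
  from lim obtain R C \<epsilon> where R: "0 < R" and C: "0 \<le> C" and \<epsilon>: "0 < \<epsilon>" and
    lim: "\<And>t x j. 0 < t \<Longrightarrow> t < \<epsilon> \<Longrightarrow> norm x \<le> R \<Longrightarrow>
       norm (t ^ w j *\<^sub>R dilation_pullback w t (b j) x - L j x) \<le> C * t"
    unfolding dilation_limit_def by blast
  obtain \<Lambda> where \<Lambda>: "0 \<le> \<Lambda>"
    "\<And>j x y. norm x \<le> R \<Longrightarrow> norm y \<le> R \<Longrightarrow> norm (L j x - L j y) \<le> \<Lambda> * norm (x - y)"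
    using lipschitz_on_balls_uniform[of L R, OF lip] by metis
  \<comment> \<open>Half of the tolerance in \<open>near_identity_frame\<close>: one half for moving
    from 0 to \<open>y\<close> in the limit field, the other for passing from the limit field to the
    rescaled one.\<close>
  define q where "q = 1 / (4 * real CARD('n))"
  have q: "0 < q" by (simp add: q_def)
  define \<rho> where "\<rho> = min R (q / (\<Lambda> + 1))"
  define \<epsilon>' where "\<epsilon>' = min \<epsilon> (q / (C + 1))"
  have pos: "0 < \<rho>" "0 < \<epsilon>'" using R q \<Lambda> C \<epsilon> by (simp_all add: \<rho>_def \<epsilon>'_def)
  show ?thesis
  proof (rule exI[of _ \<rho>], rule conjI, rule pos,
      rule exI[of _ "2 * real CARD('n) * C"], rule conjI, use C in simp,
      rule exI[of _ \<epsilon>'], rule conjI, rule pos, intro allI impI)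
    fix t s :: real and x :: "real ^ 'n"
    assume t: "0 < t" "t < \<epsilon>'" and x: "norm x \<le> \<rho>" and s: "0 \<le> s" "s \<le> 1"
    define y where "y = s *\<^sub>R x"
    have "norm y \<le> norm x" using s by (simp add: y_def mult_left_le_one_le)
    with x have y: "norm y \<le> \<rho>" by simp
    define Y where "Y = (\<lambda>j. t ^ w j *\<^sub>R dilation_pullback w t (b j) y)"
    have YL: "norm (Y j - L j y) \<le> C * t" for j
      unfolding Y_def using t y by (intro lim) (auto simp: \<epsilon>'_def \<rho>_def)
    have "norm (Y j - axis j 1) \<le> 1 / (2 * real CARD('n))" for j
    proof -
      have "norm (L j y - axis j 1) \<le> \<Lambda> * norm (y - 0)"
        using \<Lambda>(2)[of y 0 j] y R field_on_line_at_zero[of L, OF line] by (simp add: \<rho>_def)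
      also have "\<dots> \<le> (\<Lambda> + 1) * (q / (\<Lambda> + 1))"
        using y \<Lambda>(1) by (intro mult_mono) (auto simp: \<rho>_def)
      also have "\<dots> = q" using \<Lambda>(1) by simp
      finally have 1: "norm (L j y - axis j 1) \<le> q" .
      have "C * t \<le> (C + 1) * (q / (C + 1))"
        using t C by (intro mult_mono) (auto simp: \<epsilon>'_def)
      also have "\<dots> = q" using C by simp
      finally have 2: "norm (Y j - L j y) \<le> q" using YL[of j] by simp
      have "norm (Y j - axis j 1) \<le> norm (Y j - L j y) + norm (L j y - axis j 1)"
        using norm_triangle_ineq[of "Y j - L j y" "L j y - axis j 1"] by simp
      with 1 2 show ?thesis by (simp add: q_def)
    qed
    note frame = near_identity_frame_lower[of Y, OF this] near_identity_frame_surj[of Y, OF this]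
    obtain \<gamma> where \<gamma>: "(\<Sum>j\<in>UNIV. (\<gamma> $ j) *\<^sub>R Y j) = x" using frame(2) by metis
    have "norm (\<gamma> - x) \<le> 2 * norm (\<Sum>j\<in>UNIV. ((\<gamma> - x) $ j) *\<^sub>R Y j)" by (rule frame(1))
    also have "(\<Sum>j\<in>UNIV. ((\<gamma> - x) $ j) *\<^sub>R Y j) = x - (\<Sum>j\<in>UNIV. (x $ j) *\<^sub>R Y j)"
      by (simp add: scaleR_diff_left sum_subtractf \<gamma>)
    also have "\<dots> = (\<Sum>j\<in>UNIV. (x $ j) *\<^sub>R (L j y - Y j))"
      using line[of x s] by (simp add: y_def scaleR_diff_right sum_subtractf)
    also have "2 * norm \<dots> \<le> 2 * (\<Sum>j\<in>(UNIV::'n set). norm x * (C * t))"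
    proof (intro mult_left_mono sum_norm_le)
      fix j
      show "norm ((x $ j) *\<^sub>R (L j y - Y j)) \<le> norm x * (C * t)"
        unfolding norm_scaleR using YL[of j] component_le_norm_cart[of x j]
        by (intro mult_mono) (auto simp: norm_minus_commute)
    qed simp
    finally have 1: "norm (\<gamma> - x) \<le> 2 * real CARD('n) * C * t * norm x"
      by (simp add: mult.commute mult.left_commute)
    have "dilation w t x = (\<Sum>j\<in>UNIV. (\<gamma> $ j) *\<^sub>R dilation w t (Y j))"
      by (subst \<gamma>[symmetric]) (simp add: linear_sum[OF linear_dilation] linear_cmul[OF linear_dilation])
    also have "\<dots> = (\<Sum>j\<in>UNIV. (\<gamma> $ j * t ^ w j) *\<^sub>R b j (dilation w t y))"
      using t by (simp add: Y_def linear_cmul[OF linear_dilation] dilation_pullback_eq dilation_inverse)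
    finally show "\<exists>\<gamma>. dilation w t x = (\<Sum>j\<in>UNIV. (\<gamma> $ j * t ^ w j) *\<^sub>R b j (dilation w t (s *\<^sub>R x))) \<and>
         norm (\<gamma> - x) \<le> 2 * real CARD('n) * C * t * norm x"
      using 1 by (auto simp: y_def)
  qed
qed

text \<open>Here the filtration condition tames the negative powers of \<open>t\<close>: if
  \<open>p < q\<close> the coefficient is zero. If \<open>p = q\<close> the powers cancel and the
  errors of the two factors give \<open>C * B + D\<close>; if \<open>q < p\<close> at least one
  factor \<open>t\<close> is left over, with constant \<open>(C + 1) * B\<close>. The constant of
  the conclusion is the sum of both.\<close>

lemma scaled_coefficient_bound:
  fixes \<gamma> \<xi> c c' :: real
  assumes t: "0 < t" "t \<le> 1" and \<gamma>: "\<bar>\<gamma> - \<xi>\<bar> \<le> C * t" "\<bar>\<xi>\<bar> \<le> 1" and c: "\<bar>c\<bar> \<le> B" "\<bar>c - c'\<bar> \<le> D * t"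
    and zero: "p < q \<Longrightarrow> c = 0" and C: "0 \<le> C" and D: "0 \<le> D" and B: "0 \<le> B"
  shows "\<bar>\<gamma> * t ^ p * c * inverse (t ^ q) - (if p = q then \<xi> * c' else 0)\<bar> \<le> (C * B + D + (C + 1) * B) * t"
proof -
  consider "p < q" | "p = q" | "q < p" by linarith
  then show ?thesis
  proof cases
    case 1
    then show ?thesis using zero t C D B by simp
  next
    case 2
    have "\<bar>(\<gamma> - \<xi>) * c + \<xi> * (c - c')\<bar> \<le> \<bar>(\<gamma> - \<xi>) * c\<bar> + \<bar>\<xi> * (c - c')\<bar>" by (rule abs_triangle_ineq)
    also have "\<dots> \<le> (C * t) * B + 1 * (D * t)"
      unfolding abs_mult using assms by (intro add_mono mult_mono) auto
    also have "\<dots> \<le> (C * B + D + (C + 1) * B) * t"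
      using t B C by (simp add: algebra_simps)
    finally have "\<bar>\<gamma> * c - \<xi> * c'\<bar> \<le> (C * B + D + (C + 1) * B) * t" by (simp add: algebra_simps)
    moreover have "\<gamma> * t ^ q * c * inverse (t ^ q) = \<gamma> * c" using t by simp
    ultimately show ?thesis unfolding 2 by (simp only: refl if_True)
  next
    case 3
    have "C * t \<le> C" using t C by (simp add: mult_left_le)
    with \<gamma> have g: "\<bar>\<gamma>\<bar> \<le> C + 1" by linarith
    have "t ^ p * inverse (t ^ q) = t ^ (p - q)"
      using 3 t by (simp add: power_diff divide_inverse)
    moreover have "t ^ (p - q) \<le> t ^ 1" using 3 t by (intro power_decreasing) auto
    ultimately have tt: "\<bar>t ^ p * inverse (t ^ q)\<bar> \<le> t" using t by simp
    have "\<gamma> * t ^ p * c * inverse (t ^ q) = (\<gamma> * c) * (t ^ p * inverse (t ^ q))" by simp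
    also have "\<bar>\<dots>\<bar> \<le> ((C + 1) * B) * t"
      unfolding abs_mult[of "\<gamma> * c"] abs_mult[of \<gamma>] using g c tt C B t by (intro mult_mono) auto
    also have "\<dots> \<le> (C * B + D + (C + 1) * B) * t"
      using t B C D by (intro mult_right_mono) auto
    finally show ?thesis using 3 by simp
  qed
qed

section \<open>Convergence of the rescaled maps\<close>

context frame_related_map
begin

definition rescaled :: "real \<Rightarrow> real ^ 'n \<Rightarrow> real ^ 'k" where
  "rescaled t x = dilation w' (inverse t) (f (dilation w t x))"

lemma rescaled_has_vector_derivative:
  assumes "dilation w t (s *\<^sub>R x) \<in> U"
  shows "((\<lambda>s. rescaled t (s *\<^sub>R x)) has_vector_derivative
    dilation w' (inverse t) (frechet_derivative f (at (dilation w t (s *\<^sub>R x))) (dilation w t x))) (at s)"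
proof -
  let ?D = "frechet_derivative f (at (dilation w t (s *\<^sub>R x)))"
  have 1: "((\<lambda>s. dilation w t (s *\<^sub>R x)) has_derivative (\<lambda>h. dilation w t (h *\<^sub>R x))) (at s)"
    by (intro bounded_linear.has_derivative[OF linear_conv_bounded_linear[THEN iffD1, OF linear_dilation]])
       (auto intro!: derivative_eq_intros)
  have 2: "((\<lambda>s. f (dilation w t (s *\<^sub>R x))) has_derivative (\<lambda>h. ?D (dilation w t (h *\<^sub>R x)))) (at s)"
    using diff_chain_at[OF 1 f_has_derivative[OF assms]] by (simp add: o_def)
  have "((\<lambda>s. rescaled t (s *\<^sub>R x)) has_derivative (\<lambda>h. dilation w' (inverse t) (?D (dilation w t (h *\<^sub>R x))))) (at s)"
    unfolding rescaled_def
    by (intro bounded_linear.has_derivative[OF linear_conv_bounded_linear[THEN iffD1, OF linear_dilation]] 2)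
  moreover have "dilation w' (inverse t) (?D (dilation w t (h *\<^sub>R x))) =
      h *\<^sub>R dilation w' (inverse t) (?D (dilation w t x))" for h
  proof -
    have "dilation w t (h *\<^sub>R x) = h *\<^sub>R dilation w t x" by (rule linear_cmul[OF linear_dilation])
    then have "?D (dilation w t (h *\<^sub>R x)) = h *\<^sub>R ?D (dilation w t x)"
      by (simp only: linear_cmul[OF linear_df[OF assms]])
    then show ?thesis by (simp only: linear_cmul[OF linear_dilation, of w' "inverse t" h])
  qed
  ultimately show ?thesis
    by (simp only: has_vector_derivative_def)
qed

text \<open>The velocity is expressed through the rescaled target fields at
  \<open>rescaled t y\<close> itself. For \<open>y\<close> on the line through \<open>x\<close> this
  makes the rescaled curve a solution of an equation that can be compared with that of a straight
  line.\<close>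

lemma rescaled_derivative_eq:
  assumes t: "t \<noteq> 0" and z: "dilation w t y \<in> U"
    and \<gamma>: "dilation w t x = (\<Sum>j\<in>UNIV. (\<gamma> $ j * t ^ w j) *\<^sub>R b j (dilation w t y))"
    and c: "\<And>j. frechet_derivative f (at (dilation w t y)) (b j (dilation w t y)) =
      (\<Sum>k\<in>UNIV. (c j $ k) *\<^sub>R b' k (f (dilation w t y)))"
  shows "dilation w' (inverse t) (frechet_derivative f (at (dilation w t y)) (dilation w t x)) =
    (\<Sum>k\<in>UNIV. (\<Sum>j\<in>UNIV. \<gamma> $ j * t ^ w j * c j $ k * inverse (t ^ w' k)) *\<^sub>R
      (t ^ w' k *\<^sub>R dilation_pullback w' t (b' k) (rescaled t y)))"
proof -
  let ?z = "dilation w t y"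
  have "frechet_derivative f (at ?z) (dilation w t x) =
      (\<Sum>j\<in>UNIV. \<Sum>k\<in>UNIV. (\<gamma> $ j * t ^ w j * c j $ k) *\<^sub>R b' k (f ?z))"
    by (simp add: \<gamma> linear_sum[OF linear_df[OF z]] linear_cmul[OF linear_df[OF z]] c scaleR_sum_right)
  also have "\<dots> = (\<Sum>k\<in>UNIV. (\<Sum>j\<in>UNIV. \<gamma> $ j * t ^ w j * c j $ k) *\<^sub>R b' k (f ?z))"
    by (subst sum.swap) (simp add: scaleR_sum_left)
  finally have "dilation w' (inverse t) (frechet_derivative f (at ?z) (dilation w t x)) =
      (\<Sum>k\<in>UNIV. (\<Sum>j\<in>UNIV. \<gamma> $ j * t ^ w j * c j $ k) *\<^sub>R dilation w' (inverse t) (b' k (f ?z)))"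
    by (simp add: linear_sum[OF linear_dilation] linear_cmul[OF linear_dilation])
  also have "\<dots> = (\<Sum>k\<in>UNIV. (\<Sum>j\<in>UNIV. \<gamma> $ j * t ^ w j * c j $ k * inverse (t ^ w' k)) *\<^sub>R
      (t ^ w' k *\<^sub>R dilation_pullback w' t (b' k) (rescaled t y)))"
  proof (intro sum.cong refl)
    fix k
    have "dilation_pullback w' t (b' k) (rescaled t y) = dilation w' (inverse t) (b' k (f ?z))"
      using t by (simp add: dilation_pullback_eq rescaled_def dilation_inverse)
    then show "(\<Sum>j\<in>UNIV. \<gamma> $ j * t ^ w j * c j $ k) *\<^sub>R dilation w' (inverse t) (b' k (f ?z)) =
      (\<Sum>j\<in>UNIV. \<gamma> $ j * t ^ w j * c j $ k * inverse (t ^ w' k)) *\<^sub>R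
        (t ^ w' k *\<^sub>R dilation_pullback w' t (b' k) (rescaled t y))"
      using t by (simp add: sum_distrib_right[symmetric])
  qed
  finally show ?thesis .
qed

lemma rescaled_tendsto_hom:
  assumes source: "dilation_limit w b L" "\<And>j. lipschitz_on_balls (L j)"
      "\<And>v s. (\<Sum>j\<in>UNIV. (v $ j) *\<^sub>R L j (s *\<^sub>R v)) = v"
    and target: "dilation_limit w' b' L'" "\<And>k. lipschitz_on_balls (L' k)"
      "\<And>v s. (\<Sum>k\<in>UNIV. (v $ k) *\<^sub>R L' k (s *\<^sub>R v)) = v"
  shows "\<exists>\<rho>>0. \<exists>C. \<exists>\<epsilon>>0. \<forall>t x. 0 < t \<longrightarrow> t < \<epsilon> \<longrightarrow> norm x \<le> \<rho> \<longrightarrow> norm (rescaled t x - hom x) \<le> C * t"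
proof -
  obtain \<rho>2 C2 \<epsilon>2 where pos2: "0 < \<rho>2" "0 \<le> C2" "0 < \<epsilon>2" and
    src: "\<And>t x s. 0 < t \<Longrightarrow> t < \<epsilon>2 \<Longrightarrow> norm x \<le> \<rho>2 \<Longrightarrow> 0 \<le> s \<Longrightarrow> s \<le> 1 \<Longrightarrow>
      \<exists>\<gamma>. dilation w t x = (\<Sum>j\<in>UNIV. (\<gamma> $ j * t ^ w j) *\<^sub>R b j (dilation w t (s *\<^sub>R x))) \<and>
         norm (\<gamma> - x) \<le> C2 * t * norm x"
    using source_coefficients[OF source] by blast
  obtain d C1 where pos1: "0 < d" "0 \<le> C1" and
    coef: "\<And>x. norm x \<le> d \<Longrightarrow> x \<in> U \<and> (\<exists>c. \<forall>j. (\<forall>k. w j < w' k \<longrightarrow> c j $ k = 0) \<and>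
        frechet_derivative f (at x) (b j x) = (\<Sum>k\<in>UNIV. (c j $ k) *\<^sub>R b' k (f x)) \<and>
        norm (c j - c0 j) \<le> C1 * norm x)"
    using frame_coefficients_near_zero by blast
  obtain R C3 \<epsilon>3 where pos3: "0 < R" "0 \<le> C3" "0 < \<epsilon>3" and
    tgt: "\<And>t y k. 0 < t \<Longrightarrow> t < \<epsilon>3 \<Longrightarrow> norm y \<le> R \<Longrightarrow>
       norm (t ^ w' k *\<^sub>R dilation_pullback w' t (b' k) y - L' k y) \<le> C3 * t"
    using target(1) unfolding dilation_limit_def by blast
  obtain \<Lambda> where \<Lambda>: "0 \<le> \<Lambda>"
    "\<And>k x y. norm x \<le> R \<Longrightarrow> norm y \<le> R \<Longrightarrow> norm (L' k x - L' k y) \<le> \<Lambda> * norm (x - y)"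
    using lipschitz_on_balls_uniform[of L' R, OF target(2)] by metis
  obtain K where K: "0 \<le> K" "\<And>x. norm (hom x) \<le> norm x * K"
    using linear_hom linear_conv_bounded_linear bounded_linear.nonneg_bounded by metis
  define B where "B = 1 + \<Lambda> * R"
  have B: "0 \<le> B" using \<Lambda> pos3 by (simp add: B_def)
  have L'_bound: "norm (L' k y) \<le> B" if "norm y \<le> R" for k y
  proof -
    have "norm (L' k y - L' k 0) \<le> \<Lambda> * norm (y - 0)" using that pos3 by (intro \<Lambda>(2)) auto
    also have "\<dots> \<le> \<Lambda> * R" using that \<Lambda>(1) by (intro mult_left_mono) auto
    finally have "norm (L' k y - axis k 1) \<le> \<Lambda> * R"
      by (simp add: field_on_line_at_zero[of L', OF target(3)])
    then show ?thesis
      using norm_triangle_sub[of "L' k y" "axis k 1"] by (simp add: B_def)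
  qed
  \<comment> \<open>If both the deviation and the line are bounded by \<open>\<eta>\<close>, then
    the curve lies in the ball of radius \<open>R\<close>, where the target fields are
    controlled.\<close>
  define \<eta> where "\<eta> = R / 2"
  have \<eta>: "0 < \<eta>" using pos3 by (simp add: \<eta>_def)
  define n where "n = real CARD('n)"
  define n' where "n' = real CARD('k)"
  have n: "0 \<le> n" "0 < n'" by (simp_all add: n_def n'_def)
  \<comment> \<open>The last two entries make \<open>hom x\<close> at most \<open>\<eta>\<close> and
    the Lipschitz term, \<open>n' * norm (hom x) * \<Lambda>\<close> times the deviation, at most
    half of the deviation.\<close>
  define \<rho> where "\<rho> = Min {1, \<rho>2, d, \<eta> / (K + 1), 1 / (2 * (n' * \<Lambda> + 1) * (K + 1))}"
  have \<rho>: "0 < \<rho>" using pos1 pos2 \<eta> K \<Lambda> n by (simp add: \<rho>_def add_nonneg_pos)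
  have \<rho>_le: "\<rho> \<le> 1" "\<rho> \<le> \<rho>2" "\<rho> \<le> d" "\<rho> \<le> \<eta> / (K + 1)" "\<rho> \<le> 1 / (2 * (n' * \<Lambda> + 1) * (K + 1))"
    by (simp_all add: \<rho>_def)
  have hom_small: "norm (hom x) \<le> \<eta>" "n' * norm (hom x) * \<Lambda> \<le> 1 / 2" if "norm x \<le> \<rho>" for x
  proof -
    have h: "norm (hom x) \<le> \<rho> * (K + 1)"
      using K(2)[of x] that K(1) \<rho> by (smt (verit) mult_mono norm_ge_zero)
    have "\<rho> * (K + 1) \<le> \<eta>" using \<rho>_le(4) K(1) by (simp add: pos_le_divide_eq)
    with h show "norm (hom x) \<le> \<eta>" by simp
    have "\<rho> * (2 * (n' * \<Lambda> + 1) * (K + 1)) \<le> 1"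
      using \<rho>_le(5) K(1) n \<Lambda>(1) by (subst (asm) pos_le_divide_eq) (auto intro!: mult_pos_pos add_nonneg_pos)
    then have "(n' * \<Lambda> + 1) * (\<rho> * (K + 1)) \<le> 1 / 2" by (simp add: algebra_simps)
    moreover have "(n' * \<Lambda>) * norm (hom x) \<le> (n' * \<Lambda> + 1) * (\<rho> * (K + 1))"
      using h n \<Lambda>(1) by (intro mult_mono) auto
    ultimately show "n' * norm (hom x) * \<Lambda> \<le> 1 / 2" by (simp add: algebra_simps)
  qed
  define Cc where "Cc = C1 * d + (\<Sum>j\<in>UNIV. norm (c0 j))"
  have c0_le: "norm (c0 j) \<le> (\<Sum>j\<in>UNIV. norm (c0 j))" for j by (rule member_le_sum) auto
  have Cc: "0 \<le> Cc" using pos1 by (auto simp: Cc_def intro!: add_nonneg_nonneg sum_nonneg)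
  \<comment> \<open>The constant of \<open>scaled_coefficient_bound\<close> for the errors
    \<open>C2\<close> of the source coefficients and \<open>C1\<close> of the frame coefficients,
    the latter being bounded by \<open>Cc\<close>.\<close>
  define C4 where "C4 = C2 * Cc + C1 + (C2 + 1) * Cc"
  have C4: "0 \<le> C4" using pos1 pos2 Cc by (simp add: C4_def)
  define C5 where "C5 = n' * (n * C4 * (B + C3)) + n' * (\<eta> * C3)"
  have C5: "0 \<le> C5" using n C4 B pos3 \<eta> by (simp add: C5_def)
  \<comment> \<open>The last entry gives \<open>2 * (C5 * t) < \<eta>\<close>, the strict inequality
    on which the bootstrap relies.\<close>
  define \<epsilon> where "\<epsilon> = Min {1, \<epsilon>2, \<epsilon>3, \<eta> / (2 * C5 + 1)}"
  have \<epsilon>: "0 < \<epsilon>" using pos2 pos3 \<eta> C5 by (simp add: \<epsilon>_def)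
  have \<epsilon>_le: "\<epsilon> \<le> 1" "\<epsilon> \<le> \<epsilon>2" "\<epsilon> \<le> \<epsilon>3" "\<epsilon> \<le> \<eta> / (2 * C5 + 1)"
    by (simp_all add: \<epsilon>_def)
  have main: "norm (rescaled t x - hom x) \<le> 2 * C5 * t" if t: "0 < t" "t < \<epsilon>" and x: "norm x \<le> \<rho>" for t x
  proof -
    have t1: "t \<le> 1" "t < \<epsilon>2" "t < \<epsilon>3" using t \<epsilon>_le by auto
    have "t * (2 * C5 + 1) < \<eta>"
      using t(2) \<epsilon>_le(4) C5 by (simp add: pos_less_divide_eq[symmetric])
    then have At: "2 * (C5 * t) < \<eta>" using t by (simp add: algebra_simps)
    define z where "z = (\<lambda>s. dilation w t (s *\<^sub>R x))"
    have z: "norm (z s) \<le> t" "norm (z s) \<le> d" if "0 \<le> s" "s \<le> 1" for s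
    proof -
      have "norm (z s) \<le> t * norm (s *\<^sub>R x)"
        unfolding z_def using t t1 by (intro norm_dilation_le w_pos) auto
      also have "\<dots> \<le> t * \<rho>"
        using that x t by (intro mult_left_mono) (auto intro: order_trans[OF mult_left_le_one_le])
      finally have 1: "norm (z s) \<le> t * \<rho>" .
      have "t * \<rho> \<le> t" "t * \<rho> \<le> \<rho>" using t t1 \<rho> \<rho>_le(1) by (simp_all add: mult_left_le mult_left_le_one_le)
      with 1 \<rho>_le(3) show "norm (z s) \<le> t" "norm (z s) \<le> d" by simp_all
    qed
    have zU: "z s \<in> U" if "0 \<le> s" "s \<le> 1" for s using coef z(2)[OF that] by blast
    define g where "g = (\<lambda>s. rescaled t (s *\<^sub>R x))"
    define g' where "g' = (\<lambda>s. dilation w' (inverse t) (frechet_derivative f (at (z s)) (dilation w t x)))"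
    have g_der: "(g has_vector_derivative g' s) (at s)" if "0 \<le> s" "s \<le> 1" for s
      unfolding g_def g'_def z_def using zU[OF that] unfolding z_def by (rule rescaled_has_vector_derivative)
    define u where "u = (\<lambda>s. g s - s *\<^sub>R hom x)"
    have u_der: "(u has_vector_derivative g' s - hom x) (at s)" if "0 \<le> s" "s \<le> 1" for s
      unfolding u_def
      by (auto intro!: derivative_eq_intros g_der that)
    have u_bound: "norm (g' s - hom x) \<le> C5 * t + norm (u s) / 2" if s: "0 < s" "s < 1" and us: "norm (u s) \<le> \<eta>" for s
    proof -
      have s': "0 \<le> s" "s \<le> 1" using s by auto
      have sh: "norm (s *\<^sub>R hom x) \<le> \<eta>"
        using hom_small(1)[OF x] s' by (auto intro: order_trans[OF mult_left_le_one_le])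
      have gR: "norm (g s) \<le> R"
        using norm_triangle_ineq[of "u s" "s *\<^sub>R hom x"] us sh by (simp add: u_def \<eta>_def)
      have shR: "norm (s *\<^sub>R hom x) \<le> R" using sh \<eta> by (simp add: \<eta>_def)
      define Y where "Y = (\<lambda>k. t ^ w' k *\<^sub>R dilation_pullback w' t (b' k) (g s))"
      obtain \<gamma> where \<gamma>: "dilation w t x = (\<Sum>j\<in>UNIV. (\<gamma> $ j * t ^ w j) *\<^sub>R b j (z s))"
        "norm (\<gamma> - x) \<le> C2 * t * norm x"
        using src[OF t(1) t1(2) order_trans[OF x \<rho>_le(2)] s'] unfolding z_def by blast
      obtain c where c: "\<forall>j. (\<forall>k. w j < w' k \<longrightarrow> c j $ k = 0) \<and>
        frechet_derivative f (at (z s)) (b j (z s)) = (\<Sum>k\<in>UNIV. (c j $ k) *\<^sub>R b' k (f (z s))) \<and>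
        norm (c j - c0 j) \<le> C1 * norm (z s)"
        using coef[OF z(2)[OF s']] by blast
      define m where "m = (\<lambda>k. \<Sum>j\<in>UNIV. \<gamma> $ j * t ^ w j * c j $ k * inverse (t ^ w' k))"
      have g'_eq: "g' s = (\<Sum>k\<in>UNIV. m k *\<^sub>R Y k)"
        unfolding g'_def m_def Y_def g_def z_def
        by (rule rescaled_derivative_eq) (use t zU[OF s'] \<gamma>(1) c in \<open>auto simp: z_def\<close>)
      have m_bound: "\<bar>m k - hom x $ k\<bar> \<le> n * C4 * t" for k
      proof -
        have "hom x $ k = (\<Sum>j\<in>UNIV. if w j = w' k then x $ j * c0 j $ k else 0)"
          by (simp add: hom_def sum.If_cases Collect_conj_eq)
        then have "m k - hom x $ k = (\<Sum>j\<in>UNIV. \<gamma> $ j * t ^ w j * c j $ k * inverse (t ^ w' k)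
            - (if w j = w' k then x $ j * c0 j $ k else 0))"
          by (simp add: m_def sum_subtractf)
        also have "\<bar>\<dots>\<bar> \<le> (\<Sum>j\<in>(UNIV::'n set). C4 * t)"
        proof (rule order_trans[OF sum_abs sum_mono])
          fix j
          have xj: "\<bar>x $ j\<bar> \<le> 1" using component_le_norm_cart[of x j] x \<rho>_le(1) by simp
          have "C2 * t * norm x \<le> C2 * t" using x \<rho>_le(1) t pos2 by (intro mult_left_le) auto
          with \<gamma>(2) component_le_norm_cart[of "\<gamma> - x" j]
          have g: "\<bar>\<gamma> $ j - x $ j\<bar> \<le> C2 * t" by simp
          have cc: "norm (c j - c0 j) \<le> C1 * norm (z s)" using c by blast
          have "C1 * norm (z s) \<le> C1 * t" using z[OF s'] pos1 by (intro mult_left_mono) auto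
          with cc component_le_norm_cart[of "c j - c0 j" k]
          have c1: "\<bar>c j $ k - c0 j $ k\<bar> \<le> C1 * t" by simp
          have "C1 * norm (z s) \<le> C1 * d" using z[OF s'] pos1 by (intro mult_left_mono) auto
          with cc have "norm (c j) \<le> Cc"
            using norm_triangle_sub[of "c j" "c0 j"] c0_le[of j] by (simp add: Cc_def)
          then have c2: "\<bar>c j $ k\<bar> \<le> Cc" using component_le_norm_cart[of "c j" k] by simp
          have c3: "w j < w' k \<Longrightarrow> c j $ k = 0" using c by blast
          show "\<bar>\<gamma> $ j * t ^ w j * c j $ k * inverse (t ^ w' k)
            - (if w j = w' k then x $ j * c0 j $ k else 0)\<bar> \<le> C4 * t"
            unfolding C4_def
            by (rule scaled_coefficient_bound[OF t(1) t1(1) g xj c2 c1 c3 pos2(2) pos1(2) Cc])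
        qed
        also have "\<dots> = n * C4 * t" by (simp add: n_def)
        finally show ?thesis .
      qed
      have Y_L: "norm (Y k - L' k (g s)) \<le> C3 * t" for k
        unfolding Y_def by (rule tgt[OF t(1) t1(3) gR])
      have Y_bound: "norm (Y k) \<le> B + C3" for k
      proof -
        have "C3 * t \<le> C3" using t1 pos3 by (intro mult_left_le) auto
        then show ?thesis
          using Y_L[of k] L'_bound[OF gR, of k] norm_triangle_sub[of "Y k" "L' k (g s)"] by simp
      qed
      \<comment> \<open>Writing \<open>hom x\<close> in the limit fields along its own line splits
        the difference of velocities into the error of the coefficients, the error of the fields at
        the same point, and the Lipschitz difference of the limit fields at two points. The first
        two are O(t), the third is absorbed.\<close>
      have "(\<Sum>k\<in>UNIV. (hom x $ k) *\<^sub>R L' k (s *\<^sub>R hom x)) = hom x" by (rule target(3))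
      then have eq: "g' s - hom x = (\<Sum>k\<in>UNIV. (m k - hom x $ k) *\<^sub>R Y k
          + (hom x $ k) *\<^sub>R (Y k - L' k (g s)) + (hom x $ k) *\<^sub>R (L' k (g s) - L' k (s *\<^sub>R hom x)))"
        by (simp add: g'_eq sum.distrib sum_subtractf algebra_simps)
      have "norm (g' s - hom x) \<le> (\<Sum>k\<in>(UNIV::'k set). n * C4 * t * (B + C3) + \<eta> * (C3 * t) + norm (hom x) * (\<Lambda> * norm (u s)))"
        unfolding eq
      proof (rule sum_norm_le)
        fix k
        have hk: "\<bar>hom x $ k\<bar> \<le> norm (hom x)" by (rule component_le_norm_cart)
        have "norm ((m k - hom x $ k) *\<^sub>R Y k) \<le> n * C4 * t * (B + C3)"
          unfolding norm_scaleR using m_bound Y_bound n C4 t by (intro mult_mono) auto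
        moreover have "norm ((hom x $ k) *\<^sub>R (Y k - L' k (g s))) \<le> \<eta> * (C3 * t)"
          unfolding norm_scaleR using hk hom_small(1)[OF x] Y_L \<eta> by (intro mult_mono) auto
        moreover have "norm ((hom x $ k) *\<^sub>R (L' k (g s) - L' k (s *\<^sub>R hom x))) \<le> norm (hom x) * (\<Lambda> * norm (u s))"
          unfolding norm_scaleR using hk \<Lambda>(2)[OF gR shR, of k] by (intro mult_mono) (auto simp: u_def)
        ultimately show "norm ((m k - hom x $ k) *\<^sub>R Y k + (hom x $ k) *\<^sub>R (Y k - L' k (g s))
            + (hom x $ k) *\<^sub>R (L' k (g s) - L' k (s *\<^sub>R hom x)))
            \<le> n * C4 * t * (B + C3) + \<eta> * (C3 * t) + norm (hom x) * (\<Lambda> * norm (u s))"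
          by (intro order_trans[OF norm_triangle_ineq] add_mono)
      qed
      also have "\<dots> = C5 * t + (n' * norm (hom x) * \<Lambda>) * norm (u s)"
        by (simp add: C5_def n'_def algebra_simps)
      also have "\<dots> \<le> C5 * t + 1 / 2 * norm (u s)"
        using hom_small(2)[OF x] by (intro add_left_mono mult_right_mono) auto
      finally show ?thesis by simp
    qed
    have "norm (u 1) \<le> 2 * (C5 * t)"
    proof (rule integral_inequality_bootstrap[where u = u and u' = "\<lambda>s. g' s - hom x" and \<eta> = \<eta>])
      show "continuous_on {0..1} u"
        by (intro continuous_at_imp_continuous_on ballI has_vector_derivative_continuous[OF u_der]) auto
      show "u 0 = 0"
        by (simp add: u_def g_def rescaled_def linear_0[OF linear_dilation] f_zero)
    qed (use u_der u_bound At C5 t in auto)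
    then show ?thesis by (simp add: u_def g_def)
  qed
  show ?thesis
    using \<rho> \<epsilon> main by blast
qed

end

section \<open>Frames of Carnot manifolds\<close>

lemma sum_fun_apply: "(\<Sum>i\<in>I. f i) x = (\<Sum>i\<in>I. f i x)"
  for f :: "'i \<Rightarrow> 'a \<Rightarrow> 'b::comm_monoid_add"
  by (induction I rule: infinite_finite_induct) (simp_all add: plus_fun_def zero_fun_def)

lemma frechet_derivative_chain_open:
  assumes "open S" "x \<in> S" "\<And>y. y \<in> S \<Longrightarrow> h y = f (g y)"
    and "g differentiable (at x)" "f differentiable (at (g x))"
  shows "frechet_derivative h (at x) v = frechet_derivative f (at (g x)) (frechet_derivative g (at x) v)"
proof -
  have "((f \<circ> g) has_derivative (frechet_derivative f (at (g x)) \<circ> frechet_derivative g (at x))) (at x)"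
    using assms(4,5) by (intro diff_chain_at) (simp_all add: frechet_derivative_works[symmetric])
  then have "(h has_derivative (frechet_derivative f (at (g x)) \<circ> frechet_derivative g (at x))) (at x)"
    by (rule has_derivative_transform_within_open[OF _ assms(1,2)]) (simp add: assms(3))
  from frechet_derivative_at[OF this] show ?thesis by (simp add: fun_eq_iff)
qed

lemma smooth_on_imp_differentiable:
  assumes "smooth_on S f" "x \<in> S"
  shows "f differentiable (at x)"
proof -
  have "Ck_on (Suc 0) S f" using assms by (simp only: smooth_on_def)
  with assms(2) show ?thesis by simp
qed

lemma smooth_on_imp_twice_differentiable:
  assumes "smooth_on S f" "x \<in> S"
  shows "(\<lambda>x. frechet_derivative f (at x) v) differentiable (at x)"
proof -
  have "Ck_on (Suc (Suc 0)) S f" using assms by (simp only: smooth_on_def)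
  with assms(2) show ?thesis by simp
qed

lemma span_image_coefficients:
  fixes f :: "'i \<Rightarrow> 'v::real_vector"
  assumes u: "u \<in> span (f ` J)" and J: "finite J"
  shows "\<exists>c. u = (\<Sum>j\<in>J. c j *\<^sub>R f j)"
proof -
  let ?S = "{u. \<exists>c. u = (\<Sum>j\<in>J. c j *\<^sub>R f j)}"
  have "span (f ` J) \<subseteq> ?S"
  proof (rule span_minimal)
    show "f ` J \<subseteq> ?S"
    proof (clarify)
      fix j assume "j \<in> J"
      have "(\<Sum>i\<in>J. (if i = j then 1 else 0) *\<^sub>R f i) = (\<Sum>i\<in>J. if i = j then f i else 0)"
        by (intro sum.cong) auto
      also have "\<dots> = f j" using \<open>j \<in> J\<close> J by simp
      finally show "\<exists>c. f j = (\<Sum>i\<in>J. c i *\<^sub>R f i)" by (metis (no_types))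
    qed
    show "subspace ?S"
    proof (rule subspaceI)
      show "0 \<in> ?S" by (auto intro!: exI[of _ "\<lambda>_. 0"])
    next
      fix x y assume "x \<in> ?S" "y \<in> ?S"
      then obtain c d where "x = (\<Sum>j\<in>J. c j *\<^sub>R f j)" "y = (\<Sum>j\<in>J. d j *\<^sub>R f j)" by blast
      then have "x + y = (\<Sum>j\<in>J. (c j + d j) *\<^sub>R f j)" by (simp add: scaleR_left_distrib sum.distrib)
      then show "x + y \<in> ?S" by (intro CollectI exI)
    next
      fix a x assume "x \<in> ?S"
      then obtain c where "x = (\<Sum>j\<in>J. c j *\<^sub>R f j)" by blast
      then have "a *\<^sub>R x = (\<Sum>j\<in>J. (a * c j) *\<^sub>R f j)" by (simp add: scaleR_sum_right)
      then show "a *\<^sub>R x \<in> ?S" by (intro CollectI exI)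
    qed
  qed
  with u show ?thesis by blast
qed

text \<open>Tangent vectors are functions on all charts and live in an ambient space of infinite
  dimension, so the dimension count is made relative to the finite spanning set
  \<open>B\<close>.\<close>

lemma span_eq_of_card_eq:
  fixes A B :: "'v::real_vector set"
  assumes A: "independent A" "A \<subseteq> span B" and B: "finite B" and card: "card A = card B"
  shows "span A = span B"
proof
  show "span A \<subseteq> span B" using A(2) by (simp add: span_minimal)
  show "span B \<subseteq> span A"
  proof (rule ccontr)
    assume "\<not> span B \<subseteq> span A"
    then obtain x where x: "x \<in> span B" "x \<notin> span A" by blast
    have "finite A" using independent_span_bound[OF B A] by blast
    moreover have "card (insert x A) \<le> card B"
      using independent_span_bound[OF B independent_insertI[OF x(2) A(1)]] A(2) x(1) by blast
    moreover have "x \<notin> A" using x(2) span_base by blast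
    ultimately show False using card by simp
  qed
qed

section \<open>Charts and tangent spaces\<close>

lemma chart_inv_chart:
  assumes "smooth_manifold M" "\<kappa> \<in> atlas M" "p \<in> fst \<kappa>"
  shows "chart_inv \<kappa> (snd \<kappa> p) = p"
proof -
  have "topological_chart (mtop M) \<kappa>" using assms by (simp add: smooth_manifold_def)
  then have "openin (mtop M) (fst \<kappa>)"
    and hm: "homeomorphic_map (subtopology (mtop M) (fst \<kappa>)) (top_of_set (snd \<kappa> ` fst \<kappa>)) (snd \<kappa>)"
    by (simp_all add: topological_chart_def)
  moreover have "inj_on (snd \<kappa>) (topspace (subtopology (mtop M) (fst \<kappa>)))"
    using hm by (rule homeomorphic_imp_injective_map)
  ultimately have "inj_on (snd \<kappa>) (fst \<kappa>)" by (metis openin_subset topspace_subtopology_subset)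
  with assms(3) show ?thesis by (simp add: inv_into_f_f)
qed

lemma chart_openin:
  assumes "smooth_manifold M" "\<kappa> \<in> atlas M"
  shows "openin (mtop M) (fst \<kappa>)"
  using assms by (auto simp: smooth_manifold_def topological_chart_def)

lemma chart_open_image:
  assumes "smooth_manifold M" "\<kappa> \<in> atlas M" "openin (mtop M) S" "S \<subseteq> fst \<kappa>"
  shows "open (snd \<kappa> ` S)"
proof -
  have "topological_chart (mtop M) \<kappa>" using assms by (simp add: smooth_manifold_def)
  then have o: "openin (mtop M) (fst \<kappa>)" "open (snd \<kappa> ` fst \<kappa>)"
    and "open_map (subtopology (mtop M) (fst \<kappa>)) (top_of_set (snd \<kappa> ` fst \<kappa>)) (snd \<kappa>)"
    by (auto simp: topological_chart_def homeomorphic_imp_open_map)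
  moreover have "openin (subtopology (mtop M) (fst \<kappa>)) S"
    using assms(3,4) o(1) by (simp add: openin_open_subtopology)
  ultimately have "openin (top_of_set (snd \<kappa> ` fst \<kappa>)) (snd \<kappa> ` S)"
    by (simp add: open_map_def)
  with o(2) show ?thesis by (metis openin_open_eq)
qed

lemma charts_at_nonempty:
  assumes "smooth_manifold M" "p \<in> points M"
  shows "\<exists>\<kappa>. \<kappa> \<in> charts_at M p"
proof -
  have "(\<Union>\<kappa>\<in>atlas M. fst \<kappa>) = points M" using assms(1) unfolding smooth_manifold_def by blast
  with assms(2) show ?thesis unfolding charts_at_def by blast
qed

lemma transition_differentiable:
  assumes "smooth_manifold M" "\<kappa> \<in> charts_at M p" "\<kappa>' \<in> charts_at M p"
  shows "(snd \<kappa>' \<circ> chart_inv \<kappa>) differentiable (at (snd \<kappa> p))"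
proof -
  have "smooth_compatible \<kappa> \<kappa>'" using assms by (auto simp: smooth_manifold_def charts_at_def)
  then have "smooth_on (snd \<kappa> ` (fst \<kappa> \<inter> fst \<kappa>')) (snd \<kappa>' \<circ> chart_inv \<kappa>)"
    by (simp add: smooth_compatible_def)
  then show ?thesis
    by (rule smooth_on_imp_differentiable) (use assms in \<open>auto simp: charts_at_def\<close>)
qed

lemma chart_rep_differentiable:
  assumes "smooth_map M M' \<phi>" "\<kappa> \<in> charts_at M p" "\<kappa>' \<in> charts_at M' (\<phi> p)"
  shows "chart_rep \<kappa> \<kappa>' \<phi> differentiable (at (snd \<kappa> p))"
proof -
  have "smooth_on (snd \<kappa> ` {p \<in> fst \<kappa>. \<phi> p \<in> fst \<kappa>'}) (chart_rep \<kappa> \<kappa>' \<phi>)"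
    using assms by (auto simp: smooth_map_def charts_at_def)
  then show ?thesis
    by (rule smooth_on_imp_differentiable) (use assms in \<open>auto simp: charts_at_def\<close>)
qed

lemma tangent_transition:
  assumes "v \<in> tangent_space M p" "\<kappa> \<in> charts_at M p" "\<kappa>' \<in> charts_at M p"
  shows "v \<kappa>' = frechet_derivative (snd \<kappa>' \<circ> chart_inv \<kappa>) (at (snd \<kappa> p)) (v \<kappa>)"
  using assms unfolding tangent_space_def by blast

lemma tangent_outside:
  "v \<in> tangent_space M p \<Longrightarrow> \<kappa> \<notin> charts_at M p \<Longrightarrow> v \<kappa> = 0"
  unfolding tangent_space_def by blast

lemma tangent_spaceI:
  assumes "\<And>\<kappa> \<kappa>'. \<kappa> \<in> charts_at M p \<Longrightarrow> \<kappa>' \<in> charts_at M p \<Longrightarrow>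
      v \<kappa>' = frechet_derivative (snd \<kappa>' \<circ> chart_inv \<kappa>) (at (snd \<kappa> p)) (v \<kappa>)"
    and "\<And>\<kappa>. \<kappa> \<notin> charts_at M p \<Longrightarrow> v \<kappa> = 0"
  shows "v \<in> tangent_space M p"
  using assms unfolding tangent_space_def by blast

lemma tangent_eqI:
  assumes "u \<in> tangent_space M p" "v \<in> tangent_space M p" "\<kappa> \<in> charts_at M p" "u \<kappa> = v \<kappa>"
  shows "u = v"
proof
  fix \<kappa>'
  show "u \<kappa>' = v \<kappa>'"
  proof (cases "\<kappa>' \<in> charts_at M p")
    case True
    from tangent_transition[OF assms(1,3) this] tangent_transition[OF assms(2,3) this] assms(4)
    show ?thesis by (simp only:)
  next
    case False
    with tangent_outside[OF assms(1)] tangent_outside[OF assms(2)] show ?thesis by simp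
  qed
qed

lemma subspace_tangent_space:
  assumes M: "smooth_manifold M"
  shows "subspace (tangent_space M p)"
proof -
  have lin: "linear (frechet_derivative (snd \<kappa>' \<circ> chart_inv \<kappa>) (at (snd \<kappa> p)))"
    if "\<kappa> \<in> charts_at M p" "\<kappa>' \<in> charts_at M p" for \<kappa> \<kappa>'
    using linear_frechet_derivative[OF transition_differentiable[OF M that]] .
  show ?thesis
  proof (rule subspaceI)
    show "0 \<in> tangent_space M p"
      by (rule tangent_spaceI) (simp_all add: zero_fun_def linear_0[OF lin])
  next
    fix u v assume uv: "u \<in> tangent_space M p" "v \<in> tangent_space M p"
    show "u + v \<in> tangent_space M p"
    proof (rule tangent_spaceI)
      fix \<kappa> \<kappa>' assume \<kappa>: "\<kappa> \<in> charts_at M p" "\<kappa>' \<in> charts_at M p"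
      show "(u + v) \<kappa>' = frechet_derivative (snd \<kappa>' \<circ> chart_inv \<kappa>) (at (snd \<kappa> p)) ((u + v) \<kappa>)"
        unfolding plus_fun_def linear_add[OF lin[OF \<kappa>]]
        using tangent_transition[OF uv(1) \<kappa>] tangent_transition[OF uv(2) \<kappa>] by (simp only:)
    qed (simp add: plus_fun_def tangent_outside[OF uv(1)] tangent_outside[OF uv(2)])
  next
    fix c v assume v: "v \<in> tangent_space M p"
    show "c *\<^sub>R v \<in> tangent_space M p"
    proof (rule tangent_spaceI)
      fix \<kappa> \<kappa>' assume \<kappa>: "\<kappa> \<in> charts_at M p" "\<kappa>' \<in> charts_at M p"
      show "(c *\<^sub>R v) \<kappa>' = frechet_derivative (snd \<kappa>' \<circ> chart_inv \<kappa>) (at (snd \<kappa> p)) ((c *\<^sub>R v) \<kappa>)"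
        unfolding scaleR_fun_def linear_cmul[OF lin[OF \<kappa>]]
        using tangent_transition[OF v \<kappa>] by (simp only:)
    qed (simp add: scaleR_fun_def tangent_outside[OF v])
  qed
qed

section \<open>The differential of a smooth map\<close>

lemma smooth_map_points: "smooth_map M M' \<phi> \<Longrightarrow> p \<in> points M \<Longrightarrow> \<phi> p \<in> points M'"
  by (auto simp: smooth_map_def continuous_map_def)

lemma smooth_map_openin_vimage:
  assumes "smooth_map M M' \<phi>" "openin (mtop M') S"
  shows "openin (mtop M) {p \<in> points M. \<phi> p \<in> S}"
  using assms by (auto simp: smooth_map_def continuous_map_def)

text \<open>The candidate is defined through one source chart \<open>\<kappa>0\<close>. Two
  applications of the chain rule complete it: \<open>src\<close> gives independence of the source
  chart, and \<open>tgt\<close> gives the transformation law in the target. Existence makes the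
  description in \<open>differential\<close> meaningful.\<close>

lemma differential_exists:
  assumes M: "smooth_manifold M" and M': "smooth_manifold M'" and \<phi>: "smooth_map M M' \<phi>"
    and p: "p \<in> points M" and v: "v \<in> tangent_space M p"
  shows "\<exists>u. u \<in> tangent_space M' (\<phi> p) \<and>
     (\<forall>\<kappa>\<in>charts_at M p. \<forall>\<kappa>'\<in>charts_at M' (\<phi> p).
        u \<kappa>' = frechet_derivative (chart_rep \<kappa> \<kappa>' \<phi>) (at (snd \<kappa> p)) (v \<kappa>))"
proof -
  obtain \<kappa>0 where \<kappa>0: "\<kappa>0 \<in> charts_at M p" using charts_at_nonempty[OF M p] by blast
  define u where "u = (\<lambda>\<kappa>'. if \<kappa>' \<in> charts_at M' (\<phi> p)
    then frechet_derivative (chart_rep \<kappa>0 \<kappa>' \<phi>) (at (snd \<kappa>0 p)) (v \<kappa>0) else 0)"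
  have src: "frechet_derivative (chart_rep \<kappa>0 \<kappa>' \<phi>) (at (snd \<kappa>0 p)) (v \<kappa>0) =
      frechet_derivative (chart_rep \<kappa> \<kappa>' \<phi>) (at (snd \<kappa> p)) (v \<kappa>)"
    if \<kappa>: "\<kappa> \<in> charts_at M p" and \<kappa>': "\<kappa>' \<in> charts_at M' (\<phi> p)" for \<kappa> \<kappa>'
  proof -
    have at: "\<kappa>0 \<in> atlas M" "p \<in> fst \<kappa>0" "\<kappa> \<in> atlas M" "p \<in> fst \<kappa>"
      using \<kappa> \<kappa>0 by (auto simp: charts_at_def)
    let ?S = "fst \<kappa>0 \<inter> fst \<kappa>"
    have x: "(snd \<kappa> \<circ> chart_inv \<kappa>0) (snd \<kappa>0 p) = snd \<kappa> p"
      using at by (simp add: chart_inv_chart[OF M])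
    have "frechet_derivative (chart_rep \<kappa>0 \<kappa>' \<phi>) (at (snd \<kappa>0 p)) (v \<kappa>0) =
        frechet_derivative (chart_rep \<kappa> \<kappa>' \<phi>) (at ((snd \<kappa> \<circ> chart_inv \<kappa>0) (snd \<kappa>0 p)))
          (frechet_derivative (snd \<kappa> \<circ> chart_inv \<kappa>0) (at (snd \<kappa>0 p)) (v \<kappa>0))"
    proof (rule frechet_derivative_chain_open)
      show "open (snd \<kappa>0 ` ?S)"
        using at by (intro chart_open_image[OF M] openin_Int chart_openin[OF M]) auto
      show "snd \<kappa>0 p \<in> snd \<kappa>0 ` ?S" using at by blast
      show "chart_rep \<kappa>0 \<kappa>' \<phi> y = chart_rep \<kappa> \<kappa>' \<phi> ((snd \<kappa> \<circ> chart_inv \<kappa>0) y)" if "y \<in> snd \<kappa>0 ` ?S" for y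
        using that at by (auto simp: chart_rep_def chart_inv_chart[OF M])
    qed (simp_all only: x transition_differentiable[OF M \<kappa>0 \<kappa>] chart_rep_differentiable[OF \<phi> \<kappa> \<kappa>'])
    then show ?thesis using tangent_transition[OF v \<kappa>0 \<kappa>] x by simp
  qed
  have tgt: "u \<kappa>2 = frechet_derivative (snd \<kappa>2 \<circ> chart_inv \<kappa>1) (at (snd \<kappa>1 (\<phi> p))) (u \<kappa>1)"
    if \<kappa>1: "\<kappa>1 \<in> charts_at M' (\<phi> p)" and \<kappa>2: "\<kappa>2 \<in> charts_at M' (\<phi> p)" for \<kappa>1 \<kappa>2
  proof -
    have at: "\<kappa>0 \<in> atlas M" "p \<in> fst \<kappa>0" "\<kappa>1 \<in> atlas M'" "\<phi> p \<in> fst \<kappa>1" "\<kappa>2 \<in> atlas M'" "\<phi> p \<in> fst \<kappa>2"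
      using \<kappa>0 \<kappa>1 \<kappa>2 by (auto simp: charts_at_def)
    let ?S = "fst \<kappa>0 \<inter> {p \<in> points M. \<phi> p \<in> fst \<kappa>1 \<inter> fst \<kappa>2}"
    have x: "chart_rep \<kappa>0 \<kappa>1 \<phi> (snd \<kappa>0 p) = snd \<kappa>1 (\<phi> p)"
      using at by (simp add: chart_inv_chart[OF M] chart_rep_def)
    have "frechet_derivative (chart_rep \<kappa>0 \<kappa>2 \<phi>) (at (snd \<kappa>0 p)) (v \<kappa>0) =
        frechet_derivative (snd \<kappa>2 \<circ> chart_inv \<kappa>1) (at (chart_rep \<kappa>0 \<kappa>1 \<phi> (snd \<kappa>0 p)))
          (frechet_derivative (chart_rep \<kappa>0 \<kappa>1 \<phi>) (at (snd \<kappa>0 p)) (v \<kappa>0))"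
    proof (rule frechet_derivative_chain_open)
      show "open (snd \<kappa>0 ` ?S)"
        using at by (intro chart_open_image[OF M] openin_Int chart_openin[OF M] smooth_map_openin_vimage[OF \<phi>]
            chart_openin[OF M']) auto
      show "snd \<kappa>0 p \<in> snd \<kappa>0 ` ?S" using at p by blast
      show "chart_rep \<kappa>0 \<kappa>2 \<phi> y = (snd \<kappa>2 \<circ> chart_inv \<kappa>1) (chart_rep \<kappa>0 \<kappa>1 \<phi> y)" if "y \<in> snd \<kappa>0 ` ?S" for y
        using that at by (auto simp: chart_rep_def chart_inv_chart[OF M] chart_inv_chart[OF M'])
    qed (simp_all only: x transition_differentiable[OF M' \<kappa>1 \<kappa>2] chart_rep_differentiable[OF \<phi> \<kappa>0 \<kappa>1])
    then show ?thesis using \<kappa>1 \<kappa>2 x by (simp add: u_def)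
  qed
  have "u \<in> tangent_space M' (\<phi> p)"
    by (rule tangent_spaceI[OF tgt]) (simp_all add: u_def)
  moreover have "u \<kappa>' = frechet_derivative (chart_rep \<kappa> \<kappa>' \<phi>) (at (snd \<kappa> p)) (v \<kappa>)"
    if "\<kappa> \<in> charts_at M p" "\<kappa>' \<in> charts_at M' (\<phi> p)" for \<kappa> \<kappa>'
    using src[OF that] that by (simp add: u_def)
  ultimately show ?thesis by blast
qed

lemma differential_props:
  assumes M: "smooth_manifold M" and M': "smooth_manifold M'" and \<phi>: "smooth_map M M' \<phi>"
    and p: "p \<in> points M" and v: "v \<in> tangent_space M p"
  shows differential_in_tangent_space: "differential M M' \<phi> p v \<in> tangent_space M' (\<phi> p)"
    and differential_chart: "\<kappa> \<in> charts_at M p \<Longrightarrow> \<kappa>' \<in> charts_at M' (\<phi> p) \<Longrightarrow>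
      differential M M' \<phi> p v \<kappa>' = frechet_derivative (chart_rep \<kappa> \<kappa>' \<phi>) (at (snd \<kappa> p)) (v \<kappa>)"
proof -
  let ?P = "\<lambda>u. u \<in> tangent_space M' (\<phi> p) \<and>
     (\<forall>\<kappa>\<in>charts_at M p. \<forall>\<kappa>'\<in>charts_at M' (\<phi> p).
        u \<kappa>' = frechet_derivative (chart_rep \<kappa> \<kappa>' \<phi>) (at (snd \<kappa> p)) (v \<kappa>))"
  obtain u where u: "?P u" using differential_exists[OF assms] by blast
  obtain \<kappa>0 where \<kappa>0: "\<kappa>0 \<in> charts_at M p" using charts_at_nonempty[OF M p] by blast
  obtain \<kappa>1 where \<kappa>1: "\<kappa>1 \<in> charts_at M' (\<phi> p)"
    using charts_at_nonempty[OF M' smooth_map_points[OF \<phi> p]] by blast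
  have "u' = u" if "?P u'" for u'
  proof (rule tangent_eqI[OF _ _ \<kappa>1])
    have "u' \<kappa>1 = frechet_derivative (chart_rep \<kappa>0 \<kappa>1 \<phi>) (at (snd \<kappa>0 p)) (v \<kappa>0)"
      and "u \<kappa>1 = frechet_derivative (chart_rep \<kappa>0 \<kappa>1 \<phi>) (at (snd \<kappa>0 p)) (v \<kappa>0)"
      using that u \<kappa>0 \<kappa>1 by blast+
    then show "u' \<kappa>1 = u \<kappa>1" by (simp only:)
  qed (use that u in blast)+
  then have "?P (THE u. ?P u)" by (rule theI[of ?P u, OF u])
  then have *: "?P (differential M M' \<phi> p v)" unfolding differential_def .
  from * show "differential M M' \<phi> p v \<in> tangent_space M' (\<phi> p)" by blast
  from * show "\<kappa> \<in> charts_at M p \<Longrightarrow> \<kappa>' \<in> charts_at M' (\<phi> p) \<Longrightarrow>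
      differential M M' \<phi> p v \<kappa>' = frechet_derivative (chart_rep \<kappa> \<kappa>' \<phi>) (at (snd \<kappa> p)) (v \<kappa>)" by blast
qed

section \<open>Ranks and the numbering of the index type\<close>

lemma rk_eq:
  assumes "subbundle_of_rank M k E" and p: "p \<in> points M"
  shows "rk M E = k"
proof -
  \<comment> \<open>The rank is compared at the given point \<open>p\<close>: on an empty manifold
    every number would be a rank.\<close>
  have "k1 = k2" if 1: "subbundle_of_rank M k1 E" and 2: "subbundle_of_rank M k2 E" for k1 k2
  proof -
    have "\<exists>B. finite B \<and> independent B \<and> card B = k \<and> span B = E p"
      if k: "subbundle_of_rank M k E" for k
    proof -
      obtain Y where "basis_family (\<lambda>i. Y i p) {..<k} (E p)"
        using k p unfolding subbundle_of_rank_def by blast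
      then show ?thesis
        by (intro exI[of _ "(\<lambda>i. Y i p) ` {..<k}"]) (simp add: basis_family_def card_image)
    qed
    then obtain B1 B2 where B: "finite B1" "independent B1" "card B1 = k1" "span B1 = E p"
      "finite B2" "independent B2" "card B2 = k2" "span B2 = E p" using 1 2 by metis
    have "card B1 \<le> card B2"
      by (rule independent_span_bound[OF B(5,2), THEN conjunct2]) (metis B(4,8) span_superset)
    moreover have "card B2 \<le> card B1"
      by (rule independent_span_bound[OF B(1,6), THEN conjunct2]) (metis B(4,8) span_superset)
    ultimately show ?thesis using B by simp
  qed
  with assms(1) show ?thesis unfolding rk_def by blast
qed

lemma card_atMost_le_iff: "card {..i} \<le> card {..j} \<longleftrightarrow> i \<le> j" for i j :: "'n::{finite,linorder}"
proof
  assume "card {..i} \<le> card {..j}"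
  show "i \<le> j"
  proof (rule ccontr)
    assume "\<not> i \<le> j"
    then have "{..j} \<subset> {..i}" by auto
    then have "card {..j} < card {..i}" by (rule psubset_card_mono[OF finite])
    with \<open>card {..i} \<le> card {..j}\<close> show False by simp
  qed
next
  assume "i \<le> j"
  then show "card {..i} \<le> card {..j}" by (intro card_mono finite) auto
qed

text \<open>The number of elements up to \<open>j\<close> is the position of \<open>j\<close> in the
  linear order, so it maps the index type bijectively onto \<open>{1..CARD('n)}\<close>.\<close>

lemma card_Collect_card_atMost_le:
  assumes "R \<le> CARD('n)"
  shows "card {j :: 'n::{finite,linorder}. card {..j} \<le> R} = R"
proof -
  let ?f = "\<lambda>j :: 'n. card {..j}"
  have inj: "inj ?f" by (rule injI) (metis card_atMost_le_iff order_antisym order_refl)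
  have "?f ` UNIV \<subseteq> {1..CARD('n)}" by (auto simp: Suc_le_eq card_gt_0_iff intro: card_mono[OF finite subset_UNIV])
  moreover have "card (?f ` UNIV) = card {1..CARD('n)}" using card_image[OF inj] by simp
  ultimately have "?f ` UNIV = {1..CARD('n)}" by (intro card_subset_eq) auto
  then have "?f ` {j. ?f j \<le> R} = {1..R}" using assms by (auto simp: set_eq_iff image_iff) (metis order_trans)
  then have "card (?f ` {j. ?f j \<le> R}) = R" by simp
  then show ?thesis using card_image[OF inj_on_subset[OF inj subset_UNIV]] by metis
qed

section \<open>Fibers, ranks and weights in the presence of a frame\<close>

locale carnot_frame =
  fixes r :: nat and M :: "('m, 'n::{finite,linorder}) mfd" and H :: "('m, 'n) filtration"
    and V :: "'m set" and X :: "'n \<Rightarrow> 'm \<Rightarrow> ('m, 'n) tangent" and a :: 'm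
  assumes carnot: "carnot_manifold r M H" and V: "openin (mtop M) V" and a: "a \<in> V"
    and frame: "H_frame_on M H V X"
begin

lemma M: "smooth_manifold M"
  using carnot by (simp add: carnot_manifold_def)

lemma r: "1 \<le> r"
  using carnot by (simp add: carnot_manifold_def)

lemma V_points: "p \<in> V \<Longrightarrow> p \<in> points M"
  using openin_subset[OF V] by blast

lemma fiber_zero: "p \<in> points M \<Longrightarrow> H 0 p = {0}"
  and fiber_top: "p \<in> points M \<Longrightarrow> H r p = tangent_space M p"
  using carnot by (simp_all add: carnot_manifold_def)

lemma fiber_Suc: "1 \<le> w \<Longrightarrow> w < r \<Longrightarrow> p \<in> points M \<Longrightarrow> H w p \<subseteq> H (Suc w) p"
  and subbundle_pos: "1 \<le> w \<Longrightarrow> w \<le> r \<Longrightarrow> \<exists>k. subbundle_of_rank M k (H w)"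
  using carnot by (simp_all add: carnot_manifold_def)

lemma fiber_mono: "w \<le> w' \<Longrightarrow> w' \<le> r \<Longrightarrow> p \<in> points M \<Longrightarrow> H w p \<subseteq> H w' p"
proof (induction w' rule: dec_induct)
  case (step w')
  have "H w' p \<subseteq> H (Suc w') p"
  proof (cases "w' = 0")
    \<comment> \<open>The chain condition starts at weight 1; the inclusion of the zero fiber holds
      because the first fiber is a span.\<close>
    case True
    obtain k where "subbundle_of_rank M k (H 1)" using subbundle_pos r by blast
    then obtain Y where "basis_family (\<lambda>i. Y i p) {..<k} (H 1 p)"
      using step.prems unfolding subbundle_of_rank_def by meson
    then have "H 1 p = span ((\<lambda>i. Y i p) ` {..<k})" by (simp only: basis_family_def)
    then have "0 \<in> H 1 p" by (simp only: span_zero)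
    with True step.prems show ?thesis by (simp add: fiber_zero)
  next
    case False
    with step.prems show ?thesis using fiber_Suc by simp
  qed
  with step show ?case by simp
qed simp

lemma subbundle: "w \<le> r \<Longrightarrow> \<exists>k. subbundle_of_rank M k (H w)"
proof (cases "w = 0")
  case True
  have "subbundle_of_rank M 0 (H 0)"
    unfolding subbundle_of_rank_def
    by (auto intro!: exI[of _ "points M"] simp: basis_family_def fiber_zero independent_empty)
  with True show ?thesis by blast
next
  case False
  moreover assume "w \<le> r"
  ultimately show ?thesis using subbundle_pos by simp
qed

lemma fiber_basis:
  assumes "p \<in> points M" "w \<le> r"
  shows "\<exists>B. finite B \<and> independent B \<and> card B = rk M (H w) \<and> span B = H w p"
proof -
  obtain k where k: "subbundle_of_rank M k (H w)" using subbundle assms by blast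
  then obtain Y where "basis_family (\<lambda>i. Y i p) {..<k} (H w p)"
    using assms unfolding subbundle_of_rank_def by blast
  with rk_eq[OF k assms(1)] show ?thesis
    by (intro exI[of _ "(\<lambda>i. Y i p) ` {..<k}"]) (simp add: basis_family_def card_image)
qed

lemma subspace_fiber: "p \<in> points M \<Longrightarrow> w \<le> r \<Longrightarrow> subspace (H w p)"
  by (metis fiber_basis subspace_span)

lemma rk_mono:
  assumes "w \<le> w'" "w' \<le> r"
  shows "rk M (H w) \<le> rk M (H w')"
proof -
  have p: "a \<in> points M" using a V_points by blast
  obtain B where B: "finite B" "independent B" "card B = rk M (H w)" "span B = H w a"
    using fiber_basis[OF p order_trans[OF assms]] by blast
  obtain B' where B': "finite B'" "independent B'" "card B' = rk M (H w')" "span B' = H w' a"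
    using fiber_basis[OF p assms(2)] by blast
  have "B \<subseteq> span B'" using fiber_mono[OF assms p] B(4) B'(4) span_superset by blast
  from independent_span_bound[OF B'(1) B(2) this] B B' show ?thesis by simp
qed

lemma frame_basis: "p \<in> V \<Longrightarrow> basis_family (\<lambda>j. X j p) UNIV (tangent_space M p)"
  and frame_section: "p \<in> V \<Longrightarrow> X j p \<in> H (weight M H j) p"
  and frame_vector_field: "vector_field_on M V (X j)"
  using frame by (auto simp: H_frame_on_def section_on_def)

lemma rk_zero: "rk M (H 0) = 0"
proof -
  obtain B where B: "finite B" "independent B" "card B = rk M (H 0)" "span B = H 0 a"
    using fiber_basis[OF V_points[OF a], of 0] by blast
  then have "B \<subseteq> {0}" using fiber_zero[OF V_points[OF a]] span_superset by metis
  moreover have "0 \<notin> B" using B(2) dependent_zero by blast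
  ultimately have "B = {}" by blast
  with B show ?thesis by simp
qed

lemma rk_top: "rk M (H r) = CARD('n)"
proof -
  have p: "a \<in> points M" using a V_points by blast
  obtain B where B: "finite B" "independent B" "card B = rk M (H r)" "span B = H r a"
    using fiber_basis[OF p order_refl] by blast
  let ?A = "(\<lambda>j. X j a) ` UNIV"
  have A: "independent ?A" "span ?A = H r a" "card ?A = CARD('n)"
    using frame_basis[OF a] fiber_top[OF p] by (auto simp: basis_family_def card_image)
  have "card ?A \<le> card B"
    by (rule independent_span_bound[OF B(1) A(1), THEN conjunct2]) (metis A(2) B(4) span_superset)
  moreover have "card B \<le> card ?A"
    by (rule independent_span_bound[OF _ B(2), THEN conjunct2]) (auto simp: A(2) B(4)[symmetric] span_base)
  ultimately show ?thesis using A B by simp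
qed

lemma weight_le: "weight M H j \<le> r"
  unfolding weight_def by (rule Least_le) (simp add: rk_top card_mono)

text \<open>Monotonicity of the ranks turns the minimum in \<open>weight\<close> into an
  equivalence. The bound \<open>w \<le> r\<close> is there because the filtration is arbitrary
  beyond the step.\<close>

lemma weight_le_iff:
  assumes "w \<le> r"
  shows "weight M H j \<le> w \<longleftrightarrow> card {..j} \<le> rk M (H w)"
proof
  assume *: "weight M H j \<le> w"
  have "card {..j} \<le> rk M (H (weight M H j))"
    unfolding weight_def by (rule LeastI[of _ r]) (simp add: rk_top card_mono)
  also have "\<dots> \<le> rk M (H w)" using * assms by (rule rk_mono)
  finally show "card {..j} \<le> rk M (H w)" .
next
  assume "card {..j} \<le> rk M (H w)"
  then show "weight M H j \<le> w" unfolding weight_def by (rule Least_le)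
qed

text \<open>The minimum in \<open>weight\<close> admits 0 as a candidate; it is excluded because the
  zero bundle has rank 0 while \<open>{..j}\<close> is nonempty.\<close>

lemma weight_pos: "1 \<le> weight M H j"
proof (rule ccontr)
  assume "\<not> 1 \<le> weight M H j"
  then have "card {..j} = 0" using weight_le_iff[of 0 j] rk_zero by simp
  then show False by auto
qed

lemma card_weight_le:
  assumes "w \<le> r"
  shows "card {j. weight M H j \<le> w} = rk M (H w)"
  using card_Collect_card_atMost_le[of "rk M (H w)", where 'n = 'n] rk_mono[OF assms order_refl] rk_top
  by (simp add: weight_le_iff[OF assms])

text \<open>The frame vectors of weight at most \<open>w\<close> lie in the fiber and are
  independent, and there are as many of them as the rank.\<close>

lemma fiber_eq_span:
  assumes p: "p \<in> V" and w: "w \<le> r"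
  shows "H w p = span ((\<lambda>j. X j p) ` {j. weight M H j \<le> w})"
proof -
  let ?A = "(\<lambda>j. X j p) ` {j. weight M H j \<le> w}"
  obtain B where B: "finite B" "independent B" "card B = rk M (H w)" "span B = H w p"
    using fiber_basis[OF V_points[OF p] w] by blast
  have basis: "inj (\<lambda>j. X j p)" "independent (range (\<lambda>j. X j p))"
    using frame_basis[OF p] by (auto simp: basis_family_def)
  have "independent ?A" by (rule independent_mono[OF basis(2)]) auto
  moreover have "?A \<subseteq> span B"
    using frame_section[OF p] fiber_mono[OF _ w V_points[OF p]] B(4) by blast
  moreover have "card ?A = card B"
    using card_image[OF inj_on_subset[OF basis(1) subset_UNIV]] card_weight_le[OF w] B(3) by metis
  ultimately show ?thesis using span_eq_of_card_eq[OF _ _ B(1)] B(4) by metis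
qed

lemma fiber_coefficients:
  assumes p: "p \<in> V" and w: "w \<le> r" and v: "v \<in> H w p"
  shows "\<exists>c. (\<forall>j. w < weight M H j \<longrightarrow> c $ j = 0) \<and> v = (\<Sum>j\<in>UNIV. (c $ j) *\<^sub>R X j p)"
proof -
  have "v \<in> span ((\<lambda>j. X j p) ` {j. weight M H j \<le> w})"
    using v fiber_eq_span[OF p w] by (simp only:)
  from span_image_coefficients[OF this finite]
  obtain c where c: "v = (\<Sum>j | weight M H j \<le> w. c j *\<^sub>R X j p)" by blast
  let ?c = "\<chi> j. if weight M H j \<le> w then c j else 0"
  have "v = (\<Sum>j\<in>UNIV. (?c $ j) *\<^sub>R X j p)"
    unfolding c by (rule sum.mono_neutral_cong_left) auto
  then show ?thesis by (intro exI[of _ ?c]) auto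
qed

end

section \<open>Carnot coordinates\<close>

locale carnot_chart = carnot_frame r M H V X a
  for r :: nat and M :: "('m, 'n::{finite,linorder}) mfd" and H :: "('m, 'n) filtration"
    and V :: "'m set" and X :: "'n \<Rightarrow> 'm \<Rightarrow> ('m, 'n) tangent" and a :: 'm +
  fixes \<kappa> :: "('m, 'n) chart"
  assumes coordinates: "carnot_coordinates r M H V X a \<kappa>"
begin

lemma chart: "\<kappa> \<in> atlas M" "a \<in> fst \<kappa>" "\<kappa> \<in> charts_at M a"
  and chart_subset: "fst \<kappa> \<subseteq> V"
  and chart_centered: "snd \<kappa> a = 0"
  and field_rep_zero: "field_rep \<kappa> (X j) 0 = axis j 1"
  using coordinates by (auto simp: carnot_coordinates_def charts_at_def)

lemma chart_inv_zero: "chart_inv \<kappa> 0 = a"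
  using chart_inv_chart[OF M chart(1,2)] chart_centered by simp

lemma frame_at_a: "X j a \<kappa> = axis j 1"
  using field_rep_zero[of j] by (simp add: field_rep_def chart_inv_zero)

lemma open_range: "open (snd \<kappa> ` fst \<kappa>)"
  by (rule chart_open_image[OF M chart(1) chart_openin[OF M chart(1)] order_refl])

lemma zero_in_range: "0 \<in> snd \<kappa> ` fst \<kappa>"
  using chart(2) chart_centered by force

lemma field_rep_differentiable: "field_rep \<kappa> (X j) differentiable (at 0)"
proof -
  have "fst \<kappa> \<inter> V = fst \<kappa>" using chart_subset by blast
  with frame_vector_field[of j] chart(1) have "smooth_on (snd \<kappa> ` fst \<kappa>) (field_rep \<kappa> (X j))"
    unfolding vector_field_on_def by metis
  then show ?thesis using zero_in_range by (rule smooth_on_imp_differentiable)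
qed

lemma frame_sum_chart:
  "(\<Sum>j\<in>J. c j *\<^sub>R X j a) \<kappa> $ i = (if i \<in> J then c i else 0)"
proof -
  have "(\<Sum>j\<in>J. c j *\<^sub>R X j a) \<kappa> $ i = (\<Sum>j\<in>J. if j = i then c j else 0)"
    unfolding sum_fun_apply sum_component scaleR_fun_def frame_at_a
    by (intro sum.cong refl) (auto simp: axis_def)
  then show ?thesis by simp
qed

lemma frame_in_tangent_space: "X j a \<in> tangent_space M a"
  using frame_section[OF a] fiber_mono[OF weight_le order_refl V_points[OF a]] fiber_top[OF V_points[OF a]]
  by blast

lemma subspace_tangent: "subspace (tangent_space M a)"
  by (rule subspace_tangent_space[OF M])

lemma frame_sum_in_tangent_space: "(\<Sum>j\<in>J. c j *\<^sub>R X j a) \<in> tangent_space M a"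
  by (intro subspace_sum[OF subspace_tangent] subspace_mul[OF subspace_tangent] frame_in_tangent_space)

lemma tangent_expand:
  assumes "v \<in> tangent_space M a"
  shows "v = (\<Sum>j\<in>UNIV. (v \<kappa> $ j) *\<^sub>R X j a)"
  by (rule tangent_eqI[OF assms frame_sum_in_tangent_space chart(3)])
     (simp add: vec_eq_iff frame_sum_chart)

text \<open>At the center the frame is the standard basis of the chart, so the filtration becomes
  the coordinate filtration by weights. This reduces computations with classes to
  components.\<close>

lemma fiber_iff:
  assumes w: "w \<le> r"
  shows "v \<in> H w a \<longleftrightarrow> v \<in> tangent_space M a \<and> (\<forall>j. w < weight M H j \<longrightarrow> v \<kappa> $ j = 0)"
proof safe
  assume v: "v \<in> H w a"
  then show "v \<in> tangent_space M a"
    using fiber_mono[OF w order_refl V_points[OF a]] fiber_top[OF V_points[OF a]] by blast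
  fix j assume "w < weight M H j"
  with fiber_coefficients[OF a w v] show "v \<kappa> $ j = 0"
    by (auto simp: frame_sum_chart)
next
  assume v: "v \<in> tangent_space M a" and zero: "\<forall>j. w < weight M H j \<longrightarrow> v \<kappa> $ j = 0"
  note S = subspace_fiber[OF V_points[OF a] w]
  have "(\<Sum>j\<in>UNIV. (v \<kappa> $ j) *\<^sub>R X j a) \<in> H w a"
  proof (rule subspace_sum[OF S])
    fix j
    show "(v \<kappa> $ j) *\<^sub>R X j a \<in> H w a"
    proof (cases "w < weight M H j")
      case True
      with zero show ?thesis using subspace_0[OF S] by simp
    next
      case False
      then have "X j a \<in> H w a"
        using frame_section[OF a] fiber_mono[OF _ w V_points[OF a]] by (meson not_less subsetD)
      then show ?thesis by (rule subspace_mul[OF S])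
    qed
  qed
  then show "v \<in> H w a" using tangent_expand[OF v] by metis
qed

text \<open>The coordinate formula of the Lie bracket of two frame fields at the center, where their
  values are standard basis vectors.\<close>

definition bracket_rep :: "'n \<Rightarrow> 'n \<Rightarrow> (real, 'n) vec" where
  "bracket_rep i j = frechet_derivative (field_rep \<kappa> (X j)) (at 0) (axis i 1)
     - frechet_derivative (field_rep \<kappa> (X i)) (at 0) (axis j 1)"

lemma bracket_section:
  assumes "openin (mtop M) V" "1 \<le> w" "1 \<le> w'" "w + w' \<le> r"
    and "section_on M (H w) V Y" "section_on M (H w') V Z"
  shows "section_on M (H (w + w')) V (lie_bracket M Y Z)"
proof -
  have "\<forall>V w w' X Y.
        openin (mtop M) V \<and> 1 \<le> w \<and> 1 \<le> w' \<and> w + w' \<le> r \<and>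
        section_on M (H w) V X \<and> section_on M (H w') V Y \<longrightarrow>
        section_on M (H (w + w')) V (lie_bracket M X Y)"
    using carnot unfolding carnot_manifold_def by (elim conjE)
  from this[rule_format, of V w w' Y Z] assms show ?thesis by simp
qed

lemma frame_section_on: "section_on M (H (weight M H j)) V (X j)"
  using frame by (simp add: H_frame_on_def)

lemma bracket_in_fiber:
  assumes ij: "weight M H i + weight M H j \<le> r"
  shows "lie_bracket M (X i) (X j) a \<in> H (weight M H i + weight M H j) a"
proof -
  have "section_on M (H (weight M H i + weight M H j)) V (lie_bracket M (X i) (X j))"
    by (rule bracket_section[OF V weight_pos weight_pos ij frame_section_on frame_section_on])
  then show ?thesis using a by (simp add: section_on_def)
qed

lemma lie_bracket_chart: "lie_bracket M (X i) (X j) a \<kappa> = bracket_rep i j"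
  by (simp add: lie_bracket_def chart(3) chart_centered frame_at_a bracket_rep_def)

text \<open>The weight hypothesis lets the bracket condition place the Lie bracket in a fiber, hence
  in the tangent space; there its coefficients in the frame are unique and are its components in the
  chart.\<close>

lemma structure_function_eq:
  assumes ij: "weight M H i + weight M H j \<le> r"
  shows "structure_function M X a i j k = bracket_rep i j $ k"
proof -
  let ?L = "lie_bracket M (X i) (X j) a"
  have "?L \<in> tangent_space M a" using bracket_in_fiber[OF ij] fiber_iff[OF ij] by blast
  note L = tangent_expand[OF this, unfolded lie_bracket_chart]
  have "structure_function M X a i j = (\<lambda>k. bracket_rep i j $ k)"
    unfolding structure_function_def
  proof (rule the_equality)
    show "?L = (\<Sum>k\<in>UNIV. (bracket_rep i j $ k) *\<^sub>R X k a)" by (rule L)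
    fix c assume "?L = (\<Sum>k\<in>UNIV. c k *\<^sub>R X k a)"
    then have "?L \<kappa> $ k = c k" for k by (simp add: frame_sum_chart)
    then show "c = (\<lambda>k. bracket_rep i j $ k)" by (simp add: lie_bracket_chart fun_eq_iff)
  qed
  then show ?thesis by simp
qed

lemma bracket_rep_eq_0:
  assumes "weight M H i + weight M H j \<le> r" "weight M H i + weight M H j < weight M H k"
  shows "bracket_rep i j $ k = 0"
  using bracket_in_fiber[OF assms(1)] fiber_iff[OF assms(1)] assms(2) lie_bracket_chart by metis

lemma frame_bracket_alternating: "frame_bracket M H X a v v = 0"
proof (rule frame_bracket_self)
  fix i j k assume "weight M H k = weight M H i + weight M H j"
  with weight_le[of k] show "structure_function M X a i j k = - structure_function M X a j i k"
    by (simp add: structure_function_eq add.commute bracket_rep_def)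
qed

lemma left_invariant_line:
  "(\<Sum>j\<in>UNIV. (v $ j) *\<^sub>R left_invariant_field r M H X a j (s *\<^sub>R v)) = v"
  by (rule left_invariant_field_on_line[OF frame_bracket_alternating r])

lemma field_dilation_limit:
  "dilation_limit (weight M H) (\<lambda>j. field_rep \<kappa> (X j)) (left_invariant_field r M H X a)"
proof (rule dilation_limitI)
  fix j
  obtain R where R: "0 < R" "cball 0 R \<subseteq> snd \<kappa> ` fst \<kappa>"
    using open_range zero_in_range open_contains_cball by blast
  have "smooth_topology_O_t (snd \<kappa> ` fst \<kappa>)
        (\<lambda>t x. t ^ weight M H j *\<^sub>R dilation_pullback (weight M H) t (field_rep \<kappa> (X j)) x)
        (left_invariant_field r M H X a j)"
    using coordinates by (simp add: carnot_coordinates_def)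
  \<comment> \<open>The empty list of partial derivatives yields uniform convergence of the fields
    themselves on a closed ball.\<close>
  with R(2) obtain C \<epsilon> where \<epsilon>: "0 < \<epsilon>" and *: "\<forall>t. 0 < \<bar>t\<bar> \<and> \<bar>t\<bar> < \<epsilon> \<longrightarrow> (\<forall>x\<in>cball 0 R.
      norm (iterated_partial [] (\<lambda>y. t ^ weight M H j *\<^sub>R dilation_pullback (weight M H) t (field_rep \<kappa> (X j)) y
        - left_invariant_field r M H X a j y) x) \<le> C * \<bar>t\<bar>)"
    unfolding smooth_topology_O_t_def using compact_cball by meson
  show "\<exists>R>0. \<exists>C. \<exists>\<epsilon>>0. \<forall>t x. 0 < t \<longrightarrow> t < \<epsilon> \<longrightarrow> norm x \<le> R \<longrightarrow>
     norm (t ^ weight M H j *\<^sub>R dilation_pullback (weight M H) t (field_rep \<kappa> (X j)) x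
       - left_invariant_field r M H X a j x) \<le> C * t"
  proof (rule exI[of _ R], rule conjI, rule R(1), rule exI[of _ C], rule exI[of _ \<epsilon>], rule conjI, rule \<epsilon>,
      intro allI impI)
    fix t :: real and x :: "(real, 'n) vec" assume "0 < t" "t < \<epsilon>" "norm x \<le> R"
    with *[rule_format, of t x] show "norm (t ^ weight M H j *\<^sub>R dilation_pullback (weight M H) t (field_rep \<kappa> (X j)) x
       - left_invariant_field r M H X a j x) \<le> C * t" by simp
  qed
qed

end

section \<open>A Carnot map read in two Carnot charts\<close>

lemma coset_eq:
  assumes S: "subspace S" and uv: "u - v \<in> S"
  shows "(\<lambda>h. u + h) ` S = (\<lambda>h. v + h) ` S"
proof -
  have 1: "(\<lambda>h. u + h) ` S \<subseteq> (\<lambda>h. v + h) ` S" if "u - v \<in> S" for u v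
  proof
    fix x assume "x \<in> (\<lambda>h. u + h) ` S"
    then obtain h where h: "h \<in> S" "x = u + h" by blast
    then have "x = v + ((u - v) + h)" by simp
    then show "x \<in> (\<lambda>h. v + h) ` S" using subspace_add[OF S that h(1)] by blast
  qed
  have "v - u \<in> S" using subspace_neg[OF S uv] by simp
  with 1 uv show ?thesis by blast
qed

locale carnot_map_chart =
  source: carnot_chart r M H V X a \<kappa> + target: carnot_chart r M' H' V' X' "\<phi> a" \<kappa>'
  for r :: nat and M :: "('m, 'n::{finite,linorder}) mfd" and H :: "('m, 'n) filtration"
    and V :: "'m set" and X :: "'n \<Rightarrow> 'm \<Rightarrow> ('m, 'n) tangent" and a :: 'm and \<kappa> :: "('m, 'n) chart"
    and M' :: "('m', 'k::{finite,linorder}) mfd" and H' :: "('m', 'k) filtration"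
    and V' :: "'m' set" and X' :: "'k \<Rightarrow> 'm' \<Rightarrow> ('m', 'k) tangent" and \<phi> :: "'m \<Rightarrow> 'm'"
    and \<kappa>' :: "('m', 'k) chart" +
  assumes map: "carnot_map r M H M' H' \<phi>" and chart_image: "\<phi> ` fst \<kappa> \<subseteq> fst \<kappa>'"
begin

lemma smooth: "smooth_map M M' \<phi>"
  using map by (simp add: carnot_map_def)

lemma smooth_rep: "smooth_on (snd \<kappa> ` fst \<kappa>) (chart_rep \<kappa> \<kappa>' \<phi>)"
proof -
  have "{p \<in> fst \<kappa>. \<phi> p \<in> fst \<kappa>'} = fst \<kappa>" using chart_image by blast
  moreover have "smooth_on (snd \<kappa> ` {p \<in> fst \<kappa>. \<phi> p \<in> fst \<kappa>'}) (chart_rep \<kappa> \<kappa>' \<phi>)"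
    using smooth source.chart(1) target.chart(1) unfolding smooth_map_def by blast
  ultimately show ?thesis by simp
qed

lemma differential_rep:
  assumes "p \<in> fst \<kappa>" "v \<in> tangent_space M p"
  shows "differential M M' \<phi> p v \<kappa>' = frechet_derivative (chart_rep \<kappa> \<kappa>' \<phi>) (at (snd \<kappa> p)) (v \<kappa>)"
proof (rule differential_chart[OF source.M target.M smooth _ assms(2)])
  show "p \<in> points M" using assms(1) source.chart_subset source.V_points by blast
  show "\<kappa> \<in> charts_at M p" using assms(1) source.chart by (simp add: charts_at_def)
  show "\<kappa>' \<in> charts_at M' (\<phi> p)" using assms(1) target.chart chart_image by (auto simp: charts_at_def)
qed

sublocale rep: frame_related_map "weight M H" "weight M' H'" "snd \<kappa> ` fst \<kappa>" "chart_rep \<kappa> \<kappa>' \<phi>"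
  "\<lambda>j. field_rep \<kappa> (X j)" "\<lambda>k. field_rep \<kappa>' (X' k)"
proof
  show "open (snd \<kappa> ` fst \<kappa>)" by (rule source.open_range)
  show "0 \<in> snd \<kappa> ` fst \<kappa>" by (rule source.zero_in_range)
  show "1 \<le> weight M H j" for j by (rule source.weight_pos)
  show "chart_rep \<kappa> \<kappa>' \<phi> 0 = 0"
    by (simp add: chart_rep_def source.chart_inv_zero target.chart_centered)
  show "chart_rep \<kappa> \<kappa>' \<phi> differentiable (at x)" if "x \<in> snd \<kappa> ` fst \<kappa>" for x
    by (rule smooth_on_imp_differentiable[OF smooth_rep that])
  show "(\<lambda>x. frechet_derivative (chart_rep \<kappa> \<kappa>' \<phi>) (at x) v) differentiable (at 0)" for v
    by (rule smooth_on_imp_twice_differentiable[OF smooth_rep source.zero_in_range])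
  show "field_rep \<kappa> (X j) differentiable (at 0)" for j by (rule source.field_rep_differentiable)
  show "field_rep \<kappa>' (X' k) differentiable (at 0)" for k by (rule target.field_rep_differentiable)
  show "field_rep \<kappa> (X j) 0 = axis j 1" for j by (rule source.field_rep_zero)
  show "field_rep \<kappa>' (X' k) 0 = axis k 1" for k by (rule target.field_rep_zero)
  fix x j assume "x \<in> snd \<kappa> ` fst \<kappa>"
  then obtain p where p: "p \<in> fst \<kappa>" "x = snd \<kappa> p" by blast
  have inv: "chart_inv \<kappa> x = p" using chart_inv_chart[OF source.M source.chart(1)] p by simp
  have pV: "p \<in> V" "\<phi> p \<in> fst \<kappa>'" "\<phi> p \<in> V'"
    using p source.chart_subset target.chart_subset chart_image by blast+
  have inv': "chart_inv \<kappa>' (chart_rep \<kappa> \<kappa>' \<phi> x) = \<phi> p"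
    using chart_inv_chart[OF target.M target.chart(1) pV(2)] by (simp add: chart_rep_def inv)
  let ?w = "weight M H j"
  have Xp: "X j p \<in> H ?w p" "X j p \<in> tangent_space M p"
    using source.frame_section[OF pV(1)] source.fiber_mono[OF source.weight_le order_refl source.V_points[OF pV(1)]]
      source.fiber_top[OF source.V_points[OF pV(1)]] by blast+
  \<comment> \<open>The Carnot property of the map is used here: the image stays in the subbundle of
    the same weight, so it expands in target fields of no larger weight.\<close>
  have "differential M M' \<phi> p (X j p) \<in> H' ?w (\<phi> p)"
  proof -
    have "?w \<in> {1..r}" using source.weight_pos source.weight_le by simp
    with map source.V_points[OF pV(1)] have "differential M M' \<phi> p ` H ?w p \<subseteq> H' ?w (\<phi> p)"
      unfolding carnot_map_def by blast
    with Xp(1) show ?thesis by blast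
  qed
  from target.fiber_coefficients[OF pV(3) source.weight_le this]
  obtain c where c: "\<forall>k. ?w < weight M' H' k \<longrightarrow> c $ k = 0"
    "differential M M' \<phi> p (X j p) = (\<Sum>k\<in>UNIV. (c $ k) *\<^sub>R X' k (\<phi> p))" by blast
  have "frechet_derivative (chart_rep \<kappa> \<kappa>' \<phi>) (at x) (field_rep \<kappa> (X j) x) = differential M M' \<phi> p (X j p) \<kappa>'"
    using differential_rep[OF p(1) Xp(2), folded p(2)] by (simp add: field_rep_def inv)
  also have "\<dots> = (\<Sum>k\<in>UNIV. (c $ k) *\<^sub>R field_rep \<kappa>' (X' k) (chart_rep \<kappa> \<kappa>' \<phi> x))"
    by (simp add: c(2) sum_fun_apply scaleR_fun_def field_rep_def inv')
  finally show "\<exists>c. (\<forall>k. ?w < weight M' H' k \<longrightarrow> c $ k = 0) \<and>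
      frechet_derivative (chart_rep \<kappa> \<kappa>' \<phi>) (at x) (field_rep \<kappa> (X j) x) =
      (\<Sum>k\<in>UNIV. (c $ k) *\<^sub>R field_rep \<kappa>' (X' k) (chart_rep \<kappa> \<kappa>' \<phi> x))"
    using c(1) by blast
qed

lemma derivative_at_0_component:
  "frechet_derivative (chart_rep \<kappa> \<kappa>' \<phi>) (at 0) x $ k = (\<Sum>j\<in>UNIV. x $ j * rep.c0 j $ k)"
proof -
  have "frechet_derivative (chart_rep \<kappa> \<kappa>' \<phi>) (at 0) x = (\<Sum>j\<in>UNIV. (x $ j) *\<^sub>R rep.c0 j)"
    using sum_axis_scaleR[of x] linear_sum[OF rep.linear_df[OF source.zero_in_range]]
      linear_cmul[OF rep.linear_df[OF source.zero_in_range]]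
    unfolding rep.c0_def by (metis (mono_tags, lifting) sum.cong)
  then show ?thesis by simp
qed

lemma hom_component: "rep.hom x $ k = (\<Sum>j\<in>UNIV. if weight M H j = weight M' H' k then x $ j * rep.c0 j $ k else 0)"
  by (simp add: rep.hom_def sum.If_cases Collect_conj_eq)

text \<open>A representative \<open>v\<close> of the class has prescribed components in all weights
  at least \<open>w\<close>. The components of its image in these weights depend on nothing else,
  because \<open>rep.c0 j $ k\<close> is zero when the target weight exceeds the source weight. So
  all representatives give the same coset.\<close>

lemma graded_class_image:
  assumes w: "w \<in> {1..r}"
  shows "(\<Union>v\<in>graded_class H a w (\<Sum>j | weight M H j = w. (x $ j) *\<^sub>R X j a).
      graded_class H' (\<phi> a) w (differential M M' \<phi> a v)) =
    graded_class H' (\<phi> a) w (\<Sum>k | weight M' H' k = w. (rep.hom x $ k) *\<^sub>R X' k (\<phi> a))"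
proof -
  have wr: "w - 1 \<le> r" using w by auto
  let ?s = "\<Sum>j | weight M H j = w. (x $ j) *\<^sub>R X j a"
  let ?s' = "\<Sum>k | weight M' H' k = w. (rep.hom x $ k) *\<^sub>R X' k (\<phi> a)"
  note S = source.subspace_fiber[OF source.V_points[OF source.a] wr]
  note S' = target.subspace_fiber[OF target.V_points[OF target.a] wr]
  have "graded_class H' (\<phi> a) w (differential M M' \<phi> a v) = graded_class H' (\<phi> a) w ?s'"
    if "v \<in> graded_class H a w ?s" for v
  proof -
    from that obtain h where h: "h \<in> H (w - 1) a" "v = ?s + h" by (auto simp: graded_class_def)
    have h': "h \<in> tangent_space M a" "\<And>j. w - 1 < weight M H j \<Longrightarrow> h \<kappa> $ j = 0"
      using h(1) source.fiber_iff[OF wr] by auto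
    have v: "v \<in> tangent_space M a"
      unfolding h(2) by (intro subspace_add[OF source.subspace_tangent] source.frame_sum_in_tangent_space h')
    have v\<kappa>: "v \<kappa> $ j = (if weight M H j = w then x $ j else 0)" if "w \<le> weight M H j" for j
      using h'(2)[of j] that w by (auto simp: h(2) plus_fun_def source.frame_sum_chart)
    have "differential M M' \<phi> a v - ?s' \<in> H' (w - 1) (\<phi> a)"
      unfolding target.fiber_iff[OF wr]
    proof (intro conjI allI impI)
      show "differential M M' \<phi> a v - ?s' \<in> tangent_space M' (\<phi> a)"
        by (intro subspace_diff[OF target.subspace_tangent] target.frame_sum_in_tangent_space
            differential_in_tangent_space[OF source.M target.M smooth source.V_points[OF source.a] v])
      fix k assume "w - 1 < weight M' H' k"
      then have k: "w \<le> weight M' H' k" using w by auto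
      have "differential M M' \<phi> a v \<kappa>' $ k = (\<Sum>j\<in>UNIV. v \<kappa> $ j * rep.c0 j $ k)"
        by (simp add: differential_rep[OF source.chart(2) v] source.chart_centered derivative_at_0_component)
      also have "\<dots> = (\<Sum>j\<in>UNIV. if weight M H j = weight M' H' k then
          (if weight M' H' k = w then x $ j * rep.c0 j $ k else 0) else 0)"
      proof (intro sum.cong refl)
        fix j
        consider "weight M H j < weight M' H' k" | "weight M' H' k \<le> weight M H j" by linarith
        then show "v \<kappa> $ j * rep.c0 j $ k = (if weight M H j = weight M' H' k then
          (if weight M' H' k = w then x $ j * rep.c0 j $ k else 0) else 0)"
        proof cases
          case 1
          then show ?thesis using rep.c0_eq_0 by simp
        next
          case 2
          then show ?thesis using k v\<kappa>[of j] by auto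
        qed
      qed
      also have "\<dots> = (if weight M' H' k = w then rep.hom x $ k else 0)"
        by (cases "weight M' H' k = w") (simp_all add: hom_component cong: if_cong)
      finally show "(differential M M' \<phi> a v - ?s') \<kappa>' $ k = 0"
        by (simp add: fun_diff_def target.frame_sum_chart)
    qed
    then show ?thesis unfolding graded_class_def by (rule coset_eq[OF S'])
  qed
  \<comment> \<open>The class is nonempty, so the union of equal cosets is that coset.\<close>
  moreover have "?s \<in> graded_class H a w ?s"
    using subspace_0[OF S] by (force simp: graded_class_def)
  ultimately show ?thesis by blast
qed

text \<open>Two representatives of the class of degree equal to the weight of \<open>k\<close>
  differ by an element of the next smaller fiber, whose component \<open>k\<close> is zero.\<close>

lemma graded_frame_map_inj:
  assumes eq: "graded_frame_map r M' H' X' (\<phi> a) y = graded_frame_map r M' H' X' (\<phi> a) z"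
  shows "y = z"
  unfolding vec_eq_iff
proof
  fix k
  let ?w = "weight M' H' k"
  let ?s = "\<lambda>y. \<Sum>k | weight M' H' k = ?w. (y $ k) *\<^sub>R X' k (\<phi> a)"
  have w: "?w \<in> {1..r}" "?w - 1 \<le> r" "?w - 1 < ?w"
    using target.weight_pos[of k] target.weight_le[of k] by auto
  have "graded_class H' (\<phi> a) ?w (?s y) = graded_class H' (\<phi> a) ?w (?s z)"
    using fun_cong[OF eq, of ?w] w(1) by (simp add: graded_frame_map_def)
  moreover have "?s y \<in> graded_class H' (\<phi> a) ?w (?s y)"
    using subspace_0[OF target.subspace_fiber[OF target.V_points[OF target.a] w(2)]]
    by (force simp: graded_class_def)
  ultimately have "?s y \<in> graded_class H' (\<phi> a) ?w (?s z)" by simp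
  then obtain h where h: "h \<in> H' (?w - 1) (\<phi> a)" "?s y = ?s z + h" unfolding graded_class_def by blast
  have "h \<kappa>' $ k = 0" using h(1) target.fiber_iff[OF w(2)] w(3) by blast
  moreover have "?s y \<kappa>' $ k = ?s z \<kappa>' $ k + h \<kappa>' $ k" using h(2) by (simp add: plus_fun_def)
  ultimately show "y $ k = z $ k" by (simp add: target.frame_sum_chart)
qed

lemma carnot_differential_coords_eq:
  "carnot_differential_coords r M H X M' H' X' \<phi> a = rep.hom"
proof
  fix x
  have "graded_frame_map r M' H' X' (\<phi> a) (rep.hom x) =
      carnot_differential r M M' H' \<phi> a (graded_frame_map r M H X a x)"
  proof
    fix w
    \<comment> \<open>For degrees outside \<open>{1..r}\<close> both tuples take the default value
      \<open>undefined\<close>.\<close>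
    show "graded_frame_map r M' H' X' (\<phi> a) (rep.hom x) w =
        carnot_differential r M M' H' \<phi> a (graded_frame_map r M H X a x) w"
      using graded_class_image[of w x]
      by (cases "w \<in> {1..r}")
        (simp_all add: graded_frame_map_def carnot_differential_def del: atLeastAtMost_iff)
  qed
  then show "carnot_differential_coords r M H X M' H' X' \<phi> a x = rep.hom x"
    unfolding carnot_differential_coords_def
    by (intro the_equality) (metis graded_frame_map_inj)+
qed

section \<open>Compatibility with dilations, brackets and products\<close>

lemma hom_w_homogeneous: "w_homogeneous (weight M H) (weight M' H') rep.hom"
  by (simp add: w_homogeneous_def rep.hom_def dilation_def vec_eq_iff sum_distrib_left mult.assoc)

text \<open>Only components of weight equal to the sum of the two weights can be nonzero on either
  side. In these, the graded map and the graded brackets may be replaced by the full derivative at 0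
  and the full brackets, since the extra terms vanish; the claim then is
  \<open>rep.bracket_related\<close>.\<close>

lemma hom_frame_bracket_axis:
  "rep.hom (frame_bracket M H X a (axis i 1) (axis j 1)) =
    frame_bracket M' H' X' (\<phi> a) (rep.hom (axis i 1)) (rep.hom (axis j 1))"
  unfolding vec_eq_iff
proof
  fix m
  let ?w = "weight M H" and ?w' = "weight M' H'"
  let ?L = "structure_function M X a" and ?L' = "structure_function M' X' (\<phi> a)"
  have FB: "frame_bracket M H X a (axis i 1) (axis j 1) $ k = (if ?w k = ?w i + ?w j then ?L i j k else 0)" for k
    unfolding frame_bracket_axis by (simp add: axis_def if_distrib sum.If_cases cong: if_cong)
  have FB': "(\<Sum>k | ?w' k = ?w' p + ?w' q. ?L' p q k * axis k (1::real) $ m)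
      = (if ?w' m = ?w' p + ?w' q then ?L' p q m else 0)" for p q
    by (simp add: axis_def if_distrib sum.If_cases cong: if_cong)
  have hom_axis: "rep.hom (axis l 1) $ k = (if ?w l = ?w' k then rep.c0 l $ k else 0)" for l k
  proof -
    have "rep.hom (axis l 1) $ k = (\<Sum>j\<in>UNIV. if j = l then (if ?w j = ?w' k then rep.c0 j $ k else 0) else 0)"
      unfolding hom_component by (intro sum.cong refl) (auto simp: axis_def)
    then show ?thesis by simp
  qed
  have lhs: "rep.hom (frame_bracket M H X a (axis i 1) (axis j 1)) $ m =
      (\<Sum>k\<in>UNIV. if ?w k = ?w' m then (if ?w k = ?w i + ?w j then ?L i j k else 0) * rep.c0 k $ m else 0)"
    by (simp only: hom_component FB)
  have rhs: "frame_bracket M' H' X' (\<phi> a) (rep.hom (axis i 1)) (rep.hom (axis j 1)) $ m =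
      (\<Sum>p\<in>UNIV. \<Sum>q\<in>UNIV. (if ?w i = ?w' p then rep.c0 i $ p else 0) * (if ?w j = ?w' q then rep.c0 j $ q else 0) *
         (if ?w' m = ?w' p + ?w' q then ?L' p q m else 0))"
    by (simp add: frame_bracket_def hom_axis FB')
  show "rep.hom (frame_bracket M H X a (axis i 1) (axis j 1)) $ m =
    frame_bracket M' H' X' (\<phi> a) (rep.hom (axis i 1)) (rep.hom (axis j 1)) $ m"
  proof (cases "?w' m = ?w i + ?w j")
    case False
    have "rep.hom (frame_bracket M H X a (axis i 1) (axis j 1)) $ m = 0"
      unfolding lhs using False by (intro sum.neutral) auto
    moreover have "frame_bracket M' H' X' (\<phi> a) (rep.hom (axis i 1)) (rep.hom (axis j 1)) $ m = 0"
      unfolding rhs using False by (intro sum.neutral ballI) auto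
    ultimately show ?thesis by simp
  next
    case True
    then have ijr: "?w i + ?w j \<le> r" using target.weight_le[of m] by simp
    \<comment> \<open>Weights are at least 1, so the weight of \<open>m\<close> exceeds both
      summands, as \<open>rep.bracket_related\<close> demands.\<close>
    have lt: "?w i < ?w' m" "?w j < ?w' m"
      using True source.weight_pos[of i] source.weight_pos[of j] by simp_all
    have "rep.hom (frame_bracket M H X a (axis i 1) (axis j 1)) $ m =
        (\<Sum>k\<in>UNIV. source.bracket_rep i j $ k * rep.c0 k $ m)"
      unfolding lhs
    proof (intro sum.cong refl)
      fix k
      \<comment> \<open>Terms of smaller weight vanish through the derivative, terms of larger
        weight through the bracket.\<close>
      consider "?w k < ?w' m" | "?w k = ?w' m" | "?w' m < ?w k" by linarith
      then show "(if ?w k = ?w' m then (if ?w k = ?w i + ?w j then ?L i j k else 0) * rep.c0 k $ m else 0) =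
          source.bracket_rep i j $ k * rep.c0 k $ m"
      proof cases
        case 1 then show ?thesis by (simp add: rep.c0_eq_0)
      next
        case 2 then show ?thesis using True ijr by (simp add: source.structure_function_eq)
      next
        case 3 then show ?thesis using True ijr by (simp add: source.bracket_rep_eq_0)
      qed
    qed
    also have "\<dots> = frechet_derivative (chart_rep \<kappa> \<kappa>' \<phi>) (at 0) (source.bracket_rep i j) $ m"
      by (simp add: derivative_at_0_component)
    also have "\<dots> = (\<Sum>p\<in>UNIV. \<Sum>q\<in>UNIV. rep.c0 i $ p * rep.c0 j $ q * target.bracket_rep p q $ m)"
      unfolding source.bracket_rep_def target.bracket_rep_def by (rule rep.bracket_related[OF lt])
    also have "\<dots> = frame_bracket M' H' X' (\<phi> a) (rep.hom (axis i 1)) (rep.hom (axis j 1)) $ m"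
      unfolding rhs
    proof (intro sum.cong refl)
      fix p q
      \<comment> \<open>In the last case the bracket of two fields of smaller total weight has no
        component \<open>m\<close>.\<close>
      consider "?w i < ?w' p" | "?w j < ?w' q" | "?w' p = ?w i" "?w' q = ?w j"
        | "?w' p \<le> ?w i" "?w' q \<le> ?w j" "?w' p + ?w' q < ?w i + ?w j" by linarith
      then show "rep.c0 i $ p * rep.c0 j $ q * target.bracket_rep p q $ m =
          (if ?w i = ?w' p then rep.c0 i $ p else 0) * (if ?w j = ?w' q then rep.c0 j $ q else 0) *
         (if ?w' m = ?w' p + ?w' q then ?L' p q m else 0)"
      proof cases
        case 1 then show ?thesis by (simp add: rep.c0_eq_0)
      next
        case 2 then show ?thesis by (simp add: rep.c0_eq_0)
      next
        case 3 then show ?thesis using True ijr by (simp add: target.structure_function_eq)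
      next
        case 4
        then have "target.bracket_rep p q $ m = 0" using True ijr by (intro target.bracket_rep_eq_0) auto
        with 4 True show ?thesis by simp
      qed
    qed
    finally show ?thesis .
  qed
qed

lemma hom_frame_bracket:
  "rep.hom (frame_bracket M H X a x y) = frame_bracket M' H' X' (\<phi> a) (rep.hom x) (rep.hom y)"
proof -
  note lin = rep.linear_hom
  note B = bilinear_frame_bracket[of M H X a] and B' = bilinear_frame_bracket[of M' H' X' "\<phi> a"]
  have "bilinear (\<lambda>x y. rep.hom (frame_bracket M H X a x y))"
    unfolding bilinear_def
    by (auto intro!: linearI simp: bilinear_ladd[OF B] bilinear_radd[OF B] bilinear_lmul[OF B] bilinear_rmul[OF B]
        linear_add[OF lin] linear_cmul[OF lin])
  moreover have "bilinear (\<lambda>x y. frame_bracket M' H' X' (\<phi> a) (rep.hom x) (rep.hom y))"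
    unfolding bilinear_def
    by (auto intro!: linearI simp: bilinear_ladd[OF B'] bilinear_radd[OF B'] bilinear_lmul[OF B'] bilinear_rmul[OF B']
        linear_add[OF lin] linear_cmul[OF lin])
  ultimately have "(\<lambda>x y. rep.hom (frame_bracket M H X a x y)) =
      (\<lambda>x y. frame_bracket M' H' X' (\<phi> a) (rep.hom x) (rep.hom y))"
    by (rule bilinear_eq_stdbasis) (auto simp: Basis_vec_def hom_frame_bracket_axis)
  from fun_cong[OF fun_cong[OF this]] show ?thesis .
qed

lemma hom_group_mult:
  "rep.hom (frame_group_mult r M H X a x y) = frame_group_mult r M' H' X' (\<phi> a) (rep.hom x) (rep.hom y)"
  unfolding frame_group_mult_def by (rule dynkin_product_hom[where \<Phi> = rep.hom, OF rep.linear_hom])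
    (rule hom_frame_bracket)

text \<open>Every \<open>x \<noteq> 0\<close> with small \<open>N x\<close> is a dilate of a point
  \<open>z\<close> with \<open>N z = c\<close>, which lies in the ball of the uniform estimate.
  Dilating that estimate back multiplies component \<open>k\<close> by \<open>t\<close> to the power
  of its weight, and the error O(t) supplies the additional power.\<close>

lemma rep_asymptotics:
  assumes N: "pseudo_norm (weight M H) N"
  shows "is_Ow (weight M' H') N 1 (\<lambda>x. chart_rep \<kappa> \<kappa>' \<phi> x - rep.hom x)"
proof -
  let ?w = "weight M H" and ?w' = "weight M' H'" and ?f = "chart_rep \<kappa> \<kappa>' \<phi>"
  obtain \<rho> C \<epsilon> where \<rho>: "0 < \<rho>" and \<epsilon>: "0 < \<epsilon>" and
    est: "\<And>t x. 0 < t \<Longrightarrow> t < \<epsilon> \<Longrightarrow> norm x \<le> \<rho> \<Longrightarrow> norm (rep.rescaled t x - rep.hom x) \<le> C * t"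
    using rep.rescaled_tendsto_hom[OF source.field_dilation_limit left_invariant_field_lipschitz
        source.left_invariant_line target.field_dilation_limit left_invariant_field_lipschitz
        target.left_invariant_line] by blast
  obtain c where c: "0 < c" "\<And>z. N z \<le> c \<Longrightarrow> norm z \<le> \<rho>"
    using pseudo_norm_small_imp_small[OF N source.weight_pos \<rho>] by blast
  have Nhom: "N (dilation ?w t x) = \<bar>t\<bar> * N x" and Npos: "x \<noteq> 0 \<Longrightarrow> 0 < N x" and Nnn: "0 \<le> N x" for t x
    using N by (auto simp: pseudo_norm_def)
  have "dilation ?w 0 0 = 0" by (simp add: dilation_def vec_eq_iff)
  with Nhom[of 0 0] have N0: "N 0 = 0" by simp
  have "isCont N 0" using N by (simp add: pseudo_norm_def continuous_on_eq_continuous_at)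
  then have "(N \<longlongrightarrow> N 0) (nhds 0)"
    by (simp add: continuous_at tendsto_at_iff_tendsto_nhds)
  then have ev: "\<forall>\<^sub>F x in nhds 0. N x < c * \<epsilon>"
    using c(1) \<epsilon> N0 by (intro order_tendstoD(2)) auto
  have bound: "\<bar>(?f x - rep.hom x) $ k\<bar> \<le> C / c ^ (?w' k + 1) * N x ^ (?w' k + 1)" if x: "N x < c * \<epsilon>" for x k
  proof (cases "x = 0")
    \<comment> \<open>The origin belongs to the filter but is not a dilate of a point with
      \<open>N z = c\<close> by a positive parameter; there both sides vanish.\<close>
    case True
    then show ?thesis by (simp add: rep.f_zero linear_0[OF rep.linear_hom] N0)
  next
    case False
    define t where "t = N x / c"
    have t: "0 < t" "t < \<epsilon>" using Npos[OF False] c(1) x by (simp_all add: t_def pos_divide_less_eq mult.commute)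
    define z where "z = dilation ?w (inverse t) x"
    have xz: "dilation ?w t z = x" using t by (simp add: z_def dilation_inverse)
    have "N z = c" using t Npos[OF False] c(1) by (simp add: z_def Nhom t_def)
    then have "norm z \<le> \<rho>" using c(2) by simp
    have "?f x = dilation ?w' t (rep.rescaled t z)"
      using t by (simp add: rep.rescaled_def xz dilation_inverse)
    moreover have "rep.hom x = dilation ?w' t (rep.hom z)"
      using hom_w_homogeneous xz unfolding w_homogeneous_def by metis
    ultimately have "\<bar>(?f x - rep.hom x) $ k\<bar> = t ^ ?w' k * \<bar>(rep.rescaled t z - rep.hom z) $ k\<bar>"
      using t by (simp add: dilation_def right_diff_distrib[symmetric] abs_mult)
    also have "\<dots> \<le> t ^ ?w' k * (C * t)"
      using t est[OF t \<open>norm z \<le> \<rho>\<close>] component_le_norm_cart[of "rep.rescaled t z - rep.hom z" k]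
      by (intro mult_left_mono) auto
    also have "\<dots> = C / c ^ (?w' k + 1) * N x ^ (?w' k + 1)"
      by (simp add: t_def power_divide mult.commute mult.left_commute)
    finally show ?thesis .
  qed
  show ?thesis
    unfolding is_Ow_def
  proof
    fix k
    show "(\<lambda>x. (?f x - rep.hom x) $ k) \<in> O[nhds 0](\<lambda>x. N x ^ (?w' k + 1))"
    proof (rule bigoI)
      show "\<forall>\<^sub>F x in nhds 0. norm ((?f x - rep.hom x) $ k) \<le> C / c ^ (?w' k + 1) * norm (N x ^ (?w' k + 1))"
        using ev
      proof eventually_elim
        case (elim x)
        with bound[of x k] Nnn[of x] show ?case by simp
      qed
    qed
  qed
qed

end

theorem theorem6p4:
  fixes M :: "('m, 'n::{finite,linorder}) mfd"
    and M' :: "('m', 'k::{finite,linorder}) mfd"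
    and H :: "('m, 'n) filtration"
    and H' :: "('m', 'k) filtration"
    and r :: nat
    and \<phi> :: "'m \<Rightarrow> 'm'"
    and a :: 'm
    and V :: "'m set"
    and V' :: "'m' set"
    and X :: "'n \<Rightarrow> 'm \<Rightarrow> ('m, 'n) tangent"
    and X' :: "'k \<Rightarrow> 'm' \<Rightarrow> ('m', 'k) tangent"
    and \<kappa> :: "('m, 'n) chart"
    and \<kappa>' :: "('m', 'k) chart"
    and N :: "(real, 'n) vec \<Rightarrow> real"
  assumes "carnot_manifold r M H"
    and "carnot_manifold r M' H'"
    and "carnot_map r M H M' H' \<phi>"
    and "a \<in> points M"
    and "openin (mtop M) V" and "a \<in> V" and "H_frame_on M H V X"
    and "openin (mtop M') V'" and "\<phi> a \<in> V'" and "H_frame_on M' H' V' X'"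
    and "carnot_coordinates r M H V X a \<kappa>"
    and "carnot_coordinates r M' H' V' X' (\<phi> a) \<kappa>'"
    and "\<phi> ` fst \<kappa> \<subseteq> fst \<kappa>'"
    and "pseudo_norm (weight M H) N"
  defines "\<Phi> \<equiv> carnot_differential_coords r M H X M' H' X' \<phi> a"
  shows "linear \<Phi> \<and>
    w_homogeneous (weight M H) (weight M' H') \<Phi> \<and>
    (\<forall>x y. \<Phi> (frame_group_mult r M H X a x y) =
      frame_group_mult r M' H' X' (\<phi> a) (\<Phi> x) (\<Phi> y)) \<and>
    is_Ow (weight M' H') N 1 (\<lambda>x. chart_rep \<kappa> \<kappa>' \<phi> x - \<Phi> x)"
proof -
  interpret carnot_map_chart r M H V X a \<kappa> M' H' V' X' \<phi> \<kappa>'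
    using assms by unfold_locales
  have "\<Phi> = rep.hom" unfolding \<Phi>_def by (rule carnot_differential_coords_eq)
  then show ?thesis
    using rep.linear_hom hom_w_homogeneous hom_group_mult
      rep_asymptotics[OF \<open>pseudo_norm (weight M H) N\<close>] by simp
qed

end
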